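(* Let $\mathfrak{g}$ be a finite-dimensional complex Lie algebra with a symmetric nondegenerate $\mathrm{ad}$-invariant bilinear form, let $U_q\mathfrak{g}$ be the corresponding Drinfeld–Jimbo quantum group, and let $\mathcal{Z}=Z(U_q\mathfrak{g})$ be its center. Let $M$, $N$ and $V$ be $U_q\mathfrak{g}$-modules. Then $M\otimes N\otimes V^{\otimes k}$ is a $\mathcal{Z}\mathcal{B}_k^{\mathrm{ext}}$-module (where $\mathcal{Z}\mathcal{B}_k^{\mathrm{ext}}$ is the group algebra of $\mathcal{B}_k^{\mathrm{ext}}$ over $\mathcal{Z}$, and $\mathcal{Z}$ acts through the $U_q\mathfrak{g}$-action on the tensor product) with action $\Phi\colon\mathcal{Z}\mathcal{B}_k^{\mathrm{ext}}\to\mathrm{End}_{U_q\mathfrak{g}}(M\otimes N\otimes V^{\otimes k})$ given by $$T_i\mapsto\check{R}_i\ (1\le i\le k-1),\quad X_1\mapsto\check{R}_M^2,\quad Y_1\mapsto\check{R}_N^2,\quad Z_1\mapsto\check{R}_0^2,\quad P\mapsto(\check{R}_{MN}\check{R}_{NM})\otimes\mathrm{id}_V^{\otimes k},$$ where $$\check{R}_0^2=(\check{R}_{(M\otimes N)V}\check{R}_{V(M\otimes N)})\otimes\mathrm{id}_V^{\otimes(k-1)},\qquad \check{R}_i=\mathrm{id}_M\otimes\mathrm{id}_N\otimes\mathrm{id}_V^{\otimes(i-1)}\otimes\check{R}_{VV}\otimes\mathrm{id}_V^{\otimes(k-i-1)},$$ $$\check{R}_M^2=\big((\mathrm{id}_M\otimes\check{R}_{NV})((\check{R}_{MV}\check{R}_{VM})\otimes\mathrm{id}_N)(\mathrm{id}_M\otimes\check{R}_{NV}^{-1})\big)\otimes\mathrm{id}_V^{\otimes(k-1)},$$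 $$\check{R}_N^2=\mathrm{id}_M\otimes(\check{R}_{NV}\check{R}_{VN})\otimes\mathrm{id}_V^{\otimes(k-1)}.$$ Moreover, this $\mathcal{Z}\mathcal{B}_k^{\mathrm{ext}}$-action commutes with the $U_q\mathfrak{g}$-action on $M\otimes N\otimes V^{\otimes k}$.
   Context: Let $k\ge1$. The extended two boundary braid group $\mathcal{B}_k^{\mathrm{ext}}$ is the group with generators $X_1,Y_1,Z_1,T_1,\dots,T_{k-1},P$ and relations (those involving nonexistent generators are omitted): $T_iT_{i+1}T_i=T_{i+1}T_iT_{i+1}$ for $1\le i\le k-2$; $T_iT_j=T_jT_i$ for $|i-j|\ge2$; for each $A\in\{X_1,Y_1,Z_1\}$, $AT_1AT_1=T_1AT_1A$ and $AT_i=T_iA$ for $2\le i\le k-1$; $Z_1=X_1Y_1$; $PX_1P^{-1}=Z_1^{-1}X_1Z_1$; $PY_1P^{-1}=Z_1^{-1}Y_1Z_1$; $PZ_1P^{-1}=Z_1$; $PT_iP^{-1}=T_i$ for $1\le i\le k-1$. $U_q\mathfrak{g}$ is regarded, as is customary, as a ribbon (in particular quasitriangular) Hopf algebra with invertible $R$-matrix $R=\sum R_1\otimes R_2\in U_q\mathfrak{g}\otimes U_q\mathfrak{g}$. For $U_q\mathfrak{g}$-modules $M,N$ the map $\check{R}_{MN}\colon N\otimes M\to M\otimes N$, $n\otimes m\mapsto\sum R_2m\otimes R_1n$, is a $U_q\mathfrak{g}$-module isomorphism; these maps are natural, satisfy the braid relation, and satisfy the cabling identities $\check{R}_{(M\otimes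 N)V}=(\mathrm{id}_M\otimes\check{R}_{NV})(\check{R}_{MV}\otimes\mathrm{id}_N)$ and $\check{R}_{M(N\otimes V)}=(\check{R}_{MN}\otimes\mathrm{id}_V)(\mathrm{id}_N\otimes\check{R}_{MV})$. *)

theory Defs
  imports Complex_Main "HOL-Algebra.Module" "HOL-Algebra.AbelCoset"
begin

section \<open>Multiple tensor products of modules over a commutative ring\<close>

text \<open>
  The tensor product of a list of modules over a commutative ring \<open>K\<close> is the free module on
  the tuples, divided by the relations of multilinearity. Working with lists makes the tensor
  product strictly associative, so that \<open>M \<otimes> N \<otimes> V \<otimes> \<dots> \<otimes> V\<close> needs no bracketing and has the
  same HOL type for every number of factors. The product of the empty list is \<open>K\<close>.

  The ring fields \<open>mult\<close> and \<open>one\<close> of a record that is only used as a module carry no meaning.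
\<close>

definition free_module :: "'k ring \<Rightarrow> 'x set \<Rightarrow> ('k, 'x \<Rightarrow> 'k) module" where
  "free_module K B =
    \<lparr>carrier = {f. (\<forall>x. f x \<in> carrier K) \<and> finite {x. f x \<noteq> \<zero>\<^bsub>K\<^esub>} \<and> {x. f x \<noteq> \<zero>\<^bsub>K\<^esub>} \<subseteq> B},
     mult = undefined, one = undefined,
     zero = (\<lambda>x. \<zero>\<^bsub>K\<^esub>), add = (\<lambda>f g x. f x \<oplus>\<^bsub>K\<^esub> g x),
     smult = (\<lambda>c f x. c \<otimes>\<^bsub>K\<^esub> f x)\<rparr>"

definition free_gen :: "'k ring \<Rightarrow> 'x \<Rightarrow> 'x \<Rightarrow> 'k" where
  "free_gen K x = (\<lambda>y. if y = x then \<one>\<^bsub>K\<^esub> else \<zero>\<^bsub>K\<^esub>)"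

definition quotient_module :: "('k, 'a) module \<Rightarrow> 'a set \<Rightarrow> ('k, 'a set) module" where
  "quotient_module M H =
    \<lparr>carrier = a_rcosets\<^bsub>M\<^esub> H,
     mult = undefined, one = undefined,
     zero = H, add = set_add M,
     smult = (\<lambda>c X. \<Union>x\<in>X. H +>\<^bsub>M\<^esub> (c \<odot>\<^bsub>M\<^esub> x))\<rparr>"

definition tuples :: "('k, 'v, 'e) module_scheme list \<Rightarrow> 'v list set" where
  "tuples Ms = listset (map carrier Ms)"

definition multilinear_gens ::
    "'k ring \<Rightarrow> ('k, 'v, 'e) module_scheme list \<Rightarrow> ('v list \<Rightarrow> 'k) set" where
  "multilinear_gens K Ms =
    {free_gen K (xs[i := a \<oplus>\<^bsub>Ms ! i\<^esub> b])
        \<ominus>\<^bsub>free_module K (tuples Ms)\<^esub>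
          (free_gen K (xs[i := a]) \<oplus>\<^bsub>free_module K (tuples Ms)\<^esub> free_gen K (xs[i := b]))
      | xs i a b. xs \<in> tuples Ms \<and> i < length Ms \<and> a \<in> carrier (Ms ! i) \<and> b \<in> carrier (Ms ! i)}
    \<union>
    {free_gen K (xs[i := c \<odot>\<^bsub>Ms ! i\<^esub> a])
        \<ominus>\<^bsub>free_module K (tuples Ms)\<^esub>
          (c \<odot>\<^bsub>free_module K (tuples Ms)\<^esub> free_gen K (xs[i := a]))
      | xs i c a. xs \<in> tuples Ms \<and> i < length Ms \<and> c \<in> carrier K \<and> a \<in> carrier (Ms ! i)}"

definition multilinear_rels ::
    "'k ring \<Rightarrow> ('k, 'v, 'e) module_scheme list \<Rightarrow> ('v list \<Rightarrow> 'k) set" where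
  "multilinear_rels K Ms =
    \<Inter>{H. submodule H K (free_module K (tuples Ms)) \<and> multilinear_gens K Ms \<subseteq> H}"

definition tensor ::
    "'k ring \<Rightarrow> ('k, 'v, 'e) module_scheme list \<Rightarrow> ('k, ('v list \<Rightarrow> 'k) set) module" where
  "tensor K Ms = quotient_module (free_module K (tuples Ms)) (multilinear_rels K Ms)"

definition pure_tensor ::
    "'k ring \<Rightarrow> ('k, 'v, 'e) module_scheme list \<Rightarrow> 'v list \<Rightarrow> ('v list \<Rightarrow> 'k) set" where
  "pure_tensor K Ms xs = multilinear_rels K Ms +>\<^bsub>free_module K (tuples Ms)\<^esub> free_gen K xs"

text \<open>
  The linear map out of the tensor product that is induced by a multilinear map \<open>g\<close> into the
  module \<open>L\<close>, that is, \<open>pure_tensor K Ms xs \<mapsto> g xs\<close>. It is evaluated on a representative, and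
  it is meaningful only if \<open>g\<close> is multilinear.
\<close>

definition tensor_lift ::
    "'k ring \<Rightarrow> ('k, 'v, 'e) module_scheme list \<Rightarrow> ('k, 'w, 'f) module_scheme \<Rightarrow> ('v list \<Rightarrow> 'w)
      \<Rightarrow> ('v list \<Rightarrow> 'k) set \<Rightarrow> 'w" where
  "tensor_lift K Ms L g X =
    (let f = (SOME f. f \<in> X) in \<Oplus>\<^bsub>L\<^esub>xs\<in>{xs. f xs \<noteq> \<zero>\<^bsub>K\<^esub>}. f xs \<odot>\<^bsub>L\<^esub> g xs)"

definition tensor_append ::
    "'k ring \<Rightarrow> ('k, 'v, 'e) module_scheme list \<Rightarrow> ('k, 'v, 'e) module_scheme list
      \<Rightarrow> ('v list \<Rightarrow> 'k) set \<Rightarrow> ('v list \<Rightarrow> 'k) set \<Rightarrow> ('v list \<Rightarrow> 'k) set" where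
  "tensor_append K As Bs X Y =
    tensor_lift K As (tensor K (As @ Bs))
      (\<lambda>xs. tensor_lift K Bs (tensor K (As @ Bs)) (\<lambda>ys. pure_tensor K (As @ Bs) (xs @ ys)) Y) X"


section \<open>Ribbon Hopf algebras\<close>

text \<open>
  A Hopf algebra over the commutative ring \<open>scalars U\<close>. The inherited record fields are the ring
  structure of \<open>U\<close> and its scalar multiplication; \<open>comult\<close> takes values in, and \<open>rmatrix\<close> is an
  element of, \<open>tensor (scalars U) [U, U]\<close>.
\<close>

record ('k, 'u) ribbon_hopf = "('k, 'u) module" +
  scalars :: "'k ring"
  comult :: "'u \<Rightarrow> ('u list \<Rightarrow> 'k) set"
  counit :: "'u \<Rightarrow> 'k"
  antipode :: "'u \<Rightarrow> 'u"
  rmatrix :: "('u list \<Rightarrow> 'k) set"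
  ribbon :: "'u"

definition tpow :: "('k, 'u) ribbon_hopf \<Rightarrow> nat \<Rightarrow> ('k, ('u list \<Rightarrow> 'k) set) module" where
  "tpow U n = tensor (scalars U) (replicate n U)"

definition ptens :: "('k, 'u) ribbon_hopf \<Rightarrow> 'u list \<Rightarrow> ('u list \<Rightarrow> 'k) set" where
  "ptens U us = pure_tensor (scalars U) (replicate (length us) U) us"

definition tpow_mult :: "('k, 'u) ribbon_hopf \<Rightarrow> nat \<Rightarrow>
    ('u list \<Rightarrow> 'k) set \<Rightarrow> ('u list \<Rightarrow> 'k) set \<Rightarrow> ('u list \<Rightarrow> 'k) set" where
  "tpow_mult U n X Y =
    tensor_lift (scalars U) (replicate n U) (tpow U n)
      (\<lambda>as. tensor_lift (scalars U) (replicate n U) (tpow U n)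
         (\<lambda>bs. ptens U (map2 (\<lambda>a b. a \<otimes>\<^bsub>U\<^esub> b) as bs)) Y) X"

text \<open>\<open>sweedler U L g X\<close> is \<open>\<Sum> g X\<^sub>1 X\<^sub>2\<close> in \<open>L\<close> for \<open>X = \<Sum> X\<^sub>1 \<otimes> X\<^sub>2\<close> in \<open>U \<otimes> U\<close>.\<close>

definition sweedler :: "('k, 'u) ribbon_hopf \<Rightarrow> ('k, 'w, 'f) module_scheme \<Rightarrow>
    ('u \<Rightarrow> 'u \<Rightarrow> 'w) \<Rightarrow> ('u list \<Rightarrow> 'k) set \<Rightarrow> 'w" where
  "sweedler U L g = tensor_lift (scalars U) [U, U] L (\<lambda>us. g (us ! 0) (us ! 1))"

definition flip :: "('k, 'u) ribbon_hopf \<Rightarrow> ('u list \<Rightarrow> 'k) set \<Rightarrow> ('u list \<Rightarrow> 'k) set" where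
  "flip U = sweedler U (tpow U 2) (\<lambda>a b. ptens U [b, a])"

definition comult_id :: "('k, 'u) ribbon_hopf \<Rightarrow> ('u list \<Rightarrow> 'k) set \<Rightarrow> ('u list \<Rightarrow> 'k) set" where
  "comult_id U = sweedler U (tpow U 3)
    (\<lambda>a b. tensor_append (scalars U) [U, U] [U] (comult U a) (ptens U [b]))"

definition id_comult :: "('k, 'u) ribbon_hopf \<Rightarrow> ('u list \<Rightarrow> 'k) set \<Rightarrow> ('u list \<Rightarrow> 'k) set" where
  "id_comult U = sweedler U (tpow U 3)
    (\<lambda>a b. tensor_append (scalars U) [U] [U, U] (ptens U [a]) (comult U b))"

definition is_linear ::
    "'k ring \<Rightarrow> ('k, 'v, 'e) module_scheme \<Rightarrow> ('k, 'w, 'f) module_scheme \<Rightarrow> ('v \<Rightarrow> 'w) \<Rightarrow> bool" where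
  "is_linear K M L f \<longleftrightarrow>
    f \<in> carrier M \<rightarrow> carrier L \<and>
    (\<forall>x\<in>carrier M. \<forall>y\<in>carrier M. f (x \<oplus>\<^bsub>M\<^esub> y) = f x \<oplus>\<^bsub>L\<^esub> f y) \<and>
    (\<forall>c\<in>carrier K. \<forall>x\<in>carrier M. f (c \<odot>\<^bsub>M\<^esub> x) = c \<odot>\<^bsub>L\<^esub> f x)"

definition center :: "('a, 'e) ring_scheme \<Rightarrow> 'a set" where
  "center A = {z \<in> carrier A. \<forall>a\<in>carrier A. z \<otimes>\<^bsub>A\<^esub> a = a \<otimes>\<^bsub>A\<^esub> z}"

text \<open>The library locale \<open>algebra\<close> is for commutative algebras only.\<close>

locale assoc_algebra = ring A + module K A
  for K :: "'k ring" and A :: "('k, 'u, 'e) module_scheme" (structure) +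
  assumes smult_mult_left:
      "\<lbrakk>c \<in> carrier K; a \<in> carrier A; b \<in> carrier A\<rbrakk> \<Longrightarrow> (c \<odot> a) \<otimes> b = c \<odot> (a \<otimes> b)"
    and smult_mult_right:
      "\<lbrakk>c \<in> carrier K; a \<in> carrier A; b \<in> carrier A\<rbrakk> \<Longrightarrow> a \<otimes> (c \<odot> b) = c \<odot> (a \<otimes> b)"

locale hopf_algebra = assoc_algebra "scalars U" U for U :: "('k, 'u) ribbon_hopf" (structure) +
  assumes comult_linear: "is_linear (scalars U) U (tpow U 2) (comult U)"
    and comult_mult: "\<lbrakk>a \<in> carrier U; b \<in> carrier U\<rbrakk>
      \<Longrightarrow> comult U (a \<otimes> b) = tpow_mult U 2 (comult U a) (comult U b)"
    and comult_one: "comult U \<one> = ptens U [\<one>, \<one>]"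
    and counit_hom: "counit U \<in> ring_hom U (scalars U)"
    and counit_smult: "\<lbrakk>c \<in> carrier (scalars U); a \<in> carrier U\<rbrakk>
      \<Longrightarrow> counit U (c \<odot> a) = c \<otimes>\<^bsub>scalars U\<^esub> counit U a"
    and coassoc: "a \<in> carrier U \<Longrightarrow> comult_id U (comult U a) = id_comult U (comult U a)"
    and counit_left: "a \<in> carrier U \<Longrightarrow> sweedler U U (\<lambda>x y. counit U x \<odot> y) (comult U a) = a"
    and counit_right: "a \<in> carrier U \<Longrightarrow> sweedler U U (\<lambda>x y. counit U y \<odot> x) (comult U a) = a"
    and antipode_linear: "is_linear (scalars U) U U (antipode U)"
    and antipode_left: "a \<in> carrier U
      \<Longrightarrow> sweedler U U (\<lambda>x y. antipode U x \<otimes> y) (comult U a) = counit U a \<odot> \<one>"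
    and antipode_right: "a \<in> carrier U
      \<Longrightarrow> sweedler U U (\<lambda>x y. x \<otimes> antipode U y) (comult U a) = counit U a \<odot> \<one>"

definition R12 :: "('k, 'u) ribbon_hopf \<Rightarrow> ('u list \<Rightarrow> 'k) set" where
  "R12 U = sweedler U (tpow U 3) (\<lambda>a b. ptens U [a, b, \<one>\<^bsub>U\<^esub>]) (rmatrix U)"

definition R13 :: "('k, 'u) ribbon_hopf \<Rightarrow> ('u list \<Rightarrow> 'k) set" where
  "R13 U = sweedler U (tpow U 3) (\<lambda>a b. ptens U [a, \<one>\<^bsub>U\<^esub>, b]) (rmatrix U)"

definition R23 :: "('k, 'u) ribbon_hopf \<Rightarrow> ('u list \<Rightarrow> 'k) set" where
  "R23 U = sweedler U (tpow U 3) (\<lambda>a b. ptens U [\<one>\<^bsub>U\<^esub>, a, b]) (rmatrix U)"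

locale quasitriangular_hopf_algebra = hopf_algebra +
  assumes rmatrix_closed: "rmatrix U \<in> carrier (tpow U 2)"
    and rmatrix_invertible: "\<exists>R' \<in> carrier (tpow U 2).
      tpow_mult U 2 (rmatrix U) R' = ptens U [\<one>, \<one>] \<and> tpow_mult U 2 R' (rmatrix U) = ptens U [\<one>, \<one>]"
    and rmatrix_comult: "a \<in> carrier U
      \<Longrightarrow> tpow_mult U 2 (rmatrix U) (comult U a) = tpow_mult U 2 (flip U (comult U a)) (rmatrix U)"
    and comult_id_rmatrix: "comult_id U (rmatrix U) = tpow_mult U 3 (R13 U) (R23 U)"
    and id_comult_rmatrix: "id_comult U (rmatrix U) = tpow_mult U 3 (R13 U) (R12 U)"

text \<open>The Drinfeld element \<open>\<Sum> S(R\<^sub>2) R\<^sub>1\<close>.\<close>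

definition drinfeld_element :: "('k, 'u) ribbon_hopf \<Rightarrow> 'u" where
  "drinfeld_element U = sweedler U U (\<lambda>a b. antipode U b \<otimes>\<^bsub>U\<^esub> a) (rmatrix U)"

locale ribbon_hopf_algebra = quasitriangular_hopf_algebra +
  assumes ribbon_central: "ribbon U \<in> center U"
    and ribbon_square:
      "ribbon U \<otimes> ribbon U = drinfeld_element U \<otimes> antipode U (drinfeld_element U)"
    and ribbon_antipode: "antipode U (ribbon U) = ribbon U"
    and ribbon_counit: "counit U (ribbon U) = \<one>\<^bsub>scalars U\<^esub>"
    and ribbon_comult:
      "tpow_mult U 2 (tpow_mult U 2 (flip U (rmatrix U)) (rmatrix U)) (comult U (ribbon U))
        = ptens U [ribbon U, ribbon U]"


section \<open>Lie algebras with an invariant form\<close>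

text \<open>
  The quantum group attached to such a Lie algebra is, as is customary, regarded as a ribbon Hopf
  algebra with an R-matrix in \<open>U \<otimes> U\<close>. (For the algebra given by the Drinfeld--Jimbo presentation
  the R-matrix lies in a completion only, so the presentation cannot be imposed literally on such
  a \<open>U\<close>.) Therefore no relation between the structure below and \<open>U\<close> is encoded: results are stated
  for every ribbon Hopf algebra \<open>U\<close> over every commutative ground ring.
\<close>

locale quadratic_lie_algebra = vector_space scale
  for scale :: "complex \<Rightarrow> 'g::ab_group_add \<Rightarrow> 'g" +
  fixes bracket :: "'g \<Rightarrow> 'g \<Rightarrow> 'g" and form :: "'g \<Rightarrow> 'g \<Rightarrow> complex"
  assumes finite_dimensional: "\<exists>B. finite B \<and> span B = UNIV"
    and bracket_add_left: "bracket (x + y) z = bracket x z + bracket y z"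
    and bracket_add_right: "bracket x (y + z) = bracket x y + bracket x z"
    and bracket_scale_left: "bracket (scale c x) y = scale c (bracket x y)"
    and bracket_scale_right: "bracket x (scale c y) = scale c (bracket x y)"
    and bracket_self: "bracket x x = 0"
    and jacobi: "bracket x (bracket y z) + bracket y (bracket z x) + bracket z (bracket x y) = 0"
    and form_add_left: "form (x + y) z = form x z + form y z"
    and form_scale_left: "form (scale c x) y = c * form x y"
    and form_sym: "form x y = form y x"
    and form_nondegenerate: "(\<forall>y. form x y = 0) \<Longrightarrow> x = 0"
    and form_ad_invariant: "form (bracket x y) z + form y (bracket x z) = 0"


section \<open>Modules over a Hopf algebra and their tensor products\<close>

text \<open>The library locale \<open>module\<close> requires a commutative ring.\<close>

locale left_module = R?: ring R + M?: abelian_group M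
  for R :: "('a, 'r) ring_scheme" (structure) and M :: "('a, 'b, 'm) module_scheme" (structure) +
  assumes action_closed: "\<lbrakk>a \<in> carrier R; x \<in> carrier M\<rbrakk> \<Longrightarrow> a \<odot>\<^bsub>M\<^esub> x \<in> carrier M"
    and action_l_distr: "\<lbrakk>a \<in> carrier R; b \<in> carrier R; x \<in> carrier M\<rbrakk>
      \<Longrightarrow> (a \<oplus> b) \<odot>\<^bsub>M\<^esub> x = a \<odot>\<^bsub>M\<^esub> x \<oplus>\<^bsub>M\<^esub> b \<odot>\<^bsub>M\<^esub> x"
    and action_r_distr: "\<lbrakk>a \<in> carrier R; x \<in> carrier M; y \<in> carrier M\<rbrakk>
      \<Longrightarrow> a \<odot>\<^bsub>M\<^esub> (x \<oplus>\<^bsub>M\<^esub> y) = a \<odot>\<^bsub>M\<^esub> x \<oplus>\<^bsub>M\<^esub> a \<odot>\<^bsub>M\<^esub> y"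
    and action_mult: "\<lbrakk>a \<in> carrier R; b \<in> carrier R; x \<in> carrier M\<rbrakk>
      \<Longrightarrow> (a \<otimes> b) \<odot>\<^bsub>M\<^esub> x = a \<odot>\<^bsub>M\<^esub> (b \<odot>\<^bsub>M\<^esub> x)"
    and action_one: "x \<in> carrier M \<Longrightarrow> \<one> \<odot>\<^bsub>M\<^esub> x = x"

text \<open>A module over \<open>U\<close> as a module over the ground ring, along \<open>c \<mapsto> c \<odot> \<one>\<close>.\<close>

definition restr :: "('k, 'u) ribbon_hopf \<Rightarrow> ('u, 'v) module \<Rightarrow> ('k, 'v) module" where
  "restr U M = \<lparr>carrier = carrier M, mult = mult M, one = one M, zero = zero M, add = add M,
     smult = (\<lambda>c x. (c \<odot>\<^bsub>U\<^esub> \<one>\<^bsub>U\<^esub>) \<odot>\<^bsub>M\<^esub> x)\<rparr>"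

definition tens ::
    "('k, 'u) ribbon_hopf \<Rightarrow> ('u, 'v) module list \<Rightarrow> ('k, ('v list \<Rightarrow> 'k) set) module" where
  "tens U Ms = tensor (scalars U) (map (restr U) Ms)"

definition ptens_of ::
    "('k, 'u) ribbon_hopf \<Rightarrow> ('u, 'v) module list \<Rightarrow> 'v list \<Rightarrow> ('v list \<Rightarrow> 'k) set" where
  "ptens_of U Ms xs = pure_tensor (scalars U) (map (restr U) Ms) xs"

definition tlift :: "('k, 'u) ribbon_hopf \<Rightarrow> ('u, 'v) module list \<Rightarrow>
    ('k, 'w, 'f) module_scheme \<Rightarrow> ('v list \<Rightarrow> 'w) \<Rightarrow> ('v list \<Rightarrow> 'k) set \<Rightarrow> 'w" where
  "tlift U Ms = tensor_lift (scalars U) (map (restr U) Ms)"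

definition tappend :: "('k, 'u) ribbon_hopf \<Rightarrow> ('u, 'v) module list \<Rightarrow> ('u, 'v) module list \<Rightarrow>
    ('v list \<Rightarrow> 'k) set \<Rightarrow> ('v list \<Rightarrow> 'k) set \<Rightarrow> ('v list \<Rightarrow> 'k) set" where
  "tappend U As Bs = tensor_append (scalars U) (map (restr U) As) (map (restr U) Bs)"

text \<open>The iterated coproduct with values in the \<open>n\<close>-th tensor power of \<open>U\<close>; for \<open>n = 0\<close> it is
  the counit.\<close>

fun iter_comult :: "('k, 'u) ribbon_hopf \<Rightarrow> nat \<Rightarrow> 'u \<Rightarrow> ('u list \<Rightarrow> 'k) set" where
  "iter_comult U 0 a = counit U a \<odot>\<^bsub>tpow U 0\<^esub> ptens U []"
| "iter_comult U (Suc n) a =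
    sweedler U (tpow U (Suc n))
      (\<lambda>x y. tensor_append (scalars U) [U] (replicate n U) (ptens U [x]) (iter_comult U n y))
      (comult U a)"

text \<open>The action \<open>(u\<^sub>1 \<otimes> \<dots> \<otimes> u\<^sub>n) (x\<^sub>1 \<otimes> \<dots> \<otimes> x\<^sub>n) = u\<^sub>1 x\<^sub>1 \<otimes> \<dots> \<otimes> u\<^sub>n x\<^sub>n\<close> of the tensor power of \<open>U\<close>,
  and the resulting action of \<open>U\<close>.\<close>

definition tpow_act :: "('k, 'u) ribbon_hopf \<Rightarrow> ('u, 'v) module list \<Rightarrow>
    ('u list \<Rightarrow> 'k) set \<Rightarrow> ('v list \<Rightarrow> 'k) set \<Rightarrow> ('v list \<Rightarrow> 'k) set" where
  "tpow_act U Ms X Y =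
    tensor_lift (scalars U) (replicate (length Ms) U) (tens U Ms)
      (\<lambda>us. tlift U Ms (tens U Ms)
        (\<lambda>xs. ptens_of U Ms (map (\<lambda>i. us ! i \<odot>\<^bsub>Ms ! i\<^esub> xs ! i) [0..<length Ms])) Y) X"

definition tact :: "('k, 'u) ribbon_hopf \<Rightarrow> ('u, 'v) module list \<Rightarrow>
    'u \<Rightarrow> ('v list \<Rightarrow> 'k) set \<Rightarrow> ('v list \<Rightarrow> 'k) set" where
  "tact U Ms a = tpow_act U Ms (iter_comult U (length Ms) a)"

definition tensor_module ::
    "('k, 'u) ribbon_hopf \<Rightarrow> ('u, 'v) module list \<Rightarrow> ('u, ('v list \<Rightarrow> 'k) set) module" where
  "tensor_module U Ms =
    \<lparr>carrier = carrier (tens U Ms), mult = undefined, one = undefined,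
     zero = \<zero>\<^bsub>tens U Ms\<^esub>, add = add (tens U Ms), smult = tact U Ms\<rparr>"

definition End_ring :: "('a, 'r) ring_scheme \<Rightarrow> ('a, 'b, 'm) module_scheme \<Rightarrow> ('b \<Rightarrow> 'b) ring" where
  "End_ring R W =
    \<lparr>carrier = {f \<in> carrier W \<rightarrow>\<^sub>E carrier W.
        (\<forall>x\<in>carrier W. \<forall>y\<in>carrier W. f (x \<oplus>\<^bsub>W\<^esub> y) = f x \<oplus>\<^bsub>W\<^esub> f y) \<and>
        (\<forall>a\<in>carrier R. \<forall>x\<in>carrier W. f (a \<odot>\<^bsub>W\<^esub> x) = a \<odot>\<^bsub>W\<^esub> f x)},
     mult = compose (carrier W), one = (\<lambda>x\<in>carrier W. x),
     zero = (\<lambda>x\<in>carrier W. \<zero>\<^bsub>W\<^esub>), add = (\<lambda>f g. \<lambda>x\<in>carrier W. f x \<oplus>\<^bsub>W\<^esub> g x)\<rparr>"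


section \<open>Maps between tensor products\<close>

text \<open>A map between tensor products of \<open>U\<close>-modules, together with the lists of factors of its
  source and target. The underlying functions are extensional, as in \<open>End_ring\<close>.\<close>

record ('k, 'u, 'v) tmap =
  src :: "('u, 'v) module list"
  tgt :: "('u, 'v) module list"
  app :: "('v list \<Rightarrow> 'k) set \<Rightarrow> ('v list \<Rightarrow> 'k) set"

definition tid :: "('k, 'u) ribbon_hopf \<Rightarrow> ('u, 'v) module list \<Rightarrow> ('k, 'u, 'v) tmap" where
  "tid U As = \<lparr>src = As, tgt = As, app = (\<lambda>x\<in>carrier (tens U As). x)\<rparr>"

definition tcomp :: "('k, 'u, 'v) tmap \<Rightarrow> ('k, 'u) ribbon_hopf \<Rightarrow> ('k, 'u, 'v) tmap \<Rightarrow>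
    ('k, 'u, 'v) tmap" (\<open>_ \<bullet>\<^bsub>_\<^esub> _\<close> [66, 0, 65] 65) where
  "g \<bullet>\<^bsub>U\<^esub> f = \<lparr>src = src f, tgt = tgt g, app = compose (carrier (tens U (src f))) (app g) (app f)\<rparr>"

definition tinv :: "('k, 'u) ribbon_hopf \<Rightarrow> ('k, 'u, 'v) tmap \<Rightarrow> ('k, 'u, 'v) tmap" where
  "tinv U f = \<lparr>src = tgt f, tgt = src f,
     app = (\<lambda>y\<in>carrier (tens U (tgt f)). inv_into (carrier (tens U (src f))) (app f) y)\<rparr>"

definition tprod :: "('k, 'u, 'v) tmap \<Rightarrow> ('k, 'u) ribbon_hopf \<Rightarrow> ('k, 'u, 'v) tmap \<Rightarrow>
    ('k, 'u, 'v) tmap" (\<open>_ \<boxtimes>\<^bsub>_\<^esub> _\<close> [71, 0, 70] 70) where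
  "f \<boxtimes>\<^bsub>U\<^esub> g = \<lparr>src = src f @ src g, tgt = tgt f @ tgt g,
     app = (\<lambda>x\<in>carrier (tens U (src f @ src g)).
       tlift U (src f @ src g) (tens U (tgt f @ tgt g))
         (\<lambda>xs. tappend U (tgt f) (tgt g)
            (app f (ptens_of U (src f) (take (length (src f)) xs)))
            (app g (ptens_of U (src g) (drop (length (src f)) xs)))) x)\<rparr>"

text \<open>
  For lists \<open>As\<close>, \<open>Bs\<close> with tensor products \<open>A\<close>, \<open>B\<close> this is the map
  \<open>B \<otimes> A \<rightarrow> A \<otimes> B\<close>, \<open>b \<otimes> a \<mapsto> \<Sum> R\<^sub>2 a \<otimes> R\<^sub>1 b\<close>. Thus \<open>braiding U [M] [N]\<close> maps \<open>N \<otimes> M\<close> to \<open>M \<otimes> N\<close>,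
  and \<open>braiding U [M, N] [V]\<close> belongs to the modules \<open>M \<otimes> N\<close> and \<open>V\<close>.
\<close>

definition braiding :: "('k, 'u) ribbon_hopf \<Rightarrow> ('u, 'v) module list \<Rightarrow> ('u, 'v) module list \<Rightarrow>
    ('k, 'u, 'v) tmap" where
  "braiding U As Bs = \<lparr>src = Bs @ As, tgt = As @ Bs,
     app = (\<lambda>x\<in>carrier (tens U (Bs @ As)).
       tlift U (Bs @ As) (tens U (As @ Bs))
         (\<lambda>xs. let b = ptens_of U Bs (take (length Bs) xs);
                   a = ptens_of U As (drop (length Bs) xs)
               in sweedler U (tens U (As @ Bs))
                    (\<lambda>r1 r2. tappend U As Bs (tact U As r2 a) (tact U Bs r1 b)) (rmatrix U)) x)\<rparr>"

definition Rcheck_i where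
  "Rcheck_i U M N V k i =
    tid U [M] \<boxtimes>\<^bsub>U\<^esub> tid U [N] \<boxtimes>\<^bsub>U\<^esub> tid U (replicate (i - 1) V) \<boxtimes>\<^bsub>U\<^esub> braiding U [V] [V]
      \<boxtimes>\<^bsub>U\<^esub> tid U (replicate (k - i - 1) V)"

definition Rcheck_M_sq where
  "Rcheck_M_sq U M N V k =
    ((tid U [M] \<boxtimes>\<^bsub>U\<^esub> braiding U [N] [V])
       \<bullet>\<^bsub>U\<^esub> ((braiding U [M] [V] \<bullet>\<^bsub>U\<^esub> braiding U [V] [M]) \<boxtimes>\<^bsub>U\<^esub> tid U [N])
       \<bullet>\<^bsub>U\<^esub> (tid U [M] \<boxtimes>\<^bsub>U\<^esub> tinv U (braiding U [N] [V])))
    \<boxtimes>\<^bsub>U\<^esub> tid U (replicate (k - 1) V)"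

definition Rcheck_N_sq where
  "Rcheck_N_sq U M N V k =
    tid U [M] \<boxtimes>\<^bsub>U\<^esub> (braiding U [N] [V] \<bullet>\<^bsub>U\<^esub> braiding U [V] [N])
      \<boxtimes>\<^bsub>U\<^esub> tid U (replicate (k - 1) V)"

definition Rcheck_0_sq where
  "Rcheck_0_sq U M N V k =
    (braiding U [M, N] [V] \<bullet>\<^bsub>U\<^esub> braiding U [V] [M, N]) \<boxtimes>\<^bsub>U\<^esub> tid U (replicate (k - 1) V)"

definition Rcheck_P where
  "Rcheck_P U M N V k =
    (braiding U [M] [N] \<bullet>\<^bsub>U\<^esub> braiding U [N] [M]) \<boxtimes>\<^bsub>U\<^esub> tid U (replicate k V)"


section \<open>Groups given by generators and relations\<close>

text \<open>The letter \<open>(s, True)\<close> stands for the generator \<open>s\<close>, and \<open>(s, False)\<close> for its inverse.\<close>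

type_synonym 's word = "('s \<times> bool) list"

inductive word_eq :: "'s set \<Rightarrow> ('s word \<times> 's word) set \<Rightarrow> 's word \<Rightarrow> 's word \<Rightarrow> bool"
  for S :: "'s set" and E :: "('s word \<times> 's word) set" where
  refl: "w \<in> lists (S \<times> UNIV) \<Longrightarrow> word_eq S E w w"
| sym: "word_eq S E v w \<Longrightarrow> word_eq S E w v"
| trans: "word_eq S E u v \<Longrightarrow> word_eq S E v w \<Longrightarrow> word_eq S E u w"
| append: "word_eq S E v v' \<Longrightarrow> word_eq S E w w' \<Longrightarrow> word_eq S E (v @ w) (v' @ w')"
| cancel: "s \<in> S \<Longrightarrow> word_eq S E [(s, b), (s, \<not> b)] []"
| rel: "(v, w) \<in> E \<Longrightarrow> word_eq S E v w"

definition word_class :: "'s set \<Rightarrow> ('s word \<times> 's word) set \<Rightarrow> 's word \<Rightarrow> 's word set" where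
  "word_class S E w = {v. word_eq S E w v}"

definition presented_group ::
    "'s set \<Rightarrow> ('s word \<times> 's word) set \<Rightarrow> 's word set monoid" where
  "presented_group S E =
    \<lparr>carrier = word_class S E ` lists (S \<times> UNIV),
     mult = (\<lambda>A B. \<Union>v\<in>A. \<Union>w\<in>B. word_class S E (v @ w)),
     one = word_class S E []\<rparr>"

datatype braid_gen = X1 | Y1 | Z1 | P | T nat

definition gen :: "braid_gen \<Rightarrow> braid_gen \<times> bool" where "gen s = (s, True)"
definition geninv :: "braid_gen \<Rightarrow> braid_gen \<times> bool" where "geninv s = (s, False)"

definition braid_gens :: "nat \<Rightarrow> braid_gen set" where
  "braid_gens k = {X1, Y1, Z1, P} \<union> {T i | i. 1 \<le> i \<and> i < k}"

definition braid_rels :: "nat \<Rightarrow> (braid_gen word \<times> braid_gen word) set" where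
  "braid_rels k =
     {(map gen [T i, T (i + 1), T i], map gen [T (i + 1), T i, T (i + 1)]) | i.
        1 \<le> i \<and> i + 1 < k}
   \<union> {(map gen [T i, T j], map gen [T j, T i]) | i j.
        1 \<le> i \<and> i < k \<and> 1 \<le> j \<and> j < k \<and> (i + 2 \<le> j \<or> j + 2 \<le> i)}
   \<union> {(map gen [A, T 1, A, T 1], map gen [T 1, A, T 1, A]) | A. A \<in> {X1, Y1, Z1} \<and> 1 < k}
   \<union> {(map gen [A, T i], map gen [T i, A]) | A i. A \<in> {X1, Y1, Z1} \<and> 2 \<le> i \<and> i < k}
   \<union> {(map gen [Z1], map gen [X1, Y1]),
      ([gen P, gen X1, geninv P], [geninv Z1, gen X1, gen Z1]),
      ([gen P, gen Y1, geninv P], [geninv Z1, gen Y1, gen Z1]),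
      ([gen P, gen Z1, geninv P], [gen Z1])}
   \<union> {([gen P, gen (T i), geninv P], [gen (T i)]) | i. 1 \<le> i \<and> i < k}"

definition ext_braid_group :: "nat \<Rightarrow> braid_gen word set monoid" where
  "ext_braid_group k = presented_group (braid_gens k) (braid_rels k)"

definition bgen :: "nat \<Rightarrow> braid_gen \<Rightarrow> braid_gen word set" where
  "bgen k s = word_class (braid_gens k) (braid_rels k) [gen s]"


section \<open>Group algebras\<close>

definition center_ring :: "('a, 'e) ring_scheme \<Rightarrow> 'a ring" where
  "center_ring A = \<lparr>carrier = center A, mult = mult A, one = one A, zero = zero A, add = add A\<rparr>"

definition group_algebra :: "('z, 'e) ring_scheme \<Rightarrow> ('g, 'f) monoid_scheme \<Rightarrow> ('g \<Rightarrow> 'z) ring" where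
  "group_algebra Z G =
    \<lparr>carrier = {a. (\<forall>g. a g \<in> carrier Z) \<and> finite {g. a g \<noteq> \<zero>\<^bsub>Z\<^esub>} \<and> {g. a g \<noteq> \<zero>\<^bsub>Z\<^esub>} \<subseteq> carrier G},
     mult = (\<lambda>a b g. if g \<in> carrier G
        then \<Oplus>\<^bsub>Z\<^esub>h\<in>{h. a h \<noteq> \<zero>\<^bsub>Z\<^esub>}. a h \<otimes>\<^bsub>Z\<^esub> b (inv\<^bsub>G\<^esub> h \<otimes>\<^bsub>G\<^esub> g) else \<zero>\<^bsub>Z\<^esub>),
     one = (\<lambda>g. if g = \<one>\<^bsub>G\<^esub> then \<one>\<^bsub>Z\<^esub> else \<zero>\<^bsub>Z\<^esub>),
     zero = (\<lambda>g. \<zero>\<^bsub>Z\<^esub>), add = (\<lambda>a b g. a g \<oplus>\<^bsub>Z\<^esub> b g)\<rparr>"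

definition monomial :: "('z, 'e) ring_scheme \<Rightarrow> 'z \<Rightarrow> 'g \<Rightarrow> 'g \<Rightarrow> 'z" where
  "monomial Z z g = (\<lambda>h. if h = g then z else \<zero>\<^bsub>Z\<^esub>)"

definition with_action ::
    "('a, 'b, 'm) module_scheme \<Rightarrow> ('c \<Rightarrow> 'b \<Rightarrow> 'b) \<Rightarrow> ('c, 'b) module" where
  "with_action W \<phi> = \<lparr>carrier = carrier W, mult = mult W, one = one W, zero = zero W, add = add W,
     smult = \<phi>\<rparr>"

end

theory Submission
  imports Defs
begin

text \<open>
  Draw the modules \<open>M\<close> and \<open>N\<close> as two poles and the copies of \<open>V\<close> as strands. A generator \<open>T\<^sub>i\<close> acts by a
  crossing of two neighbouring strands, \<open>X\<^sub>1\<close>, \<open>Y\<^sub>1\<close>, \<open>Z\<^sub>1\<close> act by a loop of the first strand around the left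
  pole, the right pole, or both poles, and \<open>P\<close> acts by a full twist of the two poles. The relations
  hold because they are isotopies of these pictures, and an isotopy becomes an identity of maps by four
  properties of the braiding: it is an intertwiner (\<open>intertwiner_braiding\<close>), it is invertible
  (\<open>isom_braiding\<close>), it is natural (\<open>braiding_natural\<close>), and braiding a tensor product is braiding its
  factors one after the other (\<open>braiding_cabling_left\<close>, \<open>braiding_cabling_right\<close>).

  These four properties are formal consequences of the axioms of a quasitriangular Hopf algebra. An
  axiom is an identity in \<open>U \<otimes> U\<close> or \<open>U \<otimes> U \<otimes> U\<close>. By the universal property of the tensor product it gives
  an identity of sums \<open>\<Sum> g X\<^sub>1 X\<^sub>2\<close> for every multilinear \<open>g\<close>, and the properties of the braiding arise from
  those \<open>g\<close> in which the arguments act on elements of modules. What makes this work for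
  arbitrary lists of modules is that \<open>a\<close> acts on a product of two blocks by
  \<open>\<Sum> a\<^sub>1 x \<otimes> a\<^sub>2 y\<close>, wherever the list is cut (\<open>tact_append\<close>).

  In the resulting strict braided category the relations are derived as follows. The relations among the \<open>T\<^sub>i\<close>
  are the Yang--Baxter equation and the interchange law. For a loop \<open>A\<close> around a pole, the relation
  \<open>A T\<^sub>1 A T\<^sub>1 = T\<^sub>1 A T\<^sub>1 A\<close> is the reflection equation (\<open>reflection_equation\<close>); for \<open>X\<^sub>1\<close> it is transported
  along the braiding that moves the right pole out of the way (\<open>left_pole_reflection\<close>). The relation
  \<open>Z\<^sub>1 = X\<^sub>1 Y\<^sub>1\<close> is cabling (\<open>both_poles_eq\<close>). The product \<open>Z\<^sub>1 P\<close> is the full twist of \<open>M\<close>, \<open>N\<close> and the first strand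
  (\<open>full_twist\<close>), so it commutes with \<open>Z\<^sub>1\<close> and \<open>Y\<^sub>1\<close>, hence with \<open>X\<^sub>1\<close>, and this is equivalent to the conjugation
  relations for \<open>P\<close> (\<open>full_twist_conjugation\<close>).

  All maps involved are invertible endomorphisms of a \<open>U\<close>-module, so the universal property of a
  presented group gives a representation of the braid group by intertwiners. Intertwiners commute with the
  action of the center of \<open>U\<close>, so the representation extends to the group algebra over the center
  (\<open>group_algebra_hom\<close>), again by intertwiners.
\<close>

section \<open>Linear maps\<close>

lemma is_linearI:
  assumes "\<And>x. x \<in> carrier M \<Longrightarrow> f x \<in> carrier L"
    and "\<And>x y. x \<in> carrier M \<Longrightarrow> y \<in> carrier M \<Longrightarrow> f (x \<oplus>\<^bsub>M\<^esub> y) = f x \<oplus>\<^bsub>L\<^esub> f y"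
    and "\<And>c x. c \<in> carrier K \<Longrightarrow> x \<in> carrier M \<Longrightarrow> f (c \<odot>\<^bsub>M\<^esub> x) = c \<odot>\<^bsub>L\<^esub> f x"
  shows "is_linear K M L f"
  using assms by (auto simp: is_linear_def)

lemma is_linear_closed: "is_linear K M L f \<Longrightarrow> x \<in> carrier M \<Longrightarrow> f x \<in> carrier L"
  and is_linear_add: "is_linear K M L f \<Longrightarrow> x \<in> carrier M \<Longrightarrow> y \<in> carrier M
    \<Longrightarrow> f (x \<oplus>\<^bsub>M\<^esub> y) = f x \<oplus>\<^bsub>L\<^esub> f y"
  and is_linear_smult: "is_linear K M L f \<Longrightarrow> c \<in> carrier K \<Longrightarrow> x \<in> carrier M
    \<Longrightarrow> f (c \<odot>\<^bsub>M\<^esub> x) = c \<odot>\<^bsub>L\<^esub> f x"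
  by (auto simp: is_linear_def)

lemma is_linear_zero:
  assumes "module K M" "module K L" "is_linear K M L f"
  shows "f \<zero>\<^bsub>M\<^esub> = \<zero>\<^bsub>L\<^esub>"
proof -
  interpret M: module K M by fact
  interpret L: module K L by fact
  have "f (\<zero>\<^bsub>K\<^esub> \<odot>\<^bsub>M\<^esub> \<zero>\<^bsub>M\<^esub>) = \<zero>\<^bsub>K\<^esub> \<odot>\<^bsub>L\<^esub> f \<zero>\<^bsub>M\<^esub>"
    using assms(3) by (intro is_linear_smult) auto
  then show ?thesis
    using is_linear_closed[OF assms(3)] by simp
qed

lemma is_linear_minus:
  assumes "module K M" "module K L" "is_linear K M L f" "x \<in> carrier M" "y \<in> carrier M"
  shows "f (x \<ominus>\<^bsub>M\<^esub> y) = f x \<ominus>\<^bsub>L\<^esub> f y"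
proof -
  interpret M: module K M by fact
  interpret L: module K L by fact
  note [simp] = is_linear_closed[OF assms(3)] assms(4,5)
  have "f (\<ominus>\<^bsub>M\<^esub> y) = f ((\<ominus>\<^bsub>K\<^esub> \<one>\<^bsub>K\<^esub>) \<odot>\<^bsub>M\<^esub> y)"
    by (simp add: M.smult_l_minus)
  also have "\<dots> = \<ominus>\<^bsub>L\<^esub> f y"
    using is_linear_smult[OF assms(3), of "\<ominus>\<^bsub>K\<^esub> \<one>\<^bsub>K\<^esub>" y] by (simp add: L.smult_l_minus)
  finally show ?thesis
    by (simp add: a_minus_def is_linear_add[OF assms(3)])
qed

lemma is_linear_cong:
  assumes "is_linear K M L f" "\<And>x. x \<in> carrier M \<Longrightarrow> f x = f' x" "module K M"
  shows "is_linear K M L f'"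
proof -
  interpret M: module K M by fact
  show ?thesis
    using assms(1,2) by (auto simp: is_linear_def Pi_def)
qed

lemma is_linear_id: "is_linear K M M (\<lambda>x. x)"
  by (auto simp: is_linear_def)

lemma is_linear_compose:
  "is_linear K L L' g \<Longrightarrow> is_linear K M L f \<Longrightarrow> is_linear K M L' (\<lambda>x. g (f x))"
  by (auto simp: is_linear_def Pi_def)

lemma is_linear_smult_const:
  assumes "module K L" "is_linear K M L f" "c \<in> carrier K"
  shows "is_linear K M L (\<lambda>x. c \<odot>\<^bsub>L\<^esub> f x)"
proof -
  interpret L: module K L by fact
  show ?thesis
    using assms(2,3)
    by (auto simp: is_linear_def Pi_def L.smult_r_distr L.R.m_comm simp flip: L.smult_assoc1)
qed

lemma is_linear_finsum_fun:
  assumes "module K M" "module K L" "\<And>i. i \<in> A \<Longrightarrow> is_linear K M L (\<lambda>x. g x i)"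
  shows "is_linear K M L (\<lambda>x. \<Oplus>\<^bsub>L\<^esub>i\<in>A. g x i)"
proof -
  interpret M: module K M by fact
  interpret L: module K L by fact
  have cl: "g x i \<in> carrier L" if "x \<in> carrier M" "i \<in> A" for x i
    using is_linear_closed[OF assms(3)] that by blast
  show ?thesis
  proof (cases "finite A")
    case False
    then show ?thesis
      by (intro is_linearI) (simp_all add: L.M.add.finprod_infinite)
  next
    case True
    show ?thesis
    proof (rule is_linearI)
      fix x assume x: "x \<in> carrier M"
      show "(\<Oplus>\<^bsub>L\<^esub>i\<in>A. g x i) \<in> carrier L"
        using cl x by (intro L.finsum_closed) auto
      fix y assume y: "y \<in> carrier M"
      have "(\<Oplus>\<^bsub>L\<^esub>i\<in>A. g (x \<oplus>\<^bsub>M\<^esub> y) i) = (\<Oplus>\<^bsub>L\<^esub>i\<in>A. g x i \<oplus>\<^bsub>L\<^esub> g y i)"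
        using x y cl by (intro L.finsum_cong') (auto simp: is_linear_add[OF assms(3)])
      then show "(\<Oplus>\<^bsub>L\<^esub>i\<in>A. g (x \<oplus>\<^bsub>M\<^esub> y) i) = (\<Oplus>\<^bsub>L\<^esub>i\<in>A. g x i) \<oplus>\<^bsub>L\<^esub> (\<Oplus>\<^bsub>L\<^esub>i\<in>A. g y i)"
        using x y cl by (simp add: L.finsum_addf)
    next
      fix c x assume c: "c \<in> carrier K" and x: "x \<in> carrier M"
      have "(\<Oplus>\<^bsub>L\<^esub>i\<in>A. g (c \<odot>\<^bsub>M\<^esub> x) i) = (\<Oplus>\<^bsub>L\<^esub>i\<in>A. c \<odot>\<^bsub>L\<^esub> g x i)"
        using x c cl by (intro L.finsum_cong') (auto simp: is_linear_smult[OF assms(3)])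
      then show "(\<Oplus>\<^bsub>L\<^esub>i\<in>A. g (c \<odot>\<^bsub>M\<^esub> x) i) = c \<odot>\<^bsub>L\<^esub> (\<Oplus>\<^bsub>L\<^esub>i\<in>A. g x i)"
        using x c cl True by (simp add: L.finsum_smult_ldistr)
    qed
  qed
qed

definition bilinear ::
    "'k ring \<Rightarrow> ('k, 'a, 'e) module_scheme \<Rightarrow> ('k, 'b, 'f) module_scheme \<Rightarrow>
      ('k, 'w, 'g) module_scheme \<Rightarrow> ('a \<Rightarrow> 'b \<Rightarrow> 'w) \<Rightarrow> bool" where
  "bilinear K A B L g \<longleftrightarrow>
    (\<forall>a\<in>carrier A. is_linear K B L (g a)) \<and> (\<forall>b\<in>carrier B. is_linear K A L (\<lambda>a. g a b))"

lemma bilinearI: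
  assumes "\<And>a. a \<in> carrier A \<Longrightarrow> is_linear K B L (\<lambda>b. g a b)"
    and "\<And>b. b \<in> carrier B \<Longrightarrow> is_linear K A L (\<lambda>a. g a b)"
  shows "bilinear K A B L g"
  using assms by (auto simp: bilinear_def)

lemma bilinear_right: "bilinear K A B L g \<Longrightarrow> a \<in> carrier A \<Longrightarrow> is_linear K B L (g a)"
  and bilinear_left: "bilinear K A B L g \<Longrightarrow> b \<in> carrier B \<Longrightarrow> is_linear K A L (\<lambda>a. g a b)"
  by (auto simp: bilinear_def)

lemma bilinear_closed:
  "bilinear K A B L g \<Longrightarrow> a \<in> carrier A \<Longrightarrow> b \<in> carrier B \<Longrightarrow> g a b \<in> carrier L"
  by (meson bilinear_right is_linear_closed)

lemma bilinear_cong: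
  assumes "bilinear K A B L g" "module K A" "module K B"
    and "\<And>a b. a \<in> carrier A \<Longrightarrow> b \<in> carrier B \<Longrightarrow> g a b = g' a b"
  shows "bilinear K A B L g'"
proof (rule bilinearI)
  show "is_linear K B L (\<lambda>b. g' a b)" if "a \<in> carrier A" for a
    by (rule is_linear_cong[OF bilinear_right[OF assms(1) that] assms(4)[OF that] assms(3)])
  show "is_linear K A L (\<lambda>a. g' a b)" if "b \<in> carrier B" for b
    by (rule is_linear_cong[OF bilinear_left[OF assms(1) that] assms(4)[OF _ that] assms(2)])
qed


section \<open>Free modules and quotient modules\<close>

lemma free_module_simps [simp]:
  "\<zero>\<^bsub>free_module K B\<^esub> = (\<lambda>x. \<zero>\<^bsub>K\<^esub>)"
  "f \<oplus>\<^bsub>free_module K B\<^esub> g = (\<lambda>x. f x \<oplus>\<^bsub>K\<^esub> g x)"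
  "c \<odot>\<^bsub>free_module K B\<^esub> f = (\<lambda>x. c \<otimes>\<^bsub>K\<^esub> f x)"
  by (simp_all add: free_module_def)

lemma free_module_carrier:
  "f \<in> carrier (free_module K B) \<longleftrightarrow>
    (\<forall>x. f x \<in> carrier K) \<and> finite {x. f x \<noteq> \<zero>\<^bsub>K\<^esub>} \<and> {x. f x \<noteq> \<zero>\<^bsub>K\<^esub>} \<subseteq> B"
  by (simp add: free_module_def)

lemma free_moduleI:
  assumes "\<And>x. f x \<in> carrier K" "finite S" "\<And>x. f x \<noteq> \<zero>\<^bsub>K\<^esub> \<Longrightarrow> x \<in> S" "S \<subseteq> B"
  shows "f \<in> carrier (free_module K B)"
proof -
  have "{x. f x \<noteq> \<zero>\<^bsub>K\<^esub>} \<subseteq> S"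
    using assms(3) by auto
  then show ?thesis
    using assms by (auto simp: free_module_carrier intro: finite_subset)
qed

lemma free_gen_closed:
  assumes "cring K" "x \<in> B"
  shows "free_gen K x \<in> carrier (free_module K B)"
proof -
  interpret K: cring K by fact
  show ?thesis
    using assms(2) by (intro free_moduleI[of _ _ "{x}"]) (auto simp: free_gen_def split: if_splits)
qed

lemma free_module_module:
  assumes "cring K"
  shows "module K (free_module K B)"
proof -
  interpret K: cring K by fact
  have add: "(\<lambda>x. f x \<oplus>\<^bsub>K\<^esub> g x) \<in> carrier (free_module K B)"
    if "f \<in> carrier (free_module K B)" "g \<in> carrier (free_module K B)" for f g
    using that
    by (intro free_moduleI[of _ _ "{x. f x \<noteq> \<zero>\<^bsub>K\<^esub>} \<union> {x. g x \<noteq> \<zero>\<^bsub>K\<^esub>}"])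
      (auto simp: free_module_carrier)
  have smult: "(\<lambda>x. c \<otimes>\<^bsub>K\<^esub> f x) \<in> carrier (free_module K B)"
    if "f \<in> carrier (free_module K B)" "c \<in> carrier K" for f c
    using that by (intro free_moduleI[of _ _ "{x. f x \<noteq> \<zero>\<^bsub>K\<^esub>}"]) (auto simp: free_module_carrier)
  have neg: "\<exists>g\<in>carrier (free_module K B). (\<lambda>x. g x \<oplus>\<^bsub>K\<^esub> f x) = (\<lambda>x. \<zero>\<^bsub>K\<^esub>)"
    if "f \<in> carrier (free_module K B)" for f
    using that smult[OF that, of "\<ominus>\<^bsub>K\<^esub> \<one>\<^bsub>K\<^esub>"]
    by (intro bexI[of _ "\<lambda>x. (\<ominus>\<^bsub>K\<^esub> \<one>\<^bsub>K\<^esub>) \<otimes>\<^bsub>K\<^esub> f x"])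
      (auto simp: free_module_carrier K.l_minus K.l_neg)
  show ?thesis
  proof (intro moduleI abelian_groupI; (simp only: free_module_simps)?)
    fix f assume "f \<in> carrier (free_module K B)"
    then show "\<exists>g\<in>carrier (free_module K B). (\<lambda>x. g x \<oplus>\<^bsub>K\<^esub> f x) = (\<lambda>x. \<zero>\<^bsub>K\<^esub>)"
      by (rule neg)
  qed (use add smult K.is_cring in \<open>auto simp: free_module_carrier fun_eq_iff K.a_assoc K.a_comm K.a_lcomm
      K.m_assoc K.l_distr K.r_distr\<close>)
qed

text \<open>The linear extension of a map on the basis of a free module. It is the sum that
  \<open>tensor_lift\<close> evaluates on a representative.\<close>

definition lin_ext ::
    "'k ring \<Rightarrow> ('k, 'w, 'f) module_scheme \<Rightarrow> ('x \<Rightarrow> 'w) \<Rightarrow> ('x \<Rightarrow> 'k) \<Rightarrow> 'w" where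
  "lin_ext K L g f = (\<Oplus>\<^bsub>L\<^esub>x\<in>{x. f x \<noteq> \<zero>\<^bsub>K\<^esub>}. f x \<odot>\<^bsub>L\<^esub> g x)"

lemma tensor_lift_eq_lin_ext: "tensor_lift K Ms L g X = lin_ext K L g (SOME f. f \<in> X)"
  by (simp add: tensor_lift_def lin_ext_def Let_def)

text \<open>Enlarging the index set beyond the support makes it possible to compare the sums for
  functions with different supports.\<close>

lemma lin_ext_superset:
  assumes "module K L" "f \<in> carrier (free_module K B)" "g \<in> B \<rightarrow> carrier L"
    and "finite S" "{x. f x \<noteq> \<zero>\<^bsub>K\<^esub>} \<subseteq> S" "S \<subseteq> B"
  shows "lin_ext K L g f = (\<Oplus>\<^bsub>L\<^esub>x\<in>S. f x \<odot>\<^bsub>L\<^esub> g x)"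
proof -
  interpret L: module K L by fact
  show ?thesis
    unfolding lin_ext_def
  proof (rule L.M.add.finprod_mono_neutral_cong_left)
    show "f i \<odot>\<^bsub>L\<^esub> g i = \<zero>\<^bsub>L\<^esub>" if "i \<in> S - {x. f x \<noteq> \<zero>\<^bsub>K\<^esub>}" for i
      using that assms(3,6) by (auto simp: Pi_def)
  qed (use assms in \<open>auto simp: Pi_def free_module_carrier\<close>)
qed

lemma lin_ext_linear:
  assumes "module K L" "g \<in> B \<rightarrow> carrier L"
  shows "is_linear K (free_module K B) L (lin_ext K L g)"
proof -
  interpret L: module K L by fact
  interpret F: module K "free_module K B" by (rule free_module_module) (rule L.R.is_cring)
  note ext = lin_ext_superset[OF assms(1) _ assms(2)]
  have g: "g x \<in> carrier L" if "x \<in> B" for x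
    using assms(2) that by auto
  show ?thesis
  proof (rule is_linearI)
    fix f assume f: "f \<in> carrier (free_module K B)"
    then show "lin_ext K L g f \<in> carrier L"
      unfolding lin_ext_def using g by (intro L.finsum_closed) (auto simp: free_module_carrier)
  next
    fix f f' assume f: "f \<in> carrier (free_module K B)" "f' \<in> carrier (free_module K B)"
    define S where "S = {x. f x \<noteq> \<zero>\<^bsub>K\<^esub>} \<union> {x. f' x \<noteq> \<zero>\<^bsub>K\<^esub>}"
    have S: "finite S" "S \<subseteq> B"
      using f by (auto simp: S_def free_module_carrier)
    have fc: "f x \<in> carrier K" "f' x \<in> carrier K" for x
      using f by (auto simp: free_module_carrier)
    have "lin_ext K L g (f \<oplus>\<^bsub>free_module K B\<^esub> f')
        = (\<Oplus>\<^bsub>L\<^esub>x\<in>S. (f \<oplus>\<^bsub>free_module K B\<^esub> f') x \<odot>\<^bsub>L\<^esub> g x)"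
      using f S by (intro ext F.a_closed) (auto simp: S_def)
    also have "\<dots> = (\<Oplus>\<^bsub>L\<^esub>x\<in>S. f x \<odot>\<^bsub>L\<^esub> g x \<oplus>\<^bsub>L\<^esub> f' x \<odot>\<^bsub>L\<^esub> g x)"
      using fc g S by (intro L.finsum_cong') (auto simp: L.smult_l_distr)
    also have "\<dots> = (\<Oplus>\<^bsub>L\<^esub>x\<in>S. f x \<odot>\<^bsub>L\<^esub> g x) \<oplus>\<^bsub>L\<^esub> (\<Oplus>\<^bsub>L\<^esub>x\<in>S. f' x \<odot>\<^bsub>L\<^esub> g x)"
      using fc g S by (intro L.finsum_addf) auto
    also have "\<dots> = lin_ext K L g f \<oplus>\<^bsub>L\<^esub> lin_ext K L g f'"
      using f S by (subst (1 2) ext[of _ S]) (auto simp: S_def)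
    finally show "lin_ext K L g (f \<oplus>\<^bsub>free_module K B\<^esub> f') = lin_ext K L g f \<oplus>\<^bsub>L\<^esub> lin_ext K L g f'" .
  next
    fix c f assume c: "c \<in> carrier K" and f: "f \<in> carrier (free_module K B)"
    define S where "S = {x. f x \<noteq> \<zero>\<^bsub>K\<^esub>}"
    have S: "finite S" "S \<subseteq> B"
      using f by (auto simp: S_def free_module_carrier)
    have fc: "f x \<in> carrier K" for x
      using f by (auto simp: free_module_carrier)
    have "lin_ext K L g (c \<odot>\<^bsub>free_module K B\<^esub> f)
        = (\<Oplus>\<^bsub>L\<^esub>x\<in>S. (c \<odot>\<^bsub>free_module K B\<^esub> f) x \<odot>\<^bsub>L\<^esub> g x)"
      using c f S by (intro ext F.smult_closed) (auto simp: S_def)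
    also have "\<dots> = (\<Oplus>\<^bsub>L\<^esub>x\<in>S. c \<odot>\<^bsub>L\<^esub> (f x \<odot>\<^bsub>L\<^esub> g x))"
      using c fc g S by (intro L.finsum_cong') (auto simp: L.smult_assoc1)
    also have "\<dots> = c \<odot>\<^bsub>L\<^esub> lin_ext K L g f"
      using c fc g S unfolding lin_ext_def S_def[symmetric]
      by (subst L.finsum_smult_ldistr) auto
    finally show "lin_ext K L g (c \<odot>\<^bsub>free_module K B\<^esub> f) = c \<odot>\<^bsub>L\<^esub> lin_ext K L g f" .
  qed
qed

lemma lin_ext_gen:
  assumes "module K L" "g \<in> B \<rightarrow> carrier L" "x \<in> B"
  shows "lin_ext K L g (free_gen K x) = g x"
proof -
  interpret L: module K L by fact
  \<comment> \<open>The sum over \<open>{x}\<close> also covers the zero ring, where the support of the generator is empty.\<close>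
  have "lin_ext K L g (free_gen K x) = (\<Oplus>\<^bsub>L\<^esub>y\<in>{x}. free_gen K x y \<odot>\<^bsub>L\<^esub> g y)"
    using assms free_gen_closed[OF L.R.is_cring assms(3)]
    by (intro lin_ext_superset) (auto simp: free_gen_def)
  also have "\<dots> = g x"
    using assms(2,3) by (auto simp: free_gen_def Pi_def)
  finally show ?thesis .
qed

text \<open>For a fixed argument the linear extension is a finite sum with fixed coefficients, hence it
  depends linearly on the map that is extended.\<close>

lemma lin_ext_param_linear:
  assumes "module K A" "module K L" "f \<in> carrier (free_module K B)"
    and "\<And>x. x \<in> B \<Longrightarrow> is_linear K A L (\<lambda>a. g a x)"
  shows "is_linear K A L (\<lambda>a. lin_ext K L (g a) f)"
  unfolding lin_ext_def
  by (intro is_linear_finsum_fun is_linear_smult_const assms)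
    (use assms(3) in \<open>auto simp: free_module_carrier\<close>)

lemma free_module_induct [consumes 2, case_names zero gen add smult]:
  assumes "cring K" "f \<in> carrier (free_module K B)"
    and zero: "Q \<zero>\<^bsub>free_module K B\<^esub>"
    and gen: "\<And>x. x \<in> B \<Longrightarrow> Q (free_gen K x)"
    and add: "\<And>f g. f \<in> carrier (free_module K B) \<Longrightarrow> g \<in> carrier (free_module K B) \<Longrightarrow> Q f \<Longrightarrow> Q g
      \<Longrightarrow> Q (f \<oplus>\<^bsub>free_module K B\<^esub> g)"
    and smult: "\<And>c f. c \<in> carrier K \<Longrightarrow> f \<in> carrier (free_module K B) \<Longrightarrow> Q f
      \<Longrightarrow> Q (c \<odot>\<^bsub>free_module K B\<^esub> f)"
  shows "Q f"
proof -
  interpret K: cring K by fact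
  interpret F: module K "free_module K B" by (rule free_module_module) fact
  have "Q f" if "finite S" "S \<subseteq> B" "f \<in> carrier (free_module K B)" "{x. f x \<noteq> \<zero>\<^bsub>K\<^esub>} \<subseteq> S" for S f
    using that
  proof (induction S arbitrary: f rule: finite_induct)
    case empty
    then have "f = \<zero>\<^bsub>free_module K B\<^esub>"
      by auto
    then show ?case
      using zero by simp
  next
    case (insert x S)
    have x: "x \<in> B"
      using insert.prems by simp
    have fc: "f y \<in> carrier K" for y
      using insert.prems by (simp add: free_module_carrier)
    have f': "f(x := \<zero>\<^bsub>K\<^esub>) \<in> carrier (free_module K B)"
      using insert.prems fc
      by (intro free_moduleI[of _ _ "{x. f x \<noteq> \<zero>\<^bsub>K\<^esub>}"]) (auto simp: free_module_carrier split: if_splits)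
    \<comment> \<open>Splitting off the coefficient at \<open>x\<close> shrinks the support.\<close>
    have "Q (f(x := \<zero>\<^bsub>K\<^esub>))"
      using insert.prems by (intro insert.IH f') auto
    moreover have "f = f(x := \<zero>\<^bsub>K\<^esub>) \<oplus>\<^bsub>free_module K B\<^esub> (f x \<odot>\<^bsub>free_module K B\<^esub> free_gen K x)"
      using fc by (auto simp: free_gen_def)
    moreover have "Q (f(x := \<zero>\<^bsub>K\<^esub>) \<oplus>\<^bsub>free_module K B\<^esub> (f x \<odot>\<^bsub>free_module K B\<^esub> free_gen K x))"
      by (intro add smult gen F.smult_closed free_gen_closed f' fc x assms(1)) fact
    ultimately show ?case
      by simp
  qed
  from this[of "{x. f x \<noteq> \<zero>\<^bsub>K\<^esub>}" f] show ?thesis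
    using assms(2) by (simp add: free_module_carrier)
qed

locale quotient_of_module = module K M for K :: "'k ring" and M :: "('k, 'a) module" (structure) +
  fixes H :: "'a set"
  assumes submodule: "submodule H K M"
begin

lemma subgroup: "subgroup H (add_monoid M)"
  using submodule by (rule submodule.axioms)

lemma subset: "H \<subseteq> carrier M"
  using subgroup.subset[OF subgroup] by simp

sublocale abelian_subgroup H M
  by (rule abelian_subgroupI2[OF a_comm_group subgroup])

lemma coset_closed: "x \<in> carrier M \<Longrightarrow> H +> x \<in> carrier (quotient_module M H)"
  using a_rcosetsI subset by (auto simp: quotient_module_def)

lemma coset_cases:
  assumes "X \<in> carrier (quotient_module M H)"
  obtains x where "x \<in> carrier M" "X = H +> x"
  using assms by (auto simp: quotient_module_def A_RCOSETS_def RCOSETS_def a_r_coset_def)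

lemma coset_add: "x \<in> carrier M \<Longrightarrow> y \<in> carrier M
    \<Longrightarrow> (H +> x) \<oplus>\<^bsub>quotient_module M H\<^esub> (H +> y) = H +> (x \<oplus> y)"
  using a_rcos_sum by (simp add: quotient_module_def)

text \<open>The scalar multiple of a coset is a union over its elements. All sets in this union are the
  same coset, because the submodule is closed under scalars.\<close>

lemma coset_smult:
  assumes "c \<in> carrier K" "x \<in> carrier M"
  shows "c \<odot>\<^bsub>quotient_module M H\<^esub> (H +> x) = H +> (c \<odot> x)"
proof -
  have *: "H +> (c \<odot> y) = H +> (c \<odot> x)" if y: "y \<in> H +> x" for y
  proof -
    obtain h where h: "h \<in> H" "y = h \<oplus> x"
      using y by (auto simp: a_r_coset_def')
    have "c \<odot> y = (c \<odot> h) \<oplus> (c \<odot> x)"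
      using h assms subset by (auto simp: smult_r_distr)
    then have "c \<odot> y \<in> H +> (c \<odot> x)"
      using submodule.smult_closed[OF submodule assms(1) h(1)] subset assms by (auto intro: a_rcosI)
    then show ?thesis
      using a_repr_independence[OF _ _ subgroup] assms by blast
  qed
  have "x \<in> H +> x"
    using a_rcosI[of "\<zero>" H x] subset assms by auto
  then have "(\<Union>y\<in>H +> x. H +> (c \<odot> y)) = H +> (c \<odot> x)"
    by (simp add: SUP_cong[OF HOL.refl *] ex_in_conv del: UN_simps) (use \<open>x \<in> H +> x\<close> in blast)
  then show ?thesis
    by (simp add: quotient_module_def)
qed

lemma coset_linear: "is_linear K M (quotient_module M H) (\<lambda>x. H +> x)"
  by (intro is_linearI) (auto simp: coset_closed coset_add coset_smult)

lemma quotient_is_module: "module K (quotient_module M H)"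
proof -
  note simps = coset_add coset_closed a_assoc a_comm a_lcomm
  have zero: "\<zero>\<^bsub>quotient_module M H\<^esub> = H +> \<zero>"
    using subset by (simp add: quotient_module_def)
  interpret Q: abelian_group "quotient_module M H"
  proof (intro abelian_groupI; (elim coset_cases)?)
    fix X x assume "x \<in> carrier M" "X = H +> x"
    then show "\<exists>Y\<in>carrier (quotient_module M H). Y \<oplus>\<^bsub>quotient_module M H\<^esub> X = \<zero>\<^bsub>quotient_module M H\<^esub>"
      by (intro bexI[of _ "H +> (\<ominus> x)"]) (auto simp: simps zero l_neg r_neg)
  qed (auto simp: simps zero)
  show ?thesis
  proof (intro moduleI)
    show "cring K" ..
    show "abelian_group (quotient_module M H)" ..
  qed (auto elim!: coset_cases simp: coset_smult coset_add coset_closed smult_l_distr smult_r_distr smult_assoc1)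
qed

end


section \<open>The universal property of the tensor product\<close>

lemma tuples_iff: "xs \<in> tuples Ms \<longleftrightarrow> list_all2 (\<lambda>x M. x \<in> carrier M) xs Ms"
proof (induction Ms arbitrary: xs)
  case (Cons M Ms)
  then show ?case
    by (cases xs) (auto simp: tuples_def set_Cons_def)
qed (simp add: tuples_def)

lemma tuples_length: "xs \<in> tuples Ms \<Longrightarrow> length xs = length Ms"
  by (auto simp: tuples_iff list_all2_lengthD)

lemma tuples_nth: "xs \<in> tuples Ms \<Longrightarrow> i < length Ms \<Longrightarrow> xs ! i \<in> carrier (Ms ! i)"
  by (auto simp: tuples_iff list_all2_conv_all_nth)

lemma tuples_update:
  "xs \<in> tuples Ms \<Longrightarrow> i < length Ms \<Longrightarrow> a \<in> carrier (Ms ! i) \<Longrightarrow> xs[i := a] \<in> tuples Ms"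
  by (auto simp: tuples_iff list_all2_conv_all_nth nth_list_update)

lemma tuples_append: "xs \<in> tuples As \<Longrightarrow> ys \<in> tuples Bs \<Longrightarrow> xs @ ys \<in> tuples (As @ Bs)"
  by (auto simp: tuples_iff intro: list_all2_appendI)

lemma tuples_appendE:
  assumes "zs \<in> tuples (As @ Bs)"
  obtains xs ys where "zs = xs @ ys" "xs \<in> tuples As" "ys \<in> tuples Bs"
  using assms by (auto simp: tuples_iff list_all2_append2)

text \<open>The slot that varies is written as a list update, in the same way as in
  \<open>multilinear_gens\<close>.\<close>

definition multilinear ::
    "'k ring \<Rightarrow> ('k, 'v, 'e) module_scheme list \<Rightarrow> ('k, 'w, 'f) module_scheme \<Rightarrow> ('v list \<Rightarrow> 'w) \<Rightarrow> bool" where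
  "multilinear K Ms L g \<longleftrightarrow>
    (\<forall>xs\<in>tuples Ms. g xs \<in> carrier L) \<and>
    (\<forall>xs\<in>tuples Ms. \<forall>i<length Ms. is_linear K (Ms ! i) L (\<lambda>a. g (xs[i := a])))"

lemma multilinearI:
  assumes "\<And>xs. xs \<in> tuples Ms \<Longrightarrow> g xs \<in> carrier L"
    and "\<And>xs i. xs \<in> tuples Ms \<Longrightarrow> i < length Ms \<Longrightarrow> is_linear K (Ms ! i) L (\<lambda>a. g (xs[i := a]))"
  shows "multilinear K Ms L g"
  using assms by (auto simp: multilinear_def)

lemma multilinear_closed: "multilinear K Ms L g \<Longrightarrow> xs \<in> tuples Ms \<Longrightarrow> g xs \<in> carrier L"
  and multilinear_slot: "multilinear K Ms L g \<Longrightarrow> xs \<in> tuples Ms \<Longrightarrow> i < length Ms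
    \<Longrightarrow> is_linear K (Ms ! i) L (\<lambda>a. g (xs[i := a]))"
  by (auto simp: multilinear_def)

lemma multilinear_compose:
  "multilinear K Ms L g \<Longrightarrow> is_linear K L L' h \<Longrightarrow> multilinear K Ms L' (\<lambda>xs. h (g xs))"
  by (intro multilinearI)
    (auto intro: is_linear_closed multilinear_closed is_linear_compose multilinear_slot)

locale tensor_product =
  fixes K :: "'k ring" and Ms :: "('k, 'v, 'e) module_scheme list"
  assumes scalars_cring: "cring K" and factors: "\<And>M. M \<in> set Ms \<Longrightarrow> module K M"
begin

interpretation F: module K "free_module K (tuples Ms)"
  by (rule free_module_module) (rule scalars_cring)

lemma factor: "i < length Ms \<Longrightarrow> module K (Ms ! i)"
  by (simp add: factors)

lemma gens_subset: "multilinear_gens K Ms \<subseteq> carrier (free_module K (tuples Ms))"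
proof -
  have "free_gen K (xs[i := a]) \<in> carrier (free_module K (tuples Ms))"
    if "xs \<in> tuples Ms" "i < length Ms" "a \<in> carrier (Ms ! i)" for xs i a
    using that by (intro free_gen_closed scalars_cring tuples_update)
  moreover have "a \<oplus>\<^bsub>Ms ! i\<^esub> b \<in> carrier (Ms ! i)"
    if "i < length Ms" "a \<in> carrier (Ms ! i)" "b \<in> carrier (Ms ! i)" for i a b
    using abelian_monoid.a_closed[of "Ms ! i" a b] factor[of i] that
    by (simp add: module_def abelian_group_def)
  moreover have "c \<odot>\<^bsub>Ms ! i\<^esub> a \<in> carrier (Ms ! i)"
    if "i < length Ms" "c \<in> carrier K" "a \<in> carrier (Ms ! i)" for i c a
    using module.smult_closed[OF factor] that by blast
  ultimately show ?thesis
    unfolding multilinear_gens_def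
    by (auto simp del: free_module_simps intro!: F.minus_closed F.a_closed F.smult_closed)
qed

text \<open>The family of submodules in the definition is nonempty, since the whole free module belongs
  to it. Therefore its intersection lies in the free module.\<close>

lemma rels_submodule: "submodule (multilinear_rels K Ms) K (free_module K (tuples Ms))"
proof -
  let ?S = "{H. submodule H K (free_module K (tuples Ms)) \<and> multilinear_gens K Ms \<subseteq> H}"
  have ne: "carrier (free_module K (tuples Ms)) \<in> ?S"
    using F.carrier_is_submodule gens_subset by simp
  have z: "\<zero>\<^bsub>free_module K (tuples Ms)\<^esub> \<in> H" if "H \<in> ?S" for H
    using subgroup.one_closed[of H "add_monoid (free_module K (tuples Ms))"] that
    by (simp add: submodule_def)
  show ?thesis
    unfolding multilinear_rels_def
  proof (intro F.submoduleI)
    show "\<Inter>?S \<subseteq> carrier (free_module K (tuples Ms))"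
      using ne by (rule Inter_lower)
    show "\<zero>\<^bsub>free_module K (tuples Ms)\<^esub> \<in> \<Inter>?S"
      using z by blast
  next
    fix x assume x: "x \<in> \<Inter>?S"
    show "\<ominus>\<^bsub>free_module K (tuples Ms)\<^esub> x \<in> \<Inter>?S"
      using x F.submoduleE(3) by blast
    {
      fix y assume "y \<in> \<Inter>?S"
      with x show "x \<oplus>\<^bsub>free_module K (tuples Ms)\<^esub> y \<in> \<Inter>?S"
        using F.submoduleE(5) by blast
    next
      fix c assume "c \<in> carrier K"
      with x show "c \<odot>\<^bsub>free_module K (tuples Ms)\<^esub> x \<in> \<Inter>?S"
        using F.submoduleE(4) by blast
    }
  qed
qed

sublocale quotient_of_module K "free_module K (tuples Ms)" "multilinear_rels K Ms"
  by (intro quotient_of_module.intro quotient_of_module_axioms.intro F.module_axioms rels_submodule)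

lemma tensor_is_module: "module K (tensor K Ms)"
  unfolding tensor_def by (rule quotient_is_module)

lemma pure_closed: "xs \<in> tuples Ms \<Longrightarrow> pure_tensor K Ms xs \<in> carrier (tensor K Ms)"
  unfolding tensor_def pure_tensor_def by (intro coset_closed free_gen_closed scalars_cring)

lemma coset_eqI:
  assumes "u \<in> carrier (free_module K (tuples Ms))" "v \<in> carrier (free_module K (tuples Ms))"
    and "u \<ominus>\<^bsub>free_module K (tuples Ms)\<^esub> v \<in> multilinear_gens K Ms"
  shows "multilinear_rels K Ms +>\<^bsub>free_module K (tuples Ms)\<^esub> u
    = multilinear_rels K Ms +>\<^bsub>free_module K (tuples Ms)\<^esub> v"
proof -
  have "u \<ominus>\<^bsub>free_module K (tuples Ms)\<^esub> v \<in> multilinear_rels K Ms"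
    using assms(3) by (auto simp: multilinear_rels_def)
  then have "(u \<ominus>\<^bsub>free_module K (tuples Ms)\<^esub> v) \<oplus>\<^bsub>free_module K (tuples Ms)\<^esub> v
      \<in> multilinear_rels K Ms +>\<^bsub>free_module K (tuples Ms)\<^esub> v"
    using subset assms(2) by (intro F.a_rcosI)
  also have "(u \<ominus>\<^bsub>free_module K (tuples Ms)\<^esub> v) \<oplus>\<^bsub>free_module K (tuples Ms)\<^esub> v = u"
    using assms(1,2) by (simp add: a_minus_def F.a_assoc F.l_neg del: free_module_simps)
  finally show ?thesis
    using F.a_repr_independence[OF _ assms(2) subgroup] by simp
qed

text \<open>Each instance of multilinearity is the vanishing of one generator of the relations in the
  quotient.\<close>

lemma pure_multilinear: "multilinear K Ms (tensor K Ms) (pure_tensor K Ms)"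
proof (intro multilinearI is_linearI)
  fix xs i assume xs: "xs \<in> tuples Ms" and i: "i < length Ms"
  interpret M: module K "Ms ! i" by (rule factor) fact
  note gen = free_gen_closed[OF scalars_cring tuples_update[OF xs i]]
  fix a assume a: "a \<in> carrier (Ms ! i)"
  show "pure_tensor K Ms (xs[i := a]) \<in> carrier (tensor K Ms)"
    using xs i a by (intro pure_closed tuples_update)
  {
    fix b assume b: "b \<in> carrier (Ms ! i)"
    show "pure_tensor K Ms (xs[i := a \<oplus>\<^bsub>Ms ! i\<^esub> b])
      = pure_tensor K Ms (xs[i := a]) \<oplus>\<^bsub>tensor K Ms\<^esub> pure_tensor K Ms (xs[i := b])"
      unfolding pure_tensor_def tensor_def coset_add[OF gen[OF a] gen[OF b]]
      using xs i a b by (intro coset_eqI F.a_closed gen) (auto simp: multilinear_gens_def simp del: free_module_simps)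
  next
    fix c assume c: "c \<in> carrier K"
    show "pure_tensor K Ms (xs[i := c \<odot>\<^bsub>Ms ! i\<^esub> a]) = c \<odot>\<^bsub>tensor K Ms\<^esub> pure_tensor K Ms (xs[i := a])"
      unfolding pure_tensor_def tensor_def coset_smult[OF c gen[OF a]]
      using xs i a c by (intro coset_eqI F.smult_closed gen) (auto simp: multilinear_gens_def simp del: free_module_simps)
  }
qed (rule pure_closed)

text \<open>Every tensor is the coset of a linear combination of tuples, so induction over the free
  module applies.\<close>

lemma tensor_induct [consumes 1, case_names pure zero add smult]:
  assumes "X \<in> carrier (tensor K Ms)"
    and pure: "\<And>xs. xs \<in> tuples Ms \<Longrightarrow> Q (pure_tensor K Ms xs)"
    and zero: "Q \<zero>\<^bsub>tensor K Ms\<^esub>"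
    and add: "\<And>X Y. X \<in> carrier (tensor K Ms) \<Longrightarrow> Y \<in> carrier (tensor K Ms) \<Longrightarrow> Q X \<Longrightarrow> Q Y
      \<Longrightarrow> Q (X \<oplus>\<^bsub>tensor K Ms\<^esub> Y)"
    and smult: "\<And>c X. c \<in> carrier K \<Longrightarrow> X \<in> carrier (tensor K Ms) \<Longrightarrow> Q X
      \<Longrightarrow> Q (c \<odot>\<^bsub>tensor K Ms\<^esub> X)"
  shows "Q X"
proof -
  obtain f where f: "f \<in> carrier (free_module K (tuples Ms))"
    and X: "X = multilinear_rels K Ms +>\<^bsub>free_module K (tuples Ms)\<^esub> f"
    using assms(1) unfolding tensor_def by (rule coset_cases)
  note lin = coset_linear[folded tensor_def]
  have "Q (multilinear_rels K Ms +>\<^bsub>free_module K (tuples Ms)\<^esub> f)"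
    using scalars_cring f
  proof (induction rule: free_module_induct)
    case zero
    show ?case
      using is_linear_zero[OF F.module_axioms tensor_is_module lin] assms(3) by simp
  next
    case (gen x)
    show ?case
      using pure[OF gen] by (simp add: pure_tensor_def)
  next
    case (add f g)
    then show ?case
      unfolding is_linear_add[OF lin add(1,2)] by (intro assms(4) is_linear_closed[OF lin])
  next
    case (smult c f)
    then show ?case
      unfolding is_linear_smult[OF lin smult(1,2)] by (intro assms(5) is_linear_closed[OF lin])
  qed
  then show ?thesis
    by (simp add: X)
qed

lemma tensor_ext:
  assumes "X \<in> carrier (tensor K Ms)" "module K L"
    and "is_linear K (tensor K Ms) L f" "is_linear K (tensor K Ms) L f'"
    and "\<And>xs. xs \<in> tuples Ms \<Longrightarrow> f (pure_tensor K Ms xs) = f' (pure_tensor K Ms xs)"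
  shows "f X = f' X"
  using assms(1)
proof (induction rule: tensor_induct)
  case zero
  then show ?case
    using is_linear_zero[OF tensor_is_module assms(2)] assms(3,4) by metis
qed (simp_all add: assms(5) is_linear_add[OF assms(3)] is_linear_add[OF assms(4)]
    is_linear_smult[OF assms(3)] is_linear_smult[OF assms(4)])

text \<open>Well-definedness of \<open>tensor_lift\<close>: the kernel of the linear extension of a multilinear map
  is a submodule that contains the defining relations, hence all of \<open>multilinear_rels\<close>.\<close>

lemma tensor_lift_coset:
  assumes L: "module K L" and g: "multilinear K Ms L g" and f: "f \<in> carrier (free_module K (tuples Ms))"
  shows "tensor_lift K Ms L g (multilinear_rels K Ms +>\<^bsub>free_module K (tuples Ms)\<^esub> f) = lin_ext K L g f"
proof -
  interpret L: module K L by fact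
  have gc: "g \<in> tuples Ms \<rightarrow> carrier L"
    using g by (auto simp: multilinear_def)
  note lin = lin_ext_linear[OF L gc]
  note gen = lin_ext_gen[OF L gc]
  note genc = free_gen_closed[OF scalars_cring tuples_update]
  define N where "N = {f \<in> carrier (free_module K (tuples Ms)). lin_ext K L g f = \<zero>\<^bsub>L\<^esub>}"
  have "submodule N K (free_module K (tuples Ms))"
  proof (rule F.submoduleI)
    show "\<ominus>\<^bsub>free_module K (tuples Ms)\<^esub> f \<in> N" if "f \<in> N" for f
      using that is_linear_minus[OF F.module_axioms L lin, of "\<zero>\<^bsub>free_module K (tuples Ms)\<^esub>" f]
        is_linear_zero[OF F.module_axioms L lin]
      by (simp add: N_def F.minus_eq L.M.minus_eq del: free_module_simps)
  qed (auto simp: N_def is_linear_zero[OF F.module_axioms L lin] is_linear_add[OF lin]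
      is_linear_smult[OF lin] simp del: free_module_simps)
  moreover have "multilinear_gens K Ms \<subseteq> N"
  proof
    fix h assume h: "h \<in> multilinear_gens K Ms"
    consider xs i a b where "xs \<in> tuples Ms" "i < length Ms" "a \<in> carrier (Ms ! i)" "b \<in> carrier (Ms ! i)"
        "h = free_gen K (xs[i := a \<oplus>\<^bsub>Ms ! i\<^esub> b]) \<ominus>\<^bsub>free_module K (tuples Ms)\<^esub>
          (free_gen K (xs[i := a]) \<oplus>\<^bsub>free_module K (tuples Ms)\<^esub> free_gen K (xs[i := b]))"
      | xs i c a where "xs \<in> tuples Ms" "i < length Ms" "c \<in> carrier K" "a \<in> carrier (Ms ! i)"
        "h = free_gen K (xs[i := c \<odot>\<^bsub>Ms ! i\<^esub> a]) \<ominus>\<^bsub>free_module K (tuples Ms)\<^esub>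
          (c \<odot>\<^bsub>free_module K (tuples Ms)\<^esub> free_gen K (xs[i := a]))"
      using h unfolding multilinear_gens_def by blast
    then have "lin_ext K L g h = \<zero>\<^bsub>L\<^esub>"
    proof cases
      case 1
      interpret M: module K "Ms ! i" by (rule factor) fact
      note slot = multilinear_slot[OF g 1(1,2)]
      show ?thesis
        unfolding 1(5)
        using 1(1-4) is_linear_closed[OF slot]
        by (simp add: is_linear_minus[OF F.module_axioms L lin] is_linear_add[OF lin] gen genc tuples_update
            is_linear_add[OF slot] L.M.minus_eq L.M.r_neg del: free_module_simps)
    next
      case 2
      interpret M: module K "Ms ! i" by (rule factor) fact
      note slot = multilinear_slot[OF g 2(1,2)]
      show ?thesis
        unfolding 2(5)
        using 2(1-4) is_linear_closed[OF slot]
        by (simp add: is_linear_minus[OF F.module_axioms L lin] is_linear_smult[OF lin] gen genc tuples_update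
            is_linear_smult[OF slot] L.M.minus_eq L.M.r_neg del: free_module_simps)
    qed
    then show "h \<in> N"
      using h gens_subset by (auto simp: N_def)
  qed
  ultimately have rels: "multilinear_rels K Ms \<subseteq> N"
    unfolding multilinear_rels_def by blast
  have "lin_ext K L g f' = lin_ext K L g f"
    if f': "f' \<in> multilinear_rels K Ms +>\<^bsub>free_module K (tuples Ms)\<^esub> f" for f'
  proof -
    obtain h where "h \<in> multilinear_rels K Ms" "f' = h \<oplus>\<^bsub>free_module K (tuples Ms)\<^esub> f"
      using f' by (auto simp: a_r_coset_def')
    then have h: "h \<in> carrier (free_module K (tuples Ms))" "lin_ext K L g h = \<zero>\<^bsub>L\<^esub>"
        "f' = h \<oplus>\<^bsub>free_module K (tuples Ms)\<^esub> f"
      using rels by (auto simp: N_def)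
    show ?thesis
      unfolding h(3) is_linear_add[OF lin h(1) f] using h(2) is_linear_closed[OF lin f] by simp
  qed
  moreover have "f \<in> multilinear_rels K Ms +>\<^bsub>free_module K (tuples Ms)\<^esub> f"
    using F.a_rcosI[OF _ subset f, of "\<zero>\<^bsub>free_module K (tuples Ms)\<^esub>"] f zero_closed
    by (simp del: free_module_simps)
  ultimately show ?thesis
    unfolding tensor_lift_eq_lin_ext by (metis someI_ex)
qed

lemma tensor_lift_linear:
  assumes L: "module K L" and g: "multilinear K Ms L g"
  shows "is_linear K (tensor K Ms) L (tensor_lift K Ms L g)"
proof -
  have gc: "g \<in> tuples Ms \<rightarrow> carrier L"
    using g by (auto simp: multilinear_def)
  note lin = lin_ext_linear[OF L gc]
  show ?thesis
    unfolding tensor_def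
    by (intro is_linearI)
      (auto elim!: coset_cases simp: coset_add coset_smult tensor_lift_coset[OF L g] is_linear_add[OF lin]
        is_linear_smult[OF lin] is_linear_closed[OF lin] simp del: free_module_simps)
qed

lemma tensor_lift_pure:
  assumes L: "module K L" and g: "multilinear K Ms L g" and xs: "xs \<in> tuples Ms"
  shows "tensor_lift K Ms L g (pure_tensor K Ms xs) = g xs"
  unfolding pure_tensor_def tensor_lift_coset[OF L g free_gen_closed[OF scalars_cring xs]]
  using g by (intro lin_ext_gen[OF L _ xs]) (auto simp: multilinear_def)

lemma representative:
  assumes "X \<in> carrier (tensor K Ms)"
  shows "(SOME f. f \<in> X) \<in> carrier (free_module K (tuples Ms))"
proof -
  obtain f where f: "f \<in> carrier (free_module K (tuples Ms))"
    "X = multilinear_rels K Ms +>\<^bsub>free_module K (tuples Ms)\<^esub> f"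
    using assms unfolding tensor_def by (rule coset_cases)
  then have "f \<in> X"
    using F.a_rcosI[OF _ subset f(1), of "\<zero>\<^bsub>free_module K (tuples Ms)\<^esub>"] f zero_closed
    by (simp del: free_module_simps)
  then have "(SOME f. f \<in> X) \<in> X"
    by (rule someI[of "\<lambda>f. f \<in> X"])
  then show ?thesis
    using F.a_r_coset_subset_G[OF subset f(1)] f(2) by blast
qed

text \<open>Since \<open>tensor_lift\<close> evaluates on a representative that does not depend on the multilinear map,
  it is linear in the multilinear map.\<close>

lemma tensor_lift_param_linear:
  assumes "module K A" "module K L" "X \<in> carrier (tensor K Ms)"
    and "\<And>xs. xs \<in> tuples Ms \<Longrightarrow> is_linear K A L (\<lambda>a. g a xs)"
  shows "is_linear K A L (\<lambda>a. tensor_lift K Ms L (g a) X)"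
  unfolding tensor_lift_eq_lin_ext
  by (rule lin_ext_param_linear[OF assms(1,2) representative[OF assms(3)] assms(4)])

lemma tensor_lift_unique:
  assumes "module K L" "is_linear K (tensor K Ms) L h"
    and "\<And>xs. xs \<in> tuples Ms \<Longrightarrow> h (pure_tensor K Ms xs) = g xs"
    and "X \<in> carrier (tensor K Ms)"
  shows "tensor_lift K Ms L g X = h X"
proof -
  have eq: "lin_ext K L g f = lin_ext K L (\<lambda>xs. h (pure_tensor K Ms xs)) f"
    if "f \<in> carrier (free_module K (tuples Ms))" for f
  proof -
    interpret L: module K L by fact
    show ?thesis
      unfolding lin_ext_def using that is_linear_closed[OF assms(2)] pure_closed
      by (intro L.finsum_cong') (auto simp: free_module_carrier assms(3)[symmetric] subset_iff)
  qed
  note ml = multilinear_compose[OF pure_multilinear assms(2)]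
  have "tensor_lift K Ms L g X = tensor_lift K Ms L (\<lambda>xs. h (pure_tensor K Ms xs)) X"
    unfolding tensor_lift_eq_lin_ext by (rule eq[OF representative[OF assms(4)]])
  also have "\<dots> = h X"
    by (rule tensor_ext[OF assms(4,1) tensor_lift_linear[OF assms(1) ml] assms(2)])
      (rule tensor_lift_pure[OF assms(1) ml])
  finally show ?thesis .
qed

lemma tensor_lift_cong:
  assumes "module K L" "multilinear K Ms L g" "\<And>xs. xs \<in> tuples Ms \<Longrightarrow> g' xs = g xs"
    and "X \<in> carrier (tensor K Ms)"
  shows "tensor_lift K Ms L g' X = tensor_lift K Ms L g X"
  by (rule tensor_lift_unique[OF assms(1) tensor_lift_linear[OF assms(1,2)] _ assms(4)])
    (simp add: tensor_lift_pure[OF assms(1,2)] assms(3))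

end

lemma tensor_productI: "cring K \<Longrightarrow> (\<And>M. M \<in> set Ms \<Longrightarrow> module K M) \<Longrightarrow> tensor_product K Ms"
  by (simp add: tensor_product_def)


section \<open>Concatenation of tensors\<close>

locale tensor_product_pair = A: tensor_product K As + B: tensor_product K Bs
  for K :: "'k ring" and As Bs :: "('k, 'v, 'e) module_scheme list"
begin

sublocale AB: tensor_product K "As @ Bs"
  using A.factors B.factors A.scalars_cring by (intro tensor_product.intro) auto

lemma multilinear_append_right:
  assumes "multilinear K (As @ Bs) L g" "xs \<in> tuples As"
  shows "multilinear K Bs L (\<lambda>ys. g (xs @ ys))"
proof (rule multilinearI)
  fix ys i assume "ys \<in> tuples Bs" "i < length Bs"
  then show "is_linear K (Bs ! i) L (\<lambda>a. g (xs @ ys[i := a]))"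
    using multilinear_slot[OF assms(1) tuples_append[OF assms(2)], of ys "length As + i"]
      tuples_length[OF assms(2)]
    by (simp add: list_update_append nth_append)
qed (use assms in \<open>auto intro: multilinear_closed tuples_append\<close>)

lemma multilinear_append_left:
  assumes "multilinear K (As @ Bs) L g" "ys \<in> tuples Bs"
  shows "multilinear K As L (\<lambda>xs. g (xs @ ys))"
proof (rule multilinearI)
  fix xs i assume "xs \<in> tuples As" "i < length As"
  then show "is_linear K (As ! i) L (\<lambda>a. g (xs[i := a] @ ys))"
    using multilinear_slot[OF assms(1) tuples_append[OF _ assms(2)], of xs i] tuples_length[of xs As]
    by (simp add: list_update_append1 nth_append)
qed (use assms in \<open>auto intro: multilinear_closed tuples_append\<close>)

lemma append_right_linear:
  assumes "xs \<in> tuples As"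
  shows "is_linear K (tensor K Bs) (tensor K (As @ Bs))
    (tensor_lift K Bs (tensor K (As @ Bs)) (\<lambda>ys. pure_tensor K (As @ Bs) (xs @ ys)))"
  by (intro B.tensor_lift_linear AB.tensor_is_module multilinear_append_right AB.pure_multilinear assms)

text \<open>The right factor \<open>Y\<close> is arbitrary here, so linearity in a slot on the left is linearity of a
  lift in its parameter.\<close>

lemma append_left_multilinear:
  assumes "Y \<in> carrier (tensor K Bs)"
  shows "multilinear K As (tensor K (As @ Bs))
    (\<lambda>xs. tensor_lift K Bs (tensor K (As @ Bs)) (\<lambda>ys. pure_tensor K (As @ Bs) (xs @ ys)) Y)"
proof (rule multilinearI)
  fix xs i assume "xs \<in> tuples As" "i < length As"
  then show "is_linear K (As ! i) (tensor K (As @ Bs))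
      (\<lambda>a. tensor_lift K Bs (tensor K (As @ Bs)) (\<lambda>ys. pure_tensor K (As @ Bs) (xs[i := a] @ ys)) Y)"
    by (intro B.tensor_lift_param_linear A.factor AB.tensor_is_module assms
        multilinear_slot[OF multilinear_append_left[OF AB.pure_multilinear]])
qed (rule is_linear_closed[OF append_right_linear assms])

lemma tensor_append_bilinear:
  "bilinear K (tensor K As) (tensor K Bs) (tensor K (As @ Bs)) (tensor_append K As Bs)"
  unfolding tensor_append_def
  by (intro bilinearI A.tensor_lift_linear A.tensor_lift_param_linear AB.tensor_is_module B.tensor_is_module
      append_left_multilinear append_right_linear)

lemma tensor_append_pure:
  assumes "xs \<in> tuples As" "ys \<in> tuples Bs"
  shows "tensor_append K As Bs (pure_tensor K As xs) (pure_tensor K Bs ys) = pure_tensor K (As @ Bs) (xs @ ys)"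
  unfolding tensor_append_def
    A.tensor_lift_pure[OF AB.tensor_is_module append_left_multilinear[OF B.pure_closed[OF assms(2)]] assms(1)]
  by (intro B.tensor_lift_pure AB.tensor_is_module multilinear_append_right AB.pure_multilinear assms)

lemma tensor_append_ext:
  assumes "Z \<in> carrier (tensor K (As @ Bs))" "module K L"
    and "is_linear K (tensor K (As @ Bs)) L f" "is_linear K (tensor K (As @ Bs)) L f'"
    and "\<And>X Y. X \<in> carrier (tensor K As) \<Longrightarrow> Y \<in> carrier (tensor K Bs) \<Longrightarrow>
      f (tensor_append K As Bs X Y) = f' (tensor_append K As Bs X Y)"
  shows "f Z = f' Z"
  using assms(1-4)
proof (rule AB.tensor_ext)
  fix zs assume "zs \<in> tuples (As @ Bs)"
  then obtain xs ys where "zs = xs @ ys" "xs \<in> tuples As" "ys \<in> tuples Bs"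
    by (rule tuples_appendE)
  then show "f (pure_tensor K (As @ Bs) zs) = f' (pure_tensor K (As @ Bs) zs)"
    using assms(5)[OF A.pure_closed B.pure_closed] by (simp add: tensor_append_pure)
qed

lemma bilinear_ext:
  assumes "module K L" "bilinear K (tensor K As) (tensor K Bs) L g" "bilinear K (tensor K As) (tensor K Bs) L g'"
    and "\<And>xs ys. xs \<in> tuples As \<Longrightarrow> ys \<in> tuples Bs \<Longrightarrow>
      g (pure_tensor K As xs) (pure_tensor K Bs ys) = g' (pure_tensor K As xs) (pure_tensor K Bs ys)"
    and "X \<in> carrier (tensor K As)" "Y \<in> carrier (tensor K Bs)"
  shows "g X Y = g' X Y"
proof (rule A.tensor_ext[OF assms(5,1)])
  fix xs assume xs: "xs \<in> tuples As"
  show "g (pure_tensor K As xs) Y = g' (pure_tensor K As xs) Y"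
    by (rule B.tensor_ext[OF assms(6,1) bilinear_right[OF assms(2) A.pure_closed[OF xs]]
          bilinear_right[OF assms(3) A.pure_closed[OF xs]] assms(4)[OF xs]])
qed (intro bilinear_left[OF assms(2) assms(6)] bilinear_left[OF assms(3) assms(6)])+

text \<open>A bilinear map on two blocks of factors is a multilinear map on all factors. The products of
  maps and the braiding are defined by lists that are cut with \<open>take\<close> and \<open>drop\<close>, and the next two
  lemmas turn them into maps that are determined by their values on concatenations.\<close>

lemma split_multilinear:
  assumes "bilinear K (tensor K As) (tensor K Bs) L h"
  shows "multilinear K (As @ Bs) L
    (\<lambda>zs. h (pure_tensor K As (take (length As) zs)) (pure_tensor K Bs (drop (length As) zs)))"
proof (rule multilinearI)
  fix zs assume "zs \<in> tuples (As @ Bs)"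
  then obtain xs ys where zs: "zs = xs @ ys" "xs \<in> tuples As" "ys \<in> tuples Bs"
    by (rule tuples_appendE)
  have [simp]: "length xs = length As"
    using zs tuples_length by blast
  show "h (pure_tensor K As (take (length As) zs)) (pure_tensor K Bs (drop (length As) zs)) \<in> carrier L"
    using bilinear_closed[OF assms A.pure_closed[OF zs(2)] B.pure_closed[OF zs(3)]] by (simp add: zs(1))
  fix i assume i: "i < length (As @ Bs)"
  show "is_linear K ((As @ Bs) ! i) L (\<lambda>a. h (pure_tensor K As (take (length As) (zs[i := a])))
      (pure_tensor K Bs (drop (length As) (zs[i := a]))))"
  proof (cases "i < length As")
    case True
    then show ?thesis
      using is_linear_compose[OF bilinear_left[OF assms B.pure_closed[OF zs(3)]]
          multilinear_slot[OF A.pure_multilinear zs(2) True]]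
      by (simp add: zs(1) list_update_append1 nth_append)
  next
    case False
    then have "i - length As < length Bs"
      using i by simp
    from is_linear_compose[OF bilinear_right[OF assms A.pure_closed[OF zs(2)]]
          multilinear_slot[OF B.pure_multilinear zs(3) this]]
    show ?thesis
      using False by (simp add: zs(1) list_update_append nth_append)
  qed
qed

lemma tensor_lift_append:
  assumes "module K L" "bilinear K (tensor K As) (tensor K Bs) L h"
    and "X \<in> carrier (tensor K As)" "Y \<in> carrier (tensor K Bs)"
  shows "tensor_lift K (As @ Bs) L
    (\<lambda>zs. h (pure_tensor K As (take (length As) zs)) (pure_tensor K Bs (drop (length As) zs)))
    (tensor_append K As Bs X Y) = h X Y"
proof -
  let ?l = "tensor_lift K (As @ Bs) L
    (\<lambda>zs. h (pure_tensor K As (take (length As) zs)) (pure_tensor K Bs (drop (length As) zs)))"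
  note lin = AB.tensor_lift_linear[OF assms(1) split_multilinear[OF assms(2)]]
  have "bilinear K (tensor K As) (tensor K Bs) L (\<lambda>X Y. ?l (tensor_append K As Bs X Y))"
    using tensor_append_bilinear by (intro bilinearI is_linear_compose[OF lin]) (auto simp: bilinear_def)
  then show ?thesis
  proof (rule bilinear_ext[OF assms(1) _ assms(2) _ assms(3,4)])
    fix xs ys assume xs: "xs \<in> tuples As" and ys: "ys \<in> tuples Bs"
    have [simp]: "length xs = length As"
      using xs tuples_length by blast
    show "?l (tensor_append K As Bs (pure_tensor K As xs) (pure_tensor K Bs ys))
      = h (pure_tensor K As xs) (pure_tensor K Bs ys)"
      unfolding tensor_append_pure[OF xs ys]
        AB.tensor_lift_pure[OF assms(1) split_multilinear[OF assms(2)] tuples_append[OF xs ys]]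
      by simp
  qed
qed

end

text \<open>Both sides are linear in each of the three tensors, and on pure tensors the claim is the
  associativity of list concatenation.\<close>

lemma tensor_append_assoc:
  fixes K :: "'k ring" and As Bs Cs :: "('k, 'v, 'e) module_scheme list"
  assumes "tensor_product K As" "tensor_product K Bs" "tensor_product K Cs"
    and "X \<in> carrier (tensor K As)" "Y \<in> carrier (tensor K Bs)" "Z \<in> carrier (tensor K Cs)"
  shows "tensor_append K (As @ Bs) Cs (tensor_append K As Bs X Y) Z
    = tensor_append K As (Bs @ Cs) X (tensor_append K Bs Cs Y Z)"
proof -
  interpret A: tensor_product K As by fact
  interpret B: tensor_product K Bs by fact
  interpret C: tensor_product K Cs by fact
  interpret AB: tensor_product_pair K As Bs by unfold_locales
  interpret BC: tensor_product_pair K Bs Cs by unfold_locales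
  interpret AB_C: tensor_product_pair K "As @ Bs" Cs by unfold_locales
  interpret A_BC: tensor_product_pair K As "Bs @ Cs" by unfold_locales
  note [simp] = A.pure_closed B.pure_closed C.pure_closed
  note lin = is_linear_compose[OF bilinear_left[OF AB_C.tensor_append_bilinear, unfolded append_assoc]]
    is_linear_compose[OF bilinear_right[OF A_BC.tensor_append_bilinear]]
    bilinear_left[OF A_BC.tensor_append_bilinear]
    bilinear_right[OF AB_C.tensor_append_bilinear, unfolded append_assoc]
    bilinear_left[OF AB.tensor_append_bilinear] bilinear_right[OF AB.tensor_append_bilinear]
    bilinear_left[OF BC.tensor_append_bilinear] bilinear_right[OF BC.tensor_append_bilinear]
    bilinear_closed[OF AB.tensor_append_bilinear] bilinear_closed[OF BC.tensor_append_bilinear]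
  show ?thesis
  proof (rule A.tensor_ext[OF assms(4) A_BC.AB.tensor_is_module])
    fix xs assume xs: "xs \<in> tuples As"
    show "tensor_append K (As @ Bs) Cs (tensor_append K As Bs (pure_tensor K As xs) Y) Z
      = tensor_append K As (Bs @ Cs) (pure_tensor K As xs) (tensor_append K Bs Cs Y Z)"
    proof (rule B.tensor_ext[OF assms(5) A_BC.AB.tensor_is_module])
      fix ys assume ys: "ys \<in> tuples Bs"
      show "tensor_append K (As @ Bs) Cs (tensor_append K As Bs (pure_tensor K As xs) (pure_tensor K Bs ys)) Z
        = tensor_append K As (Bs @ Cs) (pure_tensor K As xs) (tensor_append K Bs Cs (pure_tensor K Bs ys) Z)"
      proof (rule C.tensor_ext[OF assms(6) A_BC.AB.tensor_is_module])
        fix zs assume zs: "zs \<in> tuples Cs"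
        show "tensor_append K (As @ Bs) Cs (tensor_append K As Bs (pure_tensor K As xs) (pure_tensor K Bs ys)) (pure_tensor K Cs zs)
          = tensor_append K As (Bs @ Cs) (pure_tensor K As xs) (tensor_append K Bs Cs (pure_tensor K Bs ys) (pure_tensor K Cs zs))"
          using xs ys zs
          by (simp add: AB.tensor_append_pure BC.tensor_append_pure AB_C.tensor_append_pure
              A_BC.tensor_append_pure tuples_append)
      qed (use xs ys in \<open>auto intro!: lin\<close>)
    qed (use xs assms in \<open>auto intro!: lin\<close>)
  qed (use assms in \<open>auto intro!: lin\<close>)
qed


section \<open>Sweedler calculus\<close>

text \<open>An identity between elements of \<open>U \<otimes> U\<close> or \<open>U \<otimes> U \<otimes> U\<close> is used only through the sums
  \<open>\<Sum> g X\<^sub>1 X\<^sub>2\<close> that it yields for multilinear \<open>g\<close>. The rules below compute with such sums: linear maps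
  pass under the sum, independent sums commute, and products, flips and coproducts turn into
  iterated sums. Each rule is linear in the tensors involved, so that it needs a proof on pure tensors
  only.\<close>

definition trilinear ::
    "'k ring \<Rightarrow> ('k, 'a, 'e) module_scheme \<Rightarrow> ('k, 'b, 'f) module_scheme \<Rightarrow> ('k, 'c, 'g) module_scheme \<Rightarrow>
      ('k, 'w, 'h) module_scheme \<Rightarrow> ('a \<Rightarrow> 'b \<Rightarrow> 'c \<Rightarrow> 'w) \<Rightarrow> bool" where
  "trilinear K A B C L g \<longleftrightarrow>
    (\<forall>a\<in>carrier A. bilinear K B C L (g a)) \<and>
    (\<forall>b\<in>carrier B. \<forall>c\<in>carrier C. is_linear K A L (\<lambda>a. g a b c))"

lemma trilinearI:
  assumes "\<And>b c. b \<in> carrier B \<Longrightarrow> c \<in> carrier C \<Longrightarrow> is_linear K A L (\<lambda>a. g a b c)"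
    and "\<And>a c. a \<in> carrier A \<Longrightarrow> c \<in> carrier C \<Longrightarrow> is_linear K B L (\<lambda>b. g a b c)"
    and "\<And>a b. a \<in> carrier A \<Longrightarrow> b \<in> carrier B \<Longrightarrow> is_linear K C L (\<lambda>c. g a b c)"
  shows "trilinear K A B C L g"
  using assms by (auto simp: trilinear_def intro!: bilinearI)

lemma trilinear_slots:
  assumes "trilinear K A B C L g"
  shows "b \<in> carrier B \<Longrightarrow> c \<in> carrier C \<Longrightarrow> is_linear K A L (\<lambda>a. g a b c)"
    and "a \<in> carrier A \<Longrightarrow> c \<in> carrier C \<Longrightarrow> is_linear K B L (\<lambda>b. g a b c)"
    and "a \<in> carrier A \<Longrightarrow> b \<in> carrier B \<Longrightarrow> is_linear K C L (\<lambda>c. g a b c)"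
    and "a \<in> carrier A \<Longrightarrow> bilinear K B C L (\<lambda>b c. g a b c)"
    and "c \<in> carrier C \<Longrightarrow> bilinear K A B L (\<lambda>a b. g a b c)"
    and "b \<in> carrier B \<Longrightarrow> bilinear K A C L (\<lambda>a c. g a b c)"
  using assms by (auto simp: trilinear_def bilinear_def)

context hopf_algebra
begin

abbreviation "K \<equiv> scalars U"

lemma U_module: "module K U"
  by (rule module_axioms)

lemma U_ring: "ring U"
  by (rule assoc_algebra.axioms(1)) (rule assoc_algebra_axioms)

lemmas U_distr = ring.ring_simprules(13,23)[OF U_ring]
lemmas U_m_closed = ring.ring_simprules(5)[OF U_ring]

lemma tensor_product_U: "tensor_product K (replicate n U)"
  by (rule tensor_productI) (auto simp: R.is_cring U_module)

lemma tpow_module: "module K (tpow U n)"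
  unfolding tpow_def by (rule tensor_product.tensor_is_module) (rule tensor_product_U)

lemma tpow_conv: "tpow U 2 = tensor K [U, U]" "tpow U 3 = tensor K [U, U, U]" "tpow U (Suc 0) = tensor K [U]"
  by (simp_all add: tpow_def numeral_2_eq_2 numeral_3_eq_3)

lemma U2: "tensor_product K [U, U]" and U3: "tensor_product K [U, U, U]" and U1: "tensor_product K [U]"
  using tensor_product_U[of 2] tensor_product_U[of 3] tensor_product_U[of 1]
  by (simp_all add: numeral_2_eq_2 numeral_3_eq_3)

lemma ptens_tuples: "set us \<subseteq> carrier U \<Longrightarrow> us \<in> tuples (replicate (length us) U)"
  by (auto simp: tuples_iff list_all2_conv_all_nth)

lemma ptens_closed: "set us \<subseteq> carrier U \<Longrightarrow> n = length us \<Longrightarrow> ptens U us \<in> carrier (tpow U n)"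
  using tensor_product.pure_closed[OF tensor_product_U ptens_tuples] by (simp add: ptens_def tpow_def)

lemma ptens_linear:
  assumes "set us \<subseteq> carrier U" "i < length us" "n = length us"
  shows "is_linear K U (tpow U n) (\<lambda>a. ptens U (us[i := a]))"
  using multilinear_slot[OF tensor_product.pure_multilinear[OF tensor_product_U] ptens_tuples[OF assms(1)], of i]
    assms(2,3)
  by (simp add: ptens_def tpow_def)

lemma tpow_ext:
  assumes "X \<in> carrier (tpow U n)" "module K L"
    and "is_linear K (tpow U n) L f" "is_linear K (tpow U n) L f'"
    and "\<And>us. set us \<subseteq> carrier U \<Longrightarrow> length us = n \<Longrightarrow> f (ptens U us) = f' (ptens U us)"
  shows "f X = f' X"
proof (rule tensor_product.tensor_ext[OF tensor_product_U assms(1-4)[unfolded tpow_def]])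
  fix us assume us: "us \<in> tuples (replicate n U)"
  then have "length us = n"
    using tuples_length by fastforce
  moreover have "set us \<subseteq> carrier U"
    using us tuples_nth[OF us] by (auto simp: in_set_conv_nth \<open>length us = n\<close>)
  ultimately show "f (pure_tensor K (replicate n U) us) = f' (pure_tensor K (replicate n U) us)"
    using assms(5)[of us] by (simp add: ptens_def)
qed

lemma tpow2_ext:
  assumes "X \<in> carrier (tpow U 2)" "module K L"
    and "is_linear K (tpow U 2) L f" "is_linear K (tpow U 2) L f'"
    and "\<And>a b. a \<in> carrier U \<Longrightarrow> b \<in> carrier U \<Longrightarrow> f (ptens U [a, b]) = f' (ptens U [a, b])"
  shows "f X = f' X"
  using assms by (elim tpow_ext) (auto simp: numeral_2_eq_2 length_Suc_conv)

lemma mult_left_linear: "b \<in> carrier U \<Longrightarrow> is_linear K A U f \<Longrightarrow> is_linear K A U (\<lambda>x. f x \<otimes> b)"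
  and mult_right_linear: "b \<in> carrier U \<Longrightarrow> is_linear K A U f \<Longrightarrow> is_linear K A U (\<lambda>x. b \<otimes> f x)"
  by (auto simp: is_linear_def Pi_def U_distr smult_mult_left smult_mult_right)

lemma sweedler_multilinear:
  assumes g: "bilinear K U U L g"
  shows "multilinear K [U, U] L (\<lambda>us. g (us ! 0) (us ! 1))"
proof (rule multilinearI)
  fix us assume us: "us \<in> tuples [U, U]"
  then have c: "us ! 0 \<in> carrier U" "us ! 1 \<in> carrier U" "length us = 2"
    using tuples_nth[OF us, of 0] tuples_nth[OF us, of 1] tuples_length[OF us] by auto
  then show "g (us ! 0) (us ! 1) \<in> carrier L"
    using g by (auto intro: bilinear_closed)
  fix i assume "i < length [U, U]"
  then consider "i = 0" | "i = 1"
    by fastforce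
  then show "is_linear K ([U, U] ! i) L (\<lambda>a. g (us[i := a] ! 0) (us[i := a] ! 1))"
    using c bilinear_left[OF g, of "us ! 1"] bilinear_right[OF g, of "us ! 0"] by cases auto
qed

lemma sweedler_linear:
  "module K L \<Longrightarrow> bilinear K U U L g \<Longrightarrow> is_linear K (tpow U 2) L (sweedler U L g)"
  unfolding sweedler_def tpow_conv
  by (intro tensor_product.tensor_lift_linear U2 sweedler_multilinear)

lemma sweedler_closed:
  "module K L \<Longrightarrow> bilinear K U U L g \<Longrightarrow> X \<in> carrier (tpow U 2) \<Longrightarrow> sweedler U L g X \<in> carrier L"
  by (rule is_linear_closed[OF sweedler_linear])

lemma sweedler_pure:
  assumes "module K L" "bilinear K U U L g" "a \<in> carrier U" "b \<in> carrier U"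
  shows "sweedler U L g (ptens U [a, b]) = g a b"
  using tensor_product.tensor_lift_pure[OF U2 assms(1) sweedler_multilinear[OF assms(2)], of "[a, b]"] assms(3,4)
  by (simp add: sweedler_def ptens_def tuples_iff)

lemma sweedler_param_linear:
  assumes "module K A" "module K L" "X \<in> carrier (tpow U 2)"
    and "\<And>a b. a \<in> carrier U \<Longrightarrow> b \<in> carrier U \<Longrightarrow> is_linear K A L (\<lambda>x. g x a b)"
  shows "is_linear K A L (\<lambda>x. sweedler U L (g x) X)"
  unfolding sweedler_def
proof (rule tensor_product.tensor_lift_param_linear[OF U2 assms(1,2) assms(3)[unfolded tpow_conv]])
  fix us assume us: "us \<in> tuples [U, U]"
  show "is_linear K A L (\<lambda>x. g x (us ! 0) (us ! 1))"
    using tuples_nth[OF us, of 0] tuples_nth[OF us, of 1] by (intro assms(4)) auto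
qed

lemma sweedler_compose:
  assumes "module K L" "module K L'" "bilinear K U U L g" "is_linear K L L' h" "X \<in> carrier (tpow U 2)"
  shows "h (sweedler U L g X) = sweedler U L' (\<lambda>a b. h (g a b)) X"
proof (rule tpow2_ext[OF assms(5,2)])
  have bl: "bilinear K U U L' (\<lambda>a b. h (g a b))"
    using assms(3) by (intro bilinearI is_linear_compose[OF assms(4)]) (auto simp: bilinear_def)
  show "is_linear K (tpow U 2) L' (\<lambda>X. h (sweedler U L g X))"
    by (intro is_linear_compose[OF assms(4)] sweedler_linear assms)
  show "is_linear K (tpow U 2) L' (sweedler U L' (\<lambda>a b. h (g a b)))"
    by (intro sweedler_linear assms bl)
  show "h (sweedler U L g (ptens U [a, b])) = sweedler U L' (\<lambda>a b. h (g a b)) (ptens U [a, b])"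
    if "a \<in> carrier U" "b \<in> carrier U" for a b
    using that by (simp add: sweedler_pure assms bl)
qed

lemma sweedler_cong:
  assumes "module K L" "bilinear K U U L g" "X \<in> carrier (tpow U 2)"
    and "\<And>a b. a \<in> carrier U \<Longrightarrow> b \<in> carrier U \<Longrightarrow> g' a b = g a b"
  shows "sweedler U L g' X = sweedler U L g X"
  unfolding sweedler_def
proof (rule tensor_product.tensor_lift_cong[OF U2 assms(1) sweedler_multilinear[OF assms(2)] _ assms(3)[unfolded tpow_conv]])
  fix us assume us: "us \<in> tuples [U, U]"
  then show "g' (us ! 0) (us ! 1) = g (us ! 0) (us ! 1)"
    using tuples_nth[OF us, of 0] tuples_nth[OF us, of 1] by (intro assms(4)) auto
qed

text \<open>Fubini for the sums over two independent tensors.\<close>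

lemma sweedler_swap:
  assumes L: "module K L" and X: "X \<in> carrier (tpow U 2)" and Y: "Y \<in> carrier (tpow U 2)"
    and g1: "\<And>a b. a \<in> carrier U \<Longrightarrow> b \<in> carrier U \<Longrightarrow> bilinear K U U L (\<lambda>c d. g a b c d)"
    and g2: "\<And>c d. c \<in> carrier U \<Longrightarrow> d \<in> carrier U \<Longrightarrow> bilinear K U U L (\<lambda>a b. g a b c d)"
  shows "sweedler U L (\<lambda>a b. sweedler U L (\<lambda>c d. g a b c d) Y) X
    = sweedler U L (\<lambda>c d. sweedler U L (\<lambda>a b. g a b c d) X) Y"
proof -
  have b: "bilinear K U U L (\<lambda>a b. sweedler U L (\<lambda>c d. g a b c d) Y)"
    by (intro bilinearI sweedler_param_linear L Y U_module bilinear_left[OF g2] bilinear_right[OF g2])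
  show ?thesis
  proof (rule tpow2_ext[OF X L sweedler_linear[OF L b]])
    show "is_linear K (tpow U 2) L (\<lambda>X. sweedler U L (\<lambda>c d. sweedler U L (\<lambda>a b. g a b c d) X) Y)"
      by (intro sweedler_param_linear tpow_module L Y sweedler_linear g2)
    fix a b assume ab: "a \<in> carrier U" "b \<in> carrier U"
    have "sweedler U L (\<lambda>c d. sweedler U L (\<lambda>a b. g a b c d) (ptens U [a, b])) Y
        = sweedler U L (\<lambda>c d. g a b c d) Y"
      using ab by (intro sweedler_cong L g1 Y) (simp_all add: sweedler_pure[OF L g2])
    then show "sweedler U L (\<lambda>a b. sweedler U L (\<lambda>c d. g a b c d) Y) (ptens U [a, b])
      = sweedler U L (\<lambda>c d. sweedler U L (\<lambda>a b. g a b c d) (ptens U [a, b])) Y"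
      using ab by (simp add: sweedler_pure[OF L b])
  qed
qed

lemma comult_closed: "a \<in> carrier U \<Longrightarrow> comult U a \<in> carrier (tpow U 2)"
  by (rule is_linear_closed[OF comult_linear])

lemma sweedler_comult_linear:
  assumes "module K L" "bilinear K U U L g" "is_linear K A U f"
  shows "is_linear K A L (\<lambda>x. sweedler U L g (comult U (f x)))"
  by (rule is_linear_compose[OF sweedler_linear[OF assms(1,2)] is_linear_compose[OF comult_linear assms(3)]])

lemma map2_update:
  "i < length as \<Longrightarrow> length as = length bs \<Longrightarrow>
    map2 f (as[i := a]) bs = (map2 f as bs)[i := f a (bs ! i)]"
  "i < length bs \<Longrightarrow> length as = length bs \<Longrightarrow>
    map2 f as (bs[i := b]) = (map2 f as bs)[i := f (as ! i) b]"
  by (auto intro!: nth_equalityI simp: nth_list_update)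

lemma tuples_replicate: "us \<in> tuples (replicate n U) \<longleftrightarrow> length us = n \<and> set us \<subseteq> carrier U"
  by (auto simp: tuples_iff list_all2_conv_all_nth in_set_conv_nth subset_iff)

lemma map2_mult_closed: "set as \<subseteq> carrier U \<Longrightarrow> set bs \<subseteq> carrier U \<Longrightarrow> set (map2 (\<lambda>a b. a \<otimes> b) as bs) \<subseteq> carrier U"
  by (auto intro!: U_m_closed dest: set_zip_leftD set_zip_rightD)

lemma tpow_mult_aux:
  assumes "set as \<subseteq> carrier U" "length as = n"
  shows "multilinear K (replicate n U) (tpow U n) (\<lambda>bs. ptens U (map2 (\<lambda>a b. a \<otimes> b) as bs))"
    and "multilinear K (replicate n U) (tpow U n) (\<lambda>bs. ptens U (map2 (\<lambda>a b. a \<otimes> b) bs as))"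
proof -
  show "multilinear K (replicate n U) (tpow U n) (\<lambda>bs. ptens U (map2 (\<lambda>a b. a \<otimes> b) as bs))"
  proof (rule multilinearI)
    fix bs i assume bs: "bs \<in> tuples (replicate n U)" and i: "i < length (replicate n U)"
    then have "as ! i \<in> carrier U"
      using assms by (auto simp: subset_iff)
    then show "is_linear K (replicate n U ! i) (tpow U n) (\<lambda>a. ptens U (map2 (\<lambda>a b. a \<otimes> b) as (bs[i := a])))"
      using bs i assms map2_mult_closed[of as bs]
      by (auto simp: map2_update tuples_replicate intro!: is_linear_compose[OF ptens_linear] mult_right_linear is_linear_id)
  qed (use assms in \<open>auto simp: tuples_replicate intro!: ptens_closed[OF map2_mult_closed]\<close>)
  show "multilinear K (replicate n U) (tpow U n) (\<lambda>bs. ptens U (map2 (\<lambda>a b. a \<otimes> b) bs as))"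
  proof (rule multilinearI)
    fix bs i assume bs: "bs \<in> tuples (replicate n U)" and i: "i < length (replicate n U)"
    then have "as ! i \<in> carrier U"
      using assms by (auto simp: subset_iff)
    then show "is_linear K (replicate n U ! i) (tpow U n) (\<lambda>a. ptens U (map2 (\<lambda>a b. a \<otimes> b) (bs[i := a]) as))"
      using bs i assms map2_mult_closed[of bs as]
      by (auto simp: map2_update tuples_replicate intro!: is_linear_compose[OF ptens_linear] mult_left_linear is_linear_id)
  qed (use assms in \<open>auto simp: tuples_replicate intro!: ptens_closed[OF map2_mult_closed]\<close>)
qed

lemma tpow_mult_aux2:
  assumes Y: "Y \<in> carrier (tpow U n)"
  shows "multilinear K (replicate n U) (tpow U n)
    (\<lambda>as. tensor_lift K (replicate n U) (tpow U n) (\<lambda>bs. ptens U (map2 (\<lambda>a b. a \<otimes> b) as bs)) Y)"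
proof (rule multilinearI)
  fix as i assume as: "as \<in> tuples (replicate n U)" and i: "i < length (replicate n U)"
  show "is_linear K (replicate n U ! i) (tpow U n) (\<lambda>a. tensor_lift K (replicate n U) (tpow U n)
      (\<lambda>bs. ptens U (map2 (\<lambda>a b. a \<otimes> b) (as[i := a]) bs)) Y)"
  proof (rule tensor_product.tensor_lift_param_linear[OF tensor_product_U _ tpow_module Y[unfolded tpow_def]])
    fix bs assume "bs \<in> tuples (replicate n U)"
    then show "is_linear K (replicate n U ! i) (tpow U n) (\<lambda>a. ptens U (map2 (\<lambda>a b. a \<otimes> b) (as[i := a]) bs))"
      using multilinear_slot[OF tpow_mult_aux(2) as i, of bs] by (simp add: tuples_replicate)
  qed (use i U_module in simp)
next
  fix as assume "as \<in> tuples (replicate n U)"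
  then show "tensor_lift K (replicate n U) (tpow U n) (\<lambda>bs. ptens U (map2 (\<lambda>a b. a \<otimes> b) as bs)) Y \<in> carrier (tpow U n)"
    using is_linear_closed[OF tensor_product.tensor_lift_linear[OF tensor_product_U tpow_module tpow_mult_aux(1)]] Y
    by (auto simp: tuples_replicate tpow_def)
qed

lemma tpow_mult_bilinear: "bilinear K (tpow U n) (tpow U n) (tpow U n) (tpow_mult U n)"
proof (rule bilinearI)
  fix X assume X: "X \<in> carrier (tpow U n)"
  show "is_linear K (tpow U n) (tpow U n) (\<lambda>Y. tpow_mult U n X Y)"
    unfolding tpow_mult_def
  proof (rule tensor_product.tensor_lift_param_linear[OF tensor_product_U tpow_module tpow_module X[unfolded tpow_def]])
    fix as assume "as \<in> tuples (replicate n U)"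
    then show "is_linear K (tpow U n) (tpow U n)
        (\<lambda>Y. tensor_lift K (replicate n U) (tpow U n) (\<lambda>bs. ptens U (map2 (\<lambda>a b. a \<otimes> b) as bs)) Y)"
      using tensor_product.tensor_lift_linear[OF tensor_product_U tpow_module tpow_mult_aux(1)]
      by (auto simp: tuples_replicate tpow_def)
  qed
next
  fix Y assume Y: "Y \<in> carrier (tpow U n)"
  show "is_linear K (tpow U n) (tpow U n) (\<lambda>X. tpow_mult U n X Y)"
    unfolding tpow_mult_def
    using tensor_product.tensor_lift_linear[OF tensor_product_U tpow_module tpow_mult_aux2[OF Y]]
    by (simp add: tpow_def)
qed

lemma tpow_mult_pure:
  assumes "set as \<subseteq> carrier U" "length as = n" "set bs \<subseteq> carrier U" "length bs = n"
  shows "tpow_mult U n (ptens U as) (ptens U bs) = ptens U (map2 (\<lambda>a b. a \<otimes> b) as bs)"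
proof -
  have t: "as \<in> tuples (replicate n U)" "bs \<in> tuples (replicate n U)"
    using assms by (auto simp: tuples_replicate)
  have p: "ptens U as = pure_tensor K (replicate n U) as" "ptens U bs = pure_tensor K (replicate n U) bs"
    using assms by (auto simp: ptens_def)
  have "ptens U bs \<in> carrier (tpow U n)"
    using assms by (intro ptens_closed) auto
  from tensor_product.tensor_lift_pure[OF tensor_product_U tpow_module tpow_mult_aux2[OF this] t(1)]
    tensor_product.tensor_lift_pure[OF tensor_product_U tpow_module tpow_mult_aux(1)[OF assms(1,2)] t(2)]
  show ?thesis
    by (simp add: tpow_mult_def p)
qed

lemma sweedler_mult:
  assumes L: "module K L" and g: "bilinear K U U L g"
    and X: "X \<in> carrier (tpow U 2)" and Y: "Y \<in> carrier (tpow U 2)"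
  shows "sweedler U L g (tpow_mult U 2 X Y) = sweedler U L (\<lambda>a b. sweedler U L (\<lambda>c d. g (a \<otimes> c) (b \<otimes> d)) Y) X"
proof -
  have g1: "bilinear K U U L (\<lambda>c d. g (a \<otimes> c) (b \<otimes> d))" if "a \<in> carrier U" "b \<in> carrier U" for a b
    using that
    by (auto intro!: bilinearI is_linear_compose[OF bilinear_left[OF g]] is_linear_compose[OF bilinear_right[OF g]]
        mult_right_linear is_linear_id)
  have g2: "bilinear K U U L (\<lambda>a b. g (a \<otimes> c) (b \<otimes> d))" if "c \<in> carrier U" "d \<in> carrier U" for c d
    using that
    by (auto intro!: bilinearI is_linear_compose[OF bilinear_left[OF g]] is_linear_compose[OF bilinear_right[OF g]]
        mult_left_linear is_linear_id)
  have b: "bilinear K U U L (\<lambda>a b. sweedler U L (\<lambda>c d. g (a \<otimes> c) (b \<otimes> d)) Z)" if "Z \<in> carrier (tpow U 2)" for Z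
    by (intro bilinearI sweedler_param_linear L that U_module bilinear_left[OF g2] bilinear_right[OF g2])
  note lin = is_linear_compose[OF sweedler_linear[OF L g]]
  show ?thesis
  proof (rule tpow2_ext[OF X L lin[OF bilinear_left[OF tpow_mult_bilinear Y]] sweedler_linear[OF L b[OF Y]]])
    fix a b assume ab: "a \<in> carrier U" "b \<in> carrier U"
    have "sweedler U L g (tpow_mult U 2 (ptens U [a, b]) Y) = sweedler U L (\<lambda>c d. g (a \<otimes> c) (b \<otimes> d)) Y"
    proof (rule tpow2_ext[OF Y L lin[OF bilinear_right[OF tpow_mult_bilinear]] sweedler_linear[OF L g1[OF ab]]])
      show "ptens U [a, b] \<in> carrier (tpow U 2)"
        using ab by (intro ptens_closed) auto
      fix c d assume cd: "c \<in> carrier U" "d \<in> carrier U"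
      show "sweedler U L g (tpow_mult U 2 (ptens U [a, b]) (ptens U [c, d]))
        = sweedler U L (\<lambda>c d. g (a \<otimes> c) (b \<otimes> d)) (ptens U [c, d])"
        using ab cd by (simp add: tpow_mult_pure sweedler_pure L g g1)
    qed
    then show "sweedler U L g (tpow_mult U 2 (ptens U [a, b]) Y)
      = sweedler U L (\<lambda>a b. sweedler U L (\<lambda>c d. g (a \<otimes> c) (b \<otimes> d)) Y) (ptens U [a, b])"
      using ab by (simp add: sweedler_pure L b[OF Y])
  qed
qed

lemma ptens2_bilinear: "bilinear K U U (tpow U 2) (\<lambda>a b. ptens U [b, a])"
  using ptens_linear[of "[_, \<zero>]" 1 2] ptens_linear[of "[\<zero>, _]" 0 2] by (intro bilinearI) auto

lemma flip_closed: "X \<in> carrier (tpow U 2) \<Longrightarrow> flip U X \<in> carrier (tpow U 2)"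
  unfolding flip_def by (intro sweedler_closed tpow_module ptens2_bilinear)

lemma sweedler_flip:
  assumes L: "module K L" and g: "bilinear K U U L g" and X: "X \<in> carrier (tpow U 2)"
  shows "sweedler U L g (flip U X) = sweedler U L (\<lambda>a b. g b a) X"
proof -
  have "bilinear K U U L (\<lambda>a b. g b a)"
    using g by (auto simp: bilinear_def)
  moreover have "sweedler U L g (ptens U [b, a]) = g b a" if "a \<in> carrier U" "b \<in> carrier U" for a b
    using that by (intro sweedler_pure L g)
  ultimately show ?thesis
    unfolding flip_def sweedler_compose[OF tpow_module L ptens2_bilinear sweedler_linear[OF L g] X]
    by (intro sweedler_cong L X)
qed

definition sweedler3 :: "('k, 'w, 'f) module_scheme \<Rightarrow> ('u \<Rightarrow> 'u \<Rightarrow> 'u \<Rightarrow> 'w) \<Rightarrow> ('u list \<Rightarrow> 'k) set \<Rightarrow> 'w" where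
  "sweedler3 L g = tensor_lift K [U, U, U] L (\<lambda>us. g (us ! 0) (us ! 1) (us ! 2))"

lemma sweedler3_multilinear:
  assumes g: "trilinear K U U U L g"
  shows "multilinear K [U, U, U] L (\<lambda>us. g (us ! 0) (us ! 1) (us ! 2))"
proof (rule multilinearI)
  fix us assume us: "us \<in> tuples [U, U, U]"
  then have c: "us ! 0 \<in> carrier U" "us ! 1 \<in> carrier U" "us ! 2 \<in> carrier U" "length us = 3"
    using tuples_nth[OF us, of 0] tuples_nth[OF us, of 1] tuples_nth[OF us, of 2] tuples_length[OF us] by auto
  then show "g (us ! 0) (us ! 1) (us ! 2) \<in> carrier L"
    using is_linear_closed[OF trilinear_slots(1)[OF g]] by auto
  fix i assume "i < length [U, U, U]"
  then consider "i = 0" | "i = 1" | "i = 2"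
    by fastforce
  then show "is_linear K ([U, U, U] ! i) L (\<lambda>a. g (us[i := a] ! 0) (us[i := a] ! 1) (us[i := a] ! 2))"
    using c trilinear_slots(1-3)[OF g] by cases auto
qed

lemma sweedler3_linear:
  "module K L \<Longrightarrow> trilinear K U U U L g \<Longrightarrow> is_linear K (tpow U 3) L (sweedler3 L g)"
  unfolding sweedler3_def tpow_conv
  by (intro tensor_product.tensor_lift_linear U3 sweedler3_multilinear)

lemma sweedler3_pure:
  assumes "module K L" "trilinear K U U U L g" "a \<in> carrier U" "b \<in> carrier U" "c \<in> carrier U"
  shows "sweedler3 L g (ptens U [a, b, c]) = g a b c"
  using tensor_product.tensor_lift_pure[OF U3 assms(1) sweedler3_multilinear[OF assms(2)], of "[a, b, c]"] assms(3-)
  by (simp add: sweedler3_def ptens_def tuples_iff)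

lemma pair_21: "tensor_product_pair K [U, U] [U]" and pair_12: "tensor_product_pair K [U] [U, U]"
  by (simp_all add: tensor_product_pair_def U1 U2)

lemma append_21_bilinear: "bilinear K (tpow U 2) (tpow U (Suc 0)) (tpow U 3) (tensor_append K [U, U] [U])"
  and append_12_bilinear: "bilinear K (tpow U (Suc 0)) (tpow U 2) (tpow U 3) (tensor_append K [U] [U, U])"
  using tensor_product_pair.tensor_append_bilinear[OF pair_21]
    tensor_product_pair.tensor_append_bilinear[OF pair_12]
  by (simp_all add: tpow_conv)

lemma ptens1_linear: "is_linear K U (tpow U (Suc 0)) (\<lambda>a. ptens U [a])"
proof -
  have "is_linear K U (tpow U (Suc 0)) (\<lambda>a. ptens U ([\<zero>][0 := a]))"
    by (rule ptens_linear) simp_all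
  then show ?thesis
    by (simp only: list_update.simps nat.case)
qed

lemma append_ptens:
  assumes "set as \<subseteq> carrier U" "set bs \<subseteq> carrier U"
  shows "tensor_append K (replicate (length as) U) (replicate (length bs) U) (ptens U as) (ptens U bs) = ptens U (as @ bs)"
proof -
  have "tensor_product_pair K (replicate (length as) U) (replicate (length bs) U)"
    by (simp add: tensor_product_pair_def tensor_product_U)
  from tensor_product_pair.tensor_append_pure[OF this ptens_tuples ptens_tuples, OF assms]
  show ?thesis
    by (simp add: ptens_def replicate_add)
qed

lemma comult_id_bilinear:
  "bilinear K U U (tpow U 3) (\<lambda>a b. tensor_append K [U, U] [U] (comult U a) (ptens U [b]))"
  by (intro bilinearI is_linear_compose[OF bilinear_left[OF append_21_bilinear] comult_linear]
      is_linear_compose[OF bilinear_right[OF append_21_bilinear] ptens1_linear] comult_closed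
      is_linear_closed[OF ptens1_linear])

lemma id_comult_bilinear:
  "bilinear K U U (tpow U 3) (\<lambda>a b. tensor_append K [U] [U, U] (ptens U [a]) (comult U b))"
  by (intro bilinearI is_linear_compose[OF bilinear_left[OF append_12_bilinear] ptens1_linear]
      is_linear_compose[OF bilinear_right[OF append_12_bilinear] comult_linear] comult_closed
      is_linear_closed[OF ptens1_linear])

lemma sweedler3_append:
  assumes L: "module K L" and g: "trilinear K U U U L g" and X: "X \<in> carrier (tpow U 2)" and c: "c \<in> carrier U"
  shows "sweedler3 L g (tensor_append K [U, U] [U] X (ptens U [c])) = sweedler U L (\<lambda>a b. g a b c) X"
    and "sweedler3 L g (tensor_append K [U] [U, U] (ptens U [c]) X) = sweedler U L (\<lambda>a b. g c a b) X"
proof -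
  have p: "ptens U [c] \<in> carrier (tpow U (Suc 0))"
    using c by (rule is_linear_closed[OF ptens1_linear])
  show "sweedler3 L g (tensor_append K [U, U] [U] X (ptens U [c])) = sweedler U L (\<lambda>a b. g a b c) X"
  proof (rule tpow2_ext[OF X L is_linear_compose[OF sweedler3_linear[OF L g] bilinear_left[OF append_21_bilinear p]]
        sweedler_linear[OF L trilinear_slots(5)[OF g c]]])
    show "sweedler3 L g (tensor_append K [U, U] [U] (ptens U [a, b]) (ptens U [c]))
        = sweedler U L (\<lambda>a b. g a b c) (ptens U [a, b])" if "a \<in> carrier U" "b \<in> carrier U" for a b
      using append_ptens[of "[a, b]" "[c]"] that c
      by (simp add: sweedler3_pure[OF L g] sweedler_pure[OF L trilinear_slots(5)[OF g c]])
  qed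
  show "sweedler3 L g (tensor_append K [U] [U, U] (ptens U [c]) X) = sweedler U L (\<lambda>a b. g c a b) X"
  proof (rule tpow2_ext[OF X L is_linear_compose[OF sweedler3_linear[OF L g] bilinear_right[OF append_12_bilinear p]]
        sweedler_linear[OF L trilinear_slots(4)[OF g c]]])
    show "sweedler3 L g (tensor_append K [U] [U, U] (ptens U [c]) (ptens U [a, b]))
        = sweedler U L (\<lambda>a b. g c a b) (ptens U [a, b])" if "a \<in> carrier U" "b \<in> carrier U" for a b
      using append_ptens[of "[c]" "[a, b]"] that c
      by (simp add: sweedler3_pure[OF L g] sweedler_pure[OF L trilinear_slots(4)[OF g c]])
  qed
qed

lemma sweedler_sweedler_comult_bilinear:
  assumes L: "module K L" and g: "trilinear K U U U L g"
  shows "bilinear K U U L (\<lambda>a b. sweedler U L (\<lambda>p q. g p q b) (comult U a))"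
    and "bilinear K U U L (\<lambda>a b. sweedler U L (\<lambda>p q. g a p q) (comult U b))"
  by (intro bilinearI sweedler_comult_linear L is_linear_id trilinear_slots[OF g] sweedler_param_linear U_module
      comult_closed; assumption)+

lemma sweedler3_comult_id:
  assumes L: "module K L" and g: "trilinear K U U U L g" and X: "X \<in> carrier (tpow U 2)"
  shows "sweedler3 L g (comult_id U X) = sweedler U L (\<lambda>a b. sweedler U L (\<lambda>p q. g p q b) (comult U a)) X"
  unfolding comult_id_def sweedler_compose[OF tpow_module L comult_id_bilinear sweedler3_linear[OF L g] X]
  by (intro sweedler_cong sweedler_sweedler_comult_bilinear L g X sweedler3_append comult_closed)

lemma sweedler3_id_comult:
  assumes L: "module K L" and g: "trilinear K U U U L g" and X: "X \<in> carrier (tpow U 2)"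
  shows "sweedler3 L g (id_comult U X) = sweedler U L (\<lambda>a b. sweedler U L (\<lambda>p q. g a p q) (comult U b)) X"
  unfolding id_comult_def sweedler_compose[OF tpow_module L id_comult_bilinear sweedler3_linear[OF L g] X]
  by (intro sweedler_cong sweedler_sweedler_comult_bilinear L g X sweedler3_append comult_closed)

lemma sweedler_coassoc:
  assumes "module K L" "trilinear K U U U L g" "a \<in> carrier U"
  shows "sweedler U L (\<lambda>x y. sweedler U L (\<lambda>p q. g p q y) (comult U x)) (comult U a)
    = sweedler U L (\<lambda>x y. sweedler U L (\<lambda>p q. g x p q) (comult U y)) (comult U a)"
  using sweedler3_comult_id[OF assms(1,2) comult_closed[OF assms(3)]]
    sweedler3_id_comult[OF assms(1,2) comult_closed[OF assms(3)]] coassoc[OF assms(3)]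
  by simp

text \<open>The tensors \<open>R\<^sub>1\<^sub>2\<close>, \<open>R\<^sub>1\<^sub>3\<close> and \<open>R\<^sub>2\<^sub>3\<close> all have the form \<open>\<Sum> \<alpha> X\<^sub>1 X\<^sub>2\<close> with pure tensors \<open>\<alpha> X\<^sub>1 X\<^sub>2\<close> of
  length three, so one formula covers the products of any two of them.\<close>

lemma sweedler3_mult:
  assumes L: "module K L" and g: "trilinear K U U U L g"
    and X: "X \<in> carrier (tpow U 2)" and Y: "Y \<in> carrier (tpow U 2)"
    and \<alpha>: "bilinear K U U (tpow U 3) (\<lambda>a b. ptens U (\<alpha> a b))"
      "\<And>a b. a \<in> carrier U \<Longrightarrow> b \<in> carrier U \<Longrightarrow> set (\<alpha> a b) \<subseteq> carrier U \<and> length (\<alpha> a b) = 3"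
    and \<beta>: "bilinear K U U (tpow U 3) (\<lambda>a b. ptens U (\<beta> a b))"
      "\<And>a b. a \<in> carrier U \<Longrightarrow> b \<in> carrier U \<Longrightarrow> set (\<beta> a b) \<subseteq> carrier U \<and> length (\<beta> a b) = 3"
  shows "sweedler3 L g (tpow_mult U 3 (sweedler U (tpow U 3) (\<lambda>a b. ptens U (\<alpha> a b)) X)
        (sweedler U (tpow U 3) (\<lambda>a b. ptens U (\<beta> a b)) Y))
    = sweedler U L (\<lambda>a b. sweedler U L (\<lambda>c d. g (\<alpha> a b ! 0 \<otimes> \<beta> c d ! 0) (\<alpha> a b ! 1 \<otimes> \<beta> c d ! 1)
        (\<alpha> a b ! 2 \<otimes> \<beta> c d ! 2)) Y) X"
proof -
  note lin = is_linear_compose[OF sweedler3_linear[OF L g]]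
  let ?Y = "sweedler U (tpow U 3) (\<lambda>a b. ptens U (\<beta> a b)) Y"
  have Y3: "?Y \<in> carrier (tpow U 3)"
    by (intro sweedler_closed tpow_module \<beta> Y)
  have val: "sweedler3 L g (tpow_mult U 3 (ptens U (\<alpha> a b)) (ptens U (\<beta> c d)))
      = g (\<alpha> a b ! 0 \<otimes> \<beta> c d ! 0) (\<alpha> a b ! 1 \<otimes> \<beta> c d ! 1) (\<alpha> a b ! 2 \<otimes> \<beta> c d ! 2)"
    if "a \<in> carrier U" "b \<in> carrier U" "c \<in> carrier U" "d \<in> carrier U" for a b c d
    using \<alpha>(2)[OF that(1,2)] \<beta>(2)[OF that(3,4)]
    by (auto simp: numeral_3_eq_3 length_Suc_conv tpow_mult_pure sweedler3_pure[OF L g] numeral_2_eq_2)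
  have pc: "ptens U (\<alpha> a b) \<in> carrier (tpow U 3)" "ptens U (\<beta> a b) \<in> carrier (tpow U 3)"
    if "a \<in> carrier U" "b \<in> carrier U" for a b
    using that \<alpha> \<beta> by (auto intro: bilinear_closed)
  let ?v = "\<lambda>a b c d. sweedler3 L g (tpow_mult U 3 (ptens U (\<alpha> a b)) (ptens U (\<beta> c d)))"
  have b1: "bilinear K U U L (?v a b)" if "a \<in> carrier U" "b \<in> carrier U" for a b
    using that bilinear_left[OF \<beta>(1)] bilinear_right[OF \<beta>(1)]
    by (intro bilinearI lin is_linear_compose[OF bilinear_right[OF tpow_mult_bilinear]] pc)
  have b1': "bilinear K U U L (\<lambda>c d. g (\<alpha> a b ! 0 \<otimes> \<beta> c d ! 0) (\<alpha> a b ! 1 \<otimes> \<beta> c d ! 1) (\<alpha> a b ! 2 \<otimes> \<beta> c d ! 2))"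
    if "a \<in> carrier U" "b \<in> carrier U" for a b
    by (rule bilinear_cong[OF b1[OF that] U_module U_module]) (rule val[OF that])
  have inner: "sweedler3 L g (tpow_mult U 3 (ptens U (\<alpha> a b)) ?Y)
      = sweedler U L (\<lambda>c d. g (\<alpha> a b ! 0 \<otimes> \<beta> c d ! 0) (\<alpha> a b ! 1 \<otimes> \<beta> c d ! 1) (\<alpha> a b ! 2 \<otimes> \<beta> c d ! 2)) Y"
    if ab: "a \<in> carrier U" "b \<in> carrier U" for a b
  proof -
    have "sweedler3 L g (tpow_mult U 3 (ptens U (\<alpha> a b)) ?Y) = sweedler U L (?v a b) Y"
      by (rule sweedler_compose[OF tpow_module L \<beta>(1) lin[OF bilinear_right[OF tpow_mult_bilinear pc(1)[OF ab]]] Y])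
    also have "\<dots> = sweedler U L (\<lambda>c d. g (\<alpha> a b ! 0 \<otimes> \<beta> c d ! 0) (\<alpha> a b ! 1 \<otimes> \<beta> c d ! 1) (\<alpha> a b ! 2 \<otimes> \<beta> c d ! 2)) Y"
      by (intro sweedler_cong[OF L b1'[OF ab] Y] val ab)
    finally show ?thesis .
  qed
  have b2: "bilinear K U U L (\<lambda>a b. sweedler3 L g (tpow_mult U 3 (ptens U (\<alpha> a b)) ?Y))"
    using bilinear_left[OF \<alpha>(1)] bilinear_right[OF \<alpha>(1)]
    by (intro bilinearI lin is_linear_compose[OF bilinear_left[OF tpow_mult_bilinear]] Y3)
  have "sweedler3 L g (tpow_mult U 3 (sweedler U (tpow U 3) (\<lambda>a b. ptens U (\<alpha> a b)) X) ?Y)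
    = sweedler U L (\<lambda>a b. sweedler3 L g (tpow_mult U 3 (ptens U (\<alpha> a b)) ?Y)) X"
    by (rule sweedler_compose[OF tpow_module L \<alpha>(1) lin[OF bilinear_left[OF tpow_mult_bilinear Y3]] X])
  also have "\<dots> = sweedler U L (\<lambda>a b. sweedler U L (\<lambda>c d. g (\<alpha> a b ! 0 \<otimes> \<beta> c d ! 0) (\<alpha> a b ! 1 \<otimes> \<beta> c d ! 1)
        (\<alpha> a b ! 2 \<otimes> \<beta> c d ! 2)) Y) X"
    by (rule sweedler_cong[OF L b2 X, symmetric]) (rule inner[symmetric])
  finally show ?thesis .
qed

end

context quasitriangular_hopf_algebra
begin

lemma ptens3_bilinear:
  "bilinear K U U (tpow U 3) (\<lambda>a b. ptens U [a, b, \<one>])"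
  "bilinear K U U (tpow U 3) (\<lambda>a b. ptens U [a, \<one>, b])"
  "bilinear K U U (tpow U 3) (\<lambda>a b. ptens U [\<one>, a, b])"
  using ptens_linear[of "[\<zero>, _, \<one>]" 0 3] ptens_linear[of "[_, \<zero>, \<one>]" 1 3]
    ptens_linear[of "[\<zero>, \<one>, _]" 0 3] ptens_linear[of "[_, \<one>, \<zero>]" 2 3]
    ptens_linear[of "[\<one>, \<zero>, _]" 1 3] ptens_linear[of "[\<one>, _, \<zero>]" 2 3]
  by (auto intro!: bilinearI simp: numeral_2_eq_2)

text \<open>The axiom \<open>(\<Delta> \<otimes> id) R = R\<^sub>1\<^sub>3 R\<^sub>2\<^sub>3\<close> in Sweedler form.\<close>

lemma sweedler_cabling_left:
  assumes L: "module K L" and g: "trilinear K U U U L g"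
  shows "sweedler U L (\<lambda>a b. sweedler U L (\<lambda>p q. g p q b) (comult U a)) (rmatrix U)
    = sweedler U L (\<lambda>a b. sweedler U L (\<lambda>c d. g a c (b \<otimes> d)) (rmatrix U)) (rmatrix U)"
proof -
  note R = rmatrix_closed
  have "sweedler U L (\<lambda>a b. sweedler U L (\<lambda>p q. g p q b) (comult U a)) (rmatrix U)
    = sweedler3 L g (tpow_mult U 3 (R13 U) (R23 U))"
    using sweedler3_comult_id[OF L g R] comult_id_rmatrix by simp
  also have "\<dots> = sweedler U L (\<lambda>a b. sweedler U L (\<lambda>c d. g (a \<otimes> \<one>) (\<one> \<otimes> c) (b \<otimes> d)) (rmatrix U)) (rmatrix U)"
    unfolding R13_def R23_def
    by (subst sweedler3_mult[OF L g R R ptens3_bilinear(2) _ ptens3_bilinear(3)]) (auto simp: numeral_2_eq_2)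
  also have "\<dots> = sweedler U L (\<lambda>a b. sweedler U L (\<lambda>c d. g a c (b \<otimes> d)) (rmatrix U)) (rmatrix U)"
  proof -
    have 1: "bilinear K U U L (\<lambda>c d. g a c (b \<otimes> d))" if "a \<in> carrier U" "b \<in> carrier U" for a b
      using that
      by (intro bilinearI trilinear_slots[OF g] is_linear_compose[OF trilinear_slots(3)[OF g]] mult_right_linear is_linear_id)
        auto
    have 2: "bilinear K U U L (\<lambda>a b. sweedler U L (\<lambda>c d. g a c (b \<otimes> d)) (rmatrix U))"
      by (intro bilinearI sweedler_param_linear L R U_module trilinear_slots[OF g]
          is_linear_compose[OF trilinear_slots(3)[OF g]] mult_left_linear is_linear_id) auto
    show ?thesis
      by (intro sweedler_cong[OF L 2 R] sweedler_cong[OF L 1 R]) auto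
  qed
  finally show ?thesis .
qed

text \<open>The axiom \<open>(id \<otimes> \<Delta>) R = R\<^sub>1\<^sub>3 R\<^sub>1\<^sub>2\<close> in Sweedler form.\<close>

lemma sweedler_cabling_right:
  assumes L: "module K L" and g: "trilinear K U U U L g"
  shows "sweedler U L (\<lambda>a b. sweedler U L (\<lambda>p q. g a p q) (comult U b)) (rmatrix U)
    = sweedler U L (\<lambda>a b. sweedler U L (\<lambda>c d. g (a \<otimes> c) d b) (rmatrix U)) (rmatrix U)"
proof -
  note R = rmatrix_closed
  have "sweedler U L (\<lambda>a b. sweedler U L (\<lambda>p q. g a p q) (comult U b)) (rmatrix U)
    = sweedler3 L g (tpow_mult U 3 (R13 U) (R12 U))"
    using sweedler3_id_comult[OF L g R] id_comult_rmatrix by simp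
  also have "\<dots> = sweedler U L (\<lambda>a b. sweedler U L (\<lambda>c d. g (a \<otimes> c) (\<one> \<otimes> d) (b \<otimes> \<one>)) (rmatrix U)) (rmatrix U)"
    unfolding R13_def R12_def
    by (subst sweedler3_mult[OF L g R R ptens3_bilinear(2) _ ptens3_bilinear(1)]) (auto simp: numeral_2_eq_2)
  also have "\<dots> = sweedler U L (\<lambda>a b. sweedler U L (\<lambda>c d. g (a \<otimes> c) d b) (rmatrix U)) (rmatrix U)"
  proof -
    have 1: "bilinear K U U L (\<lambda>c d. g (a \<otimes> c) d b)" if "a \<in> carrier U" "b \<in> carrier U" for a b
      using that
      by (intro bilinearI trilinear_slots[OF g] is_linear_compose[OF trilinear_slots(1)[OF g]] mult_right_linear is_linear_id)
        auto
    have 2: "bilinear K U U L (\<lambda>a b. sweedler U L (\<lambda>c d. g (a \<otimes> c) d b) (rmatrix U))"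
      by (intro bilinearI sweedler_param_linear L R U_module trilinear_slots[OF g]
          is_linear_compose[OF trilinear_slots(1)[OF g]] mult_left_linear is_linear_id) auto
    show ?thesis
      by (intro sweedler_cong[OF L 2 R] sweedler_cong[OF L 1 R]) auto
  qed
  finally show ?thesis .
qed

end


section \<open>The action of a Hopf algebra on tensor products of modules\<close>

context hopf_algebra
begin

definition mods :: "('u, 'v) module list \<Rightarrow> bool" where
  "mods As \<longleftrightarrow> (\<forall>A\<in>set As. left_module U A)"

lemma mods_simps [simp]:
  "mods []" "mods (A # As) \<longleftrightarrow> left_module U A \<and> mods As" "mods (As @ Bs) \<longleftrightarrow> mods As \<and> mods Bs"
  "left_module U A \<Longrightarrow> mods (replicate n A)"
  by (auto simp: mods_def)

abbreviation T :: "('u, 'v) module list \<Rightarrow> ('k, ('v list \<Rightarrow> 'k) set) module" where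
  "T \<equiv> tens U"

lemma restr_simps [simp]:
  "carrier (restr U M) = carrier M" "zero (restr U M) = zero M" "add (restr U M) = add M"
  "smult (restr U M) c x = (c \<odot> \<one>) \<odot>\<^bsub>M\<^esub> x"
  by (simp_all add: restr_def)

text \<open>Scalars act on a \<open>U\<close>-module through the elements \<open>c \<odot> \<one>\<close>. These are central in \<open>U\<close>, which is
  why \<open>U\<close> acts by linear maps.\<close>

lemma scalar_simps:
  assumes "c \<in> carrier K"
  shows "d \<in> carrier K \<Longrightarrow> (c \<otimes>\<^bsub>K\<^esub> d) \<odot> \<one> = (c \<odot> \<one>) \<otimes> (d \<odot> \<one>)"
    and "a \<in> carrier U \<Longrightarrow> (c \<odot> \<one>) \<otimes> a = c \<odot> a"
    and "a \<in> carrier U \<Longrightarrow> a \<otimes> (c \<odot> \<one>) = c \<odot> a"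
proof -
  show "(c \<otimes>\<^bsub>K\<^esub> d) \<odot> \<one> = (c \<odot> \<one>) \<otimes> (d \<odot> \<one>)" if "d \<in> carrier K"
    using assms that by (simp add: smult_mult_left smult_assoc1)
qed (use assms in \<open>simp_all add: smult_mult_left smult_mult_right\<close>)

lemma restr_module:
  fixes M :: "('u, 'v) module"
  assumes "left_module U M"
  shows "module K (restr U M)"
proof -
  interpret M: left_module U M by fact
  show ?thesis
  proof (intro moduleI abelian_groupI; (simp only: restr_simps)?)
    fix x assume "x \<in> carrier M"
    then show "\<exists>y\<in>carrier M. y \<oplus>\<^bsub>M\<^esub> x = \<zero>\<^bsub>M\<^esub>"
      by (intro bexI[of _ "\<ominus>\<^bsub>M\<^esub> x"]) (auto simp: M.M.l_neg)
  qed (auto simp: R.is_cring M.M.a_assoc M.M.a_comm M.M.a_lcomm M.action_closed M.action_l_distr M.action_r_distr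
      M.action_one scalar_simps(1) M.action_mult smult_l_distr)
qed

lemma act_linear: "left_module U M \<Longrightarrow> a \<in> carrier U \<Longrightarrow> is_linear K (restr U M) (restr U M) (\<lambda>x. a \<odot>\<^bsub>M\<^esub> x)"
  by (intro is_linearI)
    (simp_all add: left_module.action_closed left_module.action_r_distr scalar_simps
      flip: left_module.action_mult)

lemma act_elt_linear:
  assumes "left_module U M" "x \<in> carrier M"
  shows "is_linear K U (restr U M) (\<lambda>a. a \<odot>\<^bsub>M\<^esub> x)"
proof -
  have "(c \<odot> a) \<odot>\<^bsub>M\<^esub> x = (c \<odot> \<one>) \<odot>\<^bsub>M\<^esub> (a \<odot>\<^bsub>M\<^esub> x)" if "c \<in> carrier K" "a \<in> carrier U" for c a
    using that assms by (simp add: scalar_simps flip: left_module.action_mult)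
  then show ?thesis
    using assms by (intro is_linearI) (simp_all add: left_module.action_closed left_module.action_l_distr)
qed

lemma tensor_product_mods: "mods As \<Longrightarrow> tensor_product K (map (restr U) As)"
  by (rule tensor_productI) (auto simp: R.is_cring restr_module mods_def)

lemma tensor_pair_mods: "mods As \<Longrightarrow> mods Bs \<Longrightarrow> tensor_product_pair K (map (restr U) As) (map (restr U) Bs)"
  by (simp add: tensor_product_pair_def tensor_product_mods)

lemma T_module: "mods As \<Longrightarrow> module K (T As)"
  unfolding tens_def by (rule tensor_product.tensor_is_module) (rule tensor_product_mods)

lemma tappend_bilinear: "mods As \<Longrightarrow> mods Bs \<Longrightarrow> bilinear K (T As) (T Bs) (T (As @ Bs)) (tappend U As Bs)"
  using tensor_product_pair.tensor_append_bilinear[OF tensor_pair_mods] by (simp add: tens_def tappend_def)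

lemma tappend_closed:
  "mods As \<Longrightarrow> mods Bs \<Longrightarrow> C = As @ Bs \<Longrightarrow> x \<in> carrier (T As) \<Longrightarrow> y \<in> carrier (T Bs)
    \<Longrightarrow> tappend U As Bs x y \<in> carrier (T C)"
  using bilinear_closed[OF tappend_bilinear] by blast

lemma tappend_linear_left:
  "mods As \<Longrightarrow> mods Bs \<Longrightarrow> C = As @ Bs \<Longrightarrow> y \<in> carrier (T Bs) \<Longrightarrow> is_linear K A (T As) f
    \<Longrightarrow> is_linear K A (T C) (\<lambda>x. tappend U As Bs (f x) y)"
  using is_linear_compose[OF bilinear_left[OF tappend_bilinear]] by blast

lemma tappend_linear_right:
  "mods As \<Longrightarrow> mods Bs \<Longrightarrow> C = As @ Bs \<Longrightarrow> x \<in> carrier (T As) \<Longrightarrow> is_linear K A (T Bs) f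
    \<Longrightarrow> is_linear K A (T C) (\<lambda>y. tappend U As Bs x (f y))"
  using is_linear_compose[OF bilinear_right[OF tappend_bilinear]] by blast

lemma tappend_assoc:
  "mods As \<Longrightarrow> mods Bs \<Longrightarrow> mods Cs \<Longrightarrow> x \<in> carrier (T As) \<Longrightarrow> y \<in> carrier (T Bs) \<Longrightarrow> z \<in> carrier (T Cs) \<Longrightarrow>
    tappend U (As @ Bs) Cs (tappend U As Bs x y) z = tappend U As (Bs @ Cs) x (tappend U Bs Cs y z)"
  using tensor_append_assoc[OF tensor_product_mods tensor_product_mods tensor_product_mods]
  by (simp add: tens_def tappend_def)

lemma tens_ext2:
  assumes "z \<in> carrier (T C)" "mods As" "mods Bs" "module K L" "C = As @ Bs"
    and "is_linear K (T C) L f" "is_linear K (T C) L f'"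
    and "\<And>x y. x \<in> carrier (T As) \<Longrightarrow> y \<in> carrier (T Bs) \<Longrightarrow> f (tappend U As Bs x y) = f' (tappend U As Bs x y)"
  shows "f z = f' z"
  using tensor_product_pair.tensor_append_ext[OF tensor_pair_mods[OF assms(2,3)] _ assms(4), of z f f'] assms
  by (simp add: tens_def tappend_def)

lemma tens_ext3:
  assumes "z \<in> carrier (T C)" "mods As" "mods Bs" "mods Cs" "module K L" "C = As @ Bs @ Cs"
    and "is_linear K (T C) L f" "is_linear K (T C) L f'"
    and "\<And>x y z. x \<in> carrier (T As) \<Longrightarrow> y \<in> carrier (T Bs) \<Longrightarrow> z \<in> carrier (T Cs) \<Longrightarrow>
      f (tappend U As (Bs @ Cs) x (tappend U Bs Cs y z)) = f' (tappend U As (Bs @ Cs) x (tappend U Bs Cs y z))"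
  shows "f z = f' z"
proof (rule tens_ext2[OF assms(1,2) _ assms(5,6,7,8)])
  show "mods (Bs @ Cs)"
    using assms by simp
  fix x w assume x: "x \<in> carrier (T As)" and w: "w \<in> carrier (T (Bs @ Cs))"
  show "f (tappend U As (Bs @ Cs) x w) = f' (tappend U As (Bs @ Cs) x w)"
    by (rule tens_ext2[OF w assms(3,4,5) HOL.refl]; (intro is_linear_compose[OF assms(7)]
            is_linear_compose[OF assms(8)] tappend_linear_right is_linear_id assms x assms(9))?)
      (use assms in simp_all)
qed

lemma ptens_of_append:
  "mods As \<Longrightarrow> mods Bs \<Longrightarrow> xs \<in> tuples (map (restr U) As) \<Longrightarrow> ys \<in> tuples (map (restr U) Bs) \<Longrightarrow>
    tappend U As Bs (ptens_of U As xs) (ptens_of U Bs ys) = ptens_of U (As @ Bs) (xs @ ys)"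
  using tensor_product_pair.tensor_append_pure[OF tensor_pair_mods] by (simp add: tappend_def ptens_of_def)

lemma ptens_of_closed: "mods As \<Longrightarrow> xs \<in> tuples (map (restr U) As) \<Longrightarrow> ptens_of U As xs \<in> carrier (T As)"
  using tensor_product.pure_closed[OF tensor_product_mods] by (simp add: ptens_of_def tens_def)

lemma tens_ext:
  assumes "z \<in> carrier (T As)" "mods As" "module K L"
    and "is_linear K (T As) L f" "is_linear K (T As) L f'"
    and "\<And>xs. xs \<in> tuples (map (restr U) As) \<Longrightarrow> f (ptens_of U As xs) = f' (ptens_of U As xs)"
  shows "f z = f' z"
  using tensor_product.tensor_ext[OF tensor_product_mods[OF assms(2)] _ assms(3), of z f f'] assms
  by (simp add: tens_def ptens_of_def)

text \<open>The form of extensionality that matches the recursion of \<open>iter_comult\<close>.\<close>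

lemma tens_ext_Cons:
  fixes M :: "('u, 'v) module"
  assumes "z \<in> carrier (T (M # As))" "left_module U M" "mods As" "module K L"
    and "is_linear K (T (M # As)) L f" "is_linear K (T (M # As)) L f'"
    and "\<And>m x. m \<in> carrier M \<Longrightarrow> x \<in> carrier (T As) \<Longrightarrow>
      f (tappend U [M] As (ptens_of U [M] [m]) x) = f' (tappend U [M] As (ptens_of U [M] [m]) x)"
  shows "f z = f' z"
proof (rule tens_ext[OF assms(1) _ assms(4-6)])
  fix xs assume "xs \<in> tuples (map (restr U) (M # As))"
  then obtain m ys where xs: "xs = m # ys" "m \<in> carrier M" "ys \<in> tuples (map (restr U) As)"
    by (auto simp: tuples_iff list_all2_Cons2)
  then have "ptens_of U (M # As) xs = tappend U [M] As (ptens_of U [M] [m]) (ptens_of U As ys)"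
    using ptens_of_append[of "[M]" As "[m]" ys] assms(2,3) by (simp add: tuples_iff)
  then show "f (ptens_of U (M # As) xs) = f' (ptens_of U (M # As) xs)"
    using xs assms(3,7) by (simp add: ptens_of_closed)
qed (use assms in simp)

lemma ptens_of_single: "left_module U M \<Longrightarrow> m \<in> carrier M \<Longrightarrow> ptens_of U [M] [m] \<in> carrier (T [M])"
  by (rule ptens_of_closed) (simp_all add: tuples_iff)

lemma ptens_of_single_linear:
  assumes "left_module U M"
  shows "is_linear K (restr U M) (T [M]) (\<lambda>m. ptens_of U [M] [m])"
proof -
  interpret M: left_module U M by fact
  show ?thesis
    using multilinear_slot[OF tensor_product.pure_multilinear[OF tensor_product_mods[of "[M]"]], of "[\<zero>\<^bsub>M\<^esub>]" 0] assms
    by (simp add: ptens_of_def tens_def tuples_iff)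
qed

lemma ptens_of_act_linear:
  "left_module U M \<Longrightarrow> m \<in> carrier M \<Longrightarrow> is_linear K A U f \<Longrightarrow>
    is_linear K A (T [M]) (\<lambda>x. ptens_of U [M] [f x \<odot>\<^bsub>M\<^esub> m])"
  by (rule is_linear_compose[OF ptens_of_single_linear is_linear_compose[OF act_elt_linear]])

lemma tappend_Nil:
  assumes "mods Bs" "y \<in> carrier (T Bs)"
  shows "tappend U [] Bs (ptens_of U [] []) y = y"
proof (rule tens_ext[OF assms(2,1) T_module[OF assms(1)]])
  have p: "ptens_of U [] [] \<in> carrier (T [])"
    by (rule ptens_of_closed) (simp_all add: tuples_iff)
  show "is_linear K (T Bs) (T Bs) (tappend U [] Bs (ptens_of U [] []))"
    using tappend_linear_right[OF _ assms(1) _ p is_linear_id, of Bs] by simp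
  show "tappend U [] Bs (ptens_of U [] []) (ptens_of U Bs xs) = ptens_of U Bs xs"
    if "xs \<in> tuples (map (restr U) Bs)" for xs
    using ptens_of_append[OF _ assms(1) _ that, of "[]" "[]"] by (simp add: tuples_iff)
qed (rule is_linear_id)

lemma tlift_split_linear:
  "mods As \<Longrightarrow> mods Bs \<Longrightarrow> module K L \<Longrightarrow> bilinear K (T As) (T Bs) L h \<Longrightarrow>
    is_linear K (T (As @ Bs)) L (tlift U (As @ Bs) L
      (\<lambda>zs. h (ptens_of U As (take (length As) zs)) (ptens_of U Bs (drop (length As) zs))))"
  using tensor_product.tensor_lift_linear[OF tensor_product_mods[of "As @ Bs"], of L]
    tensor_product_pair.split_multilinear[OF tensor_pair_mods, of As Bs L h]
  by (simp add: tens_def tlift_def ptens_of_def)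

lemma tlift_split_append:
  "mods As \<Longrightarrow> mods Bs \<Longrightarrow> module K L \<Longrightarrow> bilinear K (T As) (T Bs) L h \<Longrightarrow>
    x \<in> carrier (T As) \<Longrightarrow> y \<in> carrier (T Bs) \<Longrightarrow>
    tlift U (As @ Bs) L (\<lambda>zs. h (ptens_of U As (take (length As) zs)) (ptens_of U Bs (drop (length As) zs)))
      (tappend U As Bs x y) = h x y"
  using tensor_product_pair.tensor_lift_append[OF tensor_pair_mods, of As Bs L h x y]
  by (simp add: tens_def tlift_def ptens_of_def tappend_def)

lemma tpow_act_multilinear:
  assumes "mods Ms" "set us \<subseteq> carrier U" "length us = length Ms"
  shows "multilinear K (map (restr U) Ms) (T Ms)
    (\<lambda>xs. ptens_of U Ms (map (\<lambda>i. us ! i \<odot>\<^bsub>Ms ! i\<^esub> xs ! i) [0..<length Ms]))"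
proof (rule multilinearI)
  fix xs assume xs: "xs \<in> tuples (map (restr U) Ms)"
  let ?ys = "map (\<lambda>i. us ! i \<odot>\<^bsub>Ms ! i\<^esub> xs ! i) [0..<length Ms]"
  have c: "us ! i \<in> carrier U" "left_module U (Ms ! i)" "xs ! i \<in> carrier (Ms ! i)" if "i < length Ms" for i
    using that assms tuples_nth[OF xs, of i] by (auto simp: mods_def subset_iff)
  then have ys: "?ys \<in> tuples (map (restr U) Ms)"
    by (auto simp: tuples_iff list_all2_conv_all_nth intro!: left_module.action_closed)
  then show "ptens_of U Ms ?ys \<in> carrier (T Ms)"
    using assms by (intro ptens_of_closed)
  fix i assume i: "i < length (map (restr U) Ms)"
  have slot: "is_linear K (restr U (Ms ! i)) (T Ms) (\<lambda>a. ptens_of U Ms (?ys[i := a]))"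
    using multilinear_slot[OF tensor_product.pure_multilinear[OF tensor_product_mods] ys, of i] assms(1) i
    by (simp add: tens_def ptens_of_def)
  have "is_linear K (map (restr U) Ms ! i) (T Ms) (\<lambda>a. ptens_of U Ms (?ys[i := us ! i \<odot>\<^bsub>Ms ! i\<^esub> a]))"
    using is_linear_compose[OF slot act_linear] c i by simp
  moreover have "map (\<lambda>j. us ! j \<odot>\<^bsub>Ms ! j\<^esub> xs[i := a] ! j) [0..<length Ms] = ?ys[i := us ! i \<odot>\<^bsub>Ms ! i\<^esub> a]" for a
    using i tuples_length[OF xs] by (auto intro!: nth_equalityI simp: nth_list_update)
  ultimately show "is_linear K (map (restr U) Ms ! i) (T Ms)
      (\<lambda>a. ptens_of U Ms (map (\<lambda>j. us ! j \<odot>\<^bsub>Ms ! j\<^esub> xs[i := a] ! j) [0..<length Ms]))"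
    by simp
qed

lemma tpow_act_multilinear_left:
  assumes Ms: "mods Ms" and Y: "Y \<in> carrier (T Ms)"
  shows "multilinear K (replicate (length Ms) U) (T Ms) (\<lambda>us. tlift U Ms (T Ms)
    (\<lambda>xs. ptens_of U Ms (map (\<lambda>i. us ! i \<odot>\<^bsub>Ms ! i\<^esub> xs ! i) [0..<length Ms])) Y)"
proof (rule multilinearI)
  fix us assume us: "us \<in> tuples (replicate (length Ms) U)"
  show "tlift U Ms (T Ms) (\<lambda>xs. ptens_of U Ms (map (\<lambda>i. us ! i \<odot>\<^bsub>Ms ! i\<^esub> xs ! i) [0..<length Ms])) Y \<in> carrier (T Ms)"
    using is_linear_closed[OF tensor_product.tensor_lift_linear[OF tensor_product_mods[OF Ms] T_module[OF Ms]
          tpow_act_multilinear[OF Ms]]] us Y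
    by (simp add: tlift_def tuples_replicate tens_def)
  fix i assume i: "i < length (replicate (length Ms) U)"
  show "is_linear K (replicate (length Ms) U ! i) (T Ms) (\<lambda>a. tlift U Ms (T Ms)
      (\<lambda>xs. ptens_of U Ms (map (\<lambda>j. us[i := a] ! j \<odot>\<^bsub>Ms ! j\<^esub> xs ! j) [0..<length Ms])) Y)"
    unfolding tlift_def
  proof (rule tensor_product.tensor_lift_param_linear[OF tensor_product_mods[OF Ms] _ T_module[OF Ms] Y[unfolded tens_def]])
    fix xs assume xs: "xs \<in> tuples (map (restr U) Ms)"
    let ?ys = "map (\<lambda>i. us ! i \<odot>\<^bsub>Ms ! i\<^esub> xs ! i) [0..<length Ms]"
    have c: "us ! i \<in> carrier U" "left_module U (Ms ! i)" "xs ! i \<in> carrier (Ms ! i)" if "i < length Ms" for i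
      using that Ms us tuples_nth[OF xs, of i] by (auto simp: mods_def subset_iff tuples_replicate)
    then have ys: "?ys \<in> tuples (map (restr U) Ms)"
      by (auto simp: tuples_iff list_all2_conv_all_nth intro!: left_module.action_closed)
    have slot: "is_linear K (restr U (Ms ! i)) (T Ms) (\<lambda>a. ptens_of U Ms (?ys[i := a]))"
      using multilinear_slot[OF tensor_product.pure_multilinear[OF tensor_product_mods] ys, of i] Ms i
      by (simp add: tens_def ptens_of_def)
    have "is_linear K (replicate (length Ms) U ! i) (T Ms) (\<lambda>a. ptens_of U Ms (?ys[i := a \<odot>\<^bsub>Ms ! i\<^esub> xs ! i]))"
      using is_linear_compose[OF slot act_elt_linear] c i by simp
    moreover have "map (\<lambda>j. us[i := a] ! j \<odot>\<^bsub>Ms ! j\<^esub> xs ! j) [0..<length Ms] = ?ys[i := a \<odot>\<^bsub>Ms ! i\<^esub> xs ! i]" for a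
      using i us by (auto intro!: nth_equalityI simp: nth_list_update tuples_replicate)
    ultimately show "is_linear K (replicate (length Ms) U ! i) (T Ms)
        (\<lambda>a. ptens_of U Ms (map (\<lambda>j. us[i := a] ! j \<odot>\<^bsub>Ms ! j\<^esub> xs ! j) [0..<length Ms]))"
      by simp
  qed (use i U_module in simp)
qed

lemma tpow_act_bilinear:
  assumes "mods Ms"
  shows "bilinear K (tpow U (length Ms)) (T Ms) (T Ms) (tpow_act U Ms)"
  unfolding tpow_act_def tpow_def
proof (intro bilinearI tensor_product.tensor_lift_linear tensor_product_U T_module assms tpow_act_multilinear_left
      tensor_product.tensor_lift_param_linear)
  fix us assume "us \<in> tuples (replicate (length Ms) U)"
  then show "is_linear K (T Ms) (T Ms) (\<lambda>Y. tlift U Ms (T Ms)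
      (\<lambda>xs. ptens_of U Ms (map (\<lambda>i. us ! i \<odot>\<^bsub>Ms ! i\<^esub> xs ! i) [0..<length Ms])) Y)"
    using tensor_product.tensor_lift_linear[OF tensor_product_mods[OF assms] T_module[OF assms]
        tpow_act_multilinear[OF assms]]
    by (simp add: tlift_def tuples_replicate tens_def)
qed

lemma tpow_act_pure:
  assumes Ms: "mods Ms" and us: "set us \<subseteq> carrier U" "length us = length Ms" and xs: "xs \<in> tuples (map (restr U) Ms)"
  shows "tpow_act U Ms (ptens U us) (ptens_of U Ms xs)
    = ptens_of U Ms (map (\<lambda>i. us ! i \<odot>\<^bsub>Ms ! i\<^esub> xs ! i) [0..<length Ms])"
proof -
  have us': "us \<in> tuples (replicate (length Ms) U)"
    using us by (simp add: tuples_replicate)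
  from tensor_product.tensor_lift_pure[OF tensor_product_U T_module[OF Ms]
      tpow_act_multilinear_left[OF Ms ptens_of_closed[OF Ms xs]] us']
    tensor_product.tensor_lift_pure[OF tensor_product_mods[OF Ms] T_module[OF Ms] tpow_act_multilinear[OF Ms us] xs]
  show ?thesis
    using us by (simp add: tpow_act_def ptens_def tlift_def ptens_of_def)
qed

lemma append_U_bilinear:
  "bilinear K (tpow U (Suc 0)) (tpow U n) (tpow U (Suc n)) (tensor_append K [U] (replicate n U))"
proof -
  have "tensor_product_pair K [U] (replicate n U)"
    by (simp add: tensor_product_pair_def U1 tensor_product_U)
  from tensor_product_pair.tensor_append_bilinear[OF this] show ?thesis
    by (simp add: tpow_def)
qed

text \<open>Splitting off the first factor reduces the componentwise action of a tensor power to a shorter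
  one. Both sides are linear in \<open>X\<close> and \<open>y\<close>, so pure tensors suffice.\<close>

lemma tpow_act_Cons:
  fixes M :: "('u, 'v) module"
  assumes M: "left_module U M" and Ms: "mods Ms" and a: "a \<in> carrier U" and m: "m \<in> carrier M"
    and X: "X \<in> carrier (tpow U (length Ms))" and y: "y \<in> carrier (T Ms)"
  shows "tpow_act U (M # Ms) (tensor_append K [U] (replicate (length Ms) U) (ptens U [a]) X)
      (tappend U [M] Ms (ptens_of U [M] [m]) y)
    = tappend U [M] Ms (ptens_of U [M] [a \<odot>\<^bsub>M\<^esub> m]) (tpow_act U Ms X y)"
proof -
  have MMs: "mods (M # Ms)" "mods [M]"
    using M Ms by auto
  have am: "a \<odot>\<^bsub>M\<^esub> m \<in> carrier M"
    using M a m by (rule left_module.action_closed)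
  note pc = ptens_of_single[OF M m] ptens_of_single[OF M am] is_linear_closed[OF ptens1_linear a]
  note act = tpow_act_bilinear[OF MMs(1), simplified] tpow_act_bilinear[OF Ms]
  note lin = is_linear_compose[OF bilinear_right[OF act(1)] tappend_linear_right[OF MMs(2) Ms _ pc(1) is_linear_id]]
    is_linear_compose[OF bilinear_left[OF act(1)] bilinear_right[OF append_U_bilinear pc(3)]]
    tappend_linear_right[OF MMs(2) Ms _ pc(2)]
  show ?thesis
  proof (rule tens_ext[OF y Ms T_module[OF MMs(1)]])
    show "is_linear K (T Ms) (T (M # Ms)) (\<lambda>y. tpow_act U (M # Ms)
        (tensor_append K [U] (replicate (length Ms) U) (ptens U [a]) X) (tappend U [M] Ms (ptens_of U [M] [m]) y))"
      by (intro lin bilinear_closed[OF append_U_bilinear pc(3) X]) simp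
    show "is_linear K (T Ms) (T (M # Ms)) (\<lambda>y. tappend U [M] Ms (ptens_of U [M] [a \<odot>\<^bsub>M\<^esub> m]) (tpow_act U Ms X y))"
      by (intro lin(3) bilinear_right[OF act(2) X]) simp
    fix ys assume ys: "ys \<in> tuples (map (restr U) Ms)"
    have eq: "tappend U [M] Ms (ptens_of U [M] [m]) (ptens_of U Ms ys) = ptens_of U (M # Ms) (m # ys)"
      using ptens_of_append[OF MMs(2) Ms _ ys, of "[m]"] m by (simp add: tuples_iff)
    have mys: "m # ys \<in> tuples (map (restr U) (M # Ms))"
      using m ys by (simp add: tuples_iff)
    show "tpow_act U (M # Ms) (tensor_append K [U] (replicate (length Ms) U) (ptens U [a]) X)
        (tappend U [M] Ms (ptens_of U [M] [m]) (ptens_of U Ms ys))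
      = tappend U [M] Ms (ptens_of U [M] [a \<odot>\<^bsub>M\<^esub> m]) (tpow_act U Ms X (ptens_of U Ms ys))"
      unfolding eq
    proof (rule tpow_ext[OF X T_module[OF MMs(1)]])
      show "is_linear K (tpow U (length Ms)) (T (M # Ms)) (\<lambda>X. tpow_act U (M # Ms)
          (tensor_append K [U] (replicate (length Ms) U) (ptens U [a]) X) (ptens_of U (M # Ms) (m # ys)))"
        by (intro lin(2) ptens_of_closed MMs mys)
      show "is_linear K (tpow U (length Ms)) (T (M # Ms))
          (\<lambda>X. tappend U [M] Ms (ptens_of U [M] [a \<odot>\<^bsub>M\<^esub> m]) (tpow_act U Ms X (ptens_of U Ms ys)))"
        by (intro lin(3) bilinear_left[OF act(2)] ptens_of_closed Ms ys) simp
      fix us assume us: "set us \<subseteq> carrier U" "length us = length Ms"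
      let ?zs = "map (\<lambda>i. us ! i \<odot>\<^bsub>Ms ! i\<^esub> ys ! i) [0..<length Ms]"
      have "us ! i \<in> carrier U" "left_module U (Ms ! i)" "ys ! i \<in> carrier (Ms ! i)" if "i < length Ms" for i
        using that Ms us tuples_nth[OF ys, of i] by (auto simp: mods_def subset_iff)
      then have zs: "?zs \<in> tuples (map (restr U) Ms)"
        by (auto simp: tuples_iff list_all2_conv_all_nth intro!: left_module.action_closed)
      have "map (\<lambda>i. (a # us) ! i \<odot>\<^bsub>(M # Ms) ! i\<^esub> (m # ys) ! i) [0..<length (M # Ms)] = (a \<odot>\<^bsub>M\<^esub> m) # ?zs"
        by (auto intro!: nth_equalityI simp: nth_Cons' simp del: upt_Suc)
      moreover have "tensor_append K [U] (replicate (length Ms) U) (ptens U [a]) (ptens U us) = ptens U (a # us)"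
        using append_ptens[of "[a]" us] a us by simp
      moreover have "tappend U [M] Ms (ptens_of U [M] [a \<odot>\<^bsub>M\<^esub> m]) (ptens_of U Ms ?zs)
          = ptens_of U (M # Ms) ((a \<odot>\<^bsub>M\<^esub> m) # ?zs)"
        using ptens_of_append[OF MMs(2) Ms _ zs, of "[a \<odot>\<^bsub>M\<^esub> m]"] am by (simp add: tuples_iff)
      ultimately show "tpow_act U (M # Ms) (tensor_append K [U] (replicate (length Ms) U) (ptens U [a]) (ptens U us))
          (ptens_of U (M # Ms) (m # ys))
        = tappend U [M] Ms (ptens_of U [M] [a \<odot>\<^bsub>M\<^esub> m]) (tpow_act U Ms (ptens U us) (ptens_of U Ms ys))"
        using tpow_act_pure[OF MMs(1) _ _ mys, of "a # us"] tpow_act_pure[OF Ms us ys] a us by simp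
    qed
  qed
qed

lemma iter_comult_aux:
  assumes "is_linear K U (tpow U n) (iter_comult U n)"
  shows "bilinear K U U (tpow U (Suc n))
    (\<lambda>x y. tensor_append K [U] (replicate n U) (ptens U [x]) (iter_comult U n y))"
  by (intro bilinearI is_linear_compose[OF bilinear_right[OF append_U_bilinear] assms]
      is_linear_compose[OF bilinear_left[OF append_U_bilinear] ptens1_linear]
      is_linear_closed[OF ptens1_linear] is_linear_closed[OF assms])

lemma counit_linear_smult:
  assumes "module K L" "y \<in> carrier L"
  shows "is_linear K U L (\<lambda>a. counit U a \<odot>\<^bsub>L\<^esub> y)"
  using assms ring_hom_closed[OF counit_hom] ring_hom_add[OF counit_hom]
  by (intro is_linearI) (auto simp: counit_smult module.smult_l_distr module.smult_assoc1 module.smult_closed)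

lemma iter_comult_linear: "is_linear K U (tpow U n) (iter_comult U n)"
proof (induction n)
  case 0
  show ?case
    using counit_linear_smult[OF tpow_module ptens_closed, of "[]" 0] by simp
next
  case (Suc n)
  then show ?case
    by (simp add: sweedler_comult_linear[OF tpow_module iter_comult_aux is_linear_id])
qed

lemma tact_linear: "mods Ms \<Longrightarrow> a \<in> carrier U \<Longrightarrow> is_linear K A (T Ms) f \<Longrightarrow> is_linear K A (T Ms) (\<lambda>y. tact U Ms a (f y))"
  unfolding tact_def
  by (intro is_linear_compose[OF bilinear_right[OF tpow_act_bilinear]] is_linear_closed[OF iter_comult_linear])

lemma tact_elt_linear:
  "mods Ms \<Longrightarrow> y \<in> carrier (T Ms) \<Longrightarrow> is_linear K A U f \<Longrightarrow> is_linear K A (T Ms) (\<lambda>a. tact U Ms (f a) y)"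
  unfolding tact_def
  by (intro is_linear_compose[OF bilinear_left[OF tpow_act_bilinear]] is_linear_compose[OF iter_comult_linear])

lemma tact_closed: "mods Ms \<Longrightarrow> a \<in> carrier U \<Longrightarrow> y \<in> carrier (T Ms) \<Longrightarrow> tact U Ms a y \<in> carrier (T Ms)"
  by (rule is_linear_closed[OF tact_linear[OF _ _ is_linear_id]])

text \<open>Linearity and membership goals for composite expressions follow from their outermost
  operations.\<close>

lemmas linear_rules = bilinearI trilinearI is_linear_id tappend_linear_left tappend_linear_right
  tact_linear tact_elt_linear ptens_of_act_linear sweedler_param_linear mult_left_linear mult_right_linear
  sweedler_comult_linear

lemmas closed_rules = tappend_closed tact_closed T_module U_module comult_closed sweedler_closed U_m_closed
  ptens_of_single left_module.action_closed

lemma tact_Nil: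
  assumes "a \<in> carrier U"
  shows "tact U [] a (ptens_of U [] []) = counit U a \<odot>\<^bsub>T []\<^esub> (ptens_of U [] [] :: ('v list \<Rightarrow> 'k) set)"
proof -
  have p: "ptens_of U [] [] \<in> carrier (T ([] :: ('u, 'v) module list))"
    by (rule ptens_of_closed) (simp_all add: tuples_iff)
  have "tpow_act U [] (ptens U []) (ptens_of U [] []) = (ptens_of U [] [] :: ('v list \<Rightarrow> 'k) set)"
    using tpow_act_pure[of "[] :: ('u, 'v) module list" "[]" "[]"] by (simp add: tuples_iff)
  then show ?thesis
    using is_linear_smult[OF bilinear_left[OF tpow_act_bilinear[of "[] :: ('u, 'v) module list"] p],
        of "counit U a" "ptens U []"] ring_hom_closed[OF counit_hom assms] ptens_closed[of "[]" 0]
    by (simp add: tact_def)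
qed

lemma tact_Cons:
  fixes M :: "('u, 'v) module"
  assumes M: "left_module U M" and Ms: "mods Ms" and a: "a \<in> carrier U" and m: "m \<in> carrier M" and y: "y \<in> carrier (T Ms)"
  shows "tact U (M # Ms) a (tappend U [M] Ms (ptens_of U [M] [m]) y)
    = sweedler U (T (M # Ms)) (\<lambda>p q. tappend U [M] Ms (ptens_of U [M] [p \<odot>\<^bsub>M\<^esub> m]) (tact U Ms q y)) (comult U a)"
proof -
  have MMs: "mods (M # Ms)" "mods [M]"
    using M Ms by auto
  have z: "tappend U [M] Ms (ptens_of U [M] [m]) y \<in> carrier (T (M # Ms))"
    using M Ms m y by (intro closed_rules) auto
  note L = T_module[OF MMs(1)]
  note act = tpow_act_bilinear[OF MMs(1), simplified]
  have b: "bilinear K U U (T (M # Ms)) (\<lambda>p q. tappend U [M] Ms (ptens_of U [M] [p \<odot>\<^bsub>M\<^esub> m]) (tact U Ms q y))"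
    using M Ms m y by (auto intro!: linear_rules closed_rules)
  show ?thesis
    unfolding tact_def iter_comult.simps length_Cons
    by (subst sweedler_compose[OF tpow_module L iter_comult_aux[OF iter_comult_linear] bilinear_left[OF act z] comult_closed[OF a]],
        rule sweedler_cong[OF L b comult_closed[OF a], unfolded tact_def])
      (intro tpow_act_Cons M Ms m y is_linear_closed[OF iter_comult_linear])
qed

text \<open>The action is defined with the coproduct iterated from the right. That it nevertheless splits
  along an arbitrary cut of the list is coassociativity; the empty left block is the counit axiom.\<close>

theorem tact_append:
  fixes As Bs :: "('u, 'v) module list"
  assumes "mods As" "mods Bs" "a \<in> carrier U" "x \<in> carrier (T As)" "y \<in> carrier (T Bs)"
  shows "tact U (As @ Bs) a (tappend U As Bs x y)
    = sweedler U (T (As @ Bs)) (\<lambda>p q. tappend U As Bs (tact U As p x) (tact U Bs q y)) (comult U a)"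
  using assms
proof (induction As arbitrary: a x)
  case Nil
  note L = T_module[OF Nil(2)]
  note counit_closed = ring_hom_closed[OF counit_hom]
  have b': "bilinear K U U U (\<lambda>x y. counit U x \<odot> y)"
    by (intro bilinearI counit_linear_smult is_linear_smult_const is_linear_id U_module counit_closed)
  show ?case
  proof (simp, rule tens_ext[OF Nil(4) _ L])
    show "is_linear K (T []) (T Bs) (\<lambda>x. tact U Bs a (tappend U [] Bs x y))"
      using Nil by (auto intro!: linear_rules closed_rules)
    show "is_linear K (T []) (T Bs) (\<lambda>x. sweedler U (T Bs) (\<lambda>p q. tappend U [] Bs (tact U [] p x) (tact U Bs q y)) (comult U a))"
      using Nil by (auto intro!: linear_rules closed_rules)
    fix xs assume "xs \<in> tuples (map (restr U) ([] :: ('u, 'v) module list))"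
    then have xs: "xs = []"
      by (simp add: tuples_iff)
    have p: "ptens_of U [] [] \<in> carrier (T ([] :: ('u, 'v) module list))"
      by (rule ptens_of_closed) (simp_all add: tuples_iff)
    have "sweedler U (T Bs) (\<lambda>p q. tappend U [] Bs (tact U [] p (ptens_of U [] [])) (tact U Bs q y)) (comult U a)
        = sweedler U (T Bs) (\<lambda>p q. tact U Bs (counit U p \<odot> q) y) (comult U a)"
    proof (rule sweedler_cong[OF L _ comult_closed[OF Nil(3)]])
      show "bilinear K U U (T Bs) (\<lambda>p q. tact U Bs (counit U p \<odot> q) y)"
        using b' Nil by (auto intro!: bilinearI tact_elt_linear dest: bilinear_left bilinear_right)
      fix p' q assume pq: "p' \<in> carrier U" "q \<in> carrier U"
      have "tappend U [] Bs (counit U p' \<odot>\<^bsub>T []\<^esub> ptens_of U [] []) (tact U Bs q y)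
          = counit U p' \<odot>\<^bsub>T Bs\<^esub> tappend U [] Bs (ptens_of U [] []) (tact U Bs q y)"
        using is_linear_smult[OF tappend_linear_left[OF _ Nil(2) HOL.refl tact_closed[OF Nil(2) pq(2) Nil(5)] is_linear_id, of "[]"]
            counit_closed[OF pq(1)] p] by simp
      also have "\<dots> = counit U p' \<odot>\<^bsub>T Bs\<^esub> tact U Bs q y"
        using pq Nil by (subst tappend_Nil) (auto intro: tact_closed)
      also have "\<dots> = tact U Bs (counit U p' \<odot> q) y"
        using is_linear_smult[OF tact_elt_linear[OF Nil(2,5) is_linear_id] counit_closed[OF pq(1)] pq(2)] by simp
      finally show "tappend U [] Bs (tact U [] p' (ptens_of U [] [])) (tact U Bs q y) = tact U Bs (counit U p' \<odot> q) y"
        by (simp add: tact_Nil pq)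
    qed
    also have "\<dots> = tact U Bs (sweedler U U (\<lambda>p q. counit U p \<odot> q) (comult U a)) y"
      by (rule sweedler_compose[OF U_module L b' tact_elt_linear[OF Nil(2,5) is_linear_id] comult_closed[OF Nil(3)], symmetric])
    also have "\<dots> = tact U Bs a y"
      using Nil by (simp add: counit_left)
    finally show "tact U Bs a (tappend U [] Bs (ptens_of U [] xs) y)
      = sweedler U (T Bs) (\<lambda>p q. tappend U [] Bs (tact U [] p (ptens_of U [] xs)) (tact U Bs q y)) (comult U a)"
      using Nil by (simp add: xs tappend_Nil)
  qed simp
next
  case (Cons M As)
  then have M: "left_module U M" and As: "mods As" and Bs: "mods Bs" and a: "a \<in> carrier U" and y: "y \<in> carrier (T Bs)"
    by auto
  have mM: "mods [M]"
    using M by simp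
  note L = T_module[of "M # As @ Bs"]
  show ?case
    unfolding append_Cons
  proof (rule tens_ext_Cons[OF Cons.prems(4) M As, of "T (M # As @ Bs)"])
    fix m x assume m: "m \<in> carrier M" and x: "x \<in> carrier (T As)"
    let ?p = "\<lambda>p. ptens_of U [M] [p \<odot>\<^bsub>M\<^esub> m]"
    let ?g = "\<lambda>p q r. tappend U [M] (As @ Bs) (?p p) (tappend U As Bs (tact U As q x) (tact U Bs r y))"
    have tri: "trilinear K U U U (T (M # As @ Bs)) ?g"
      using M As Bs m x y by (auto intro!: linear_rules closed_rules)
    have assoc: "tappend U (M # As) Bs (tappend U [M] As z x') y' = tappend U [M] (As @ Bs) z (tappend U As Bs x' y')"
      if "z \<in> carrier (T [M])" "x' \<in> carrier (T As)" "y' \<in> carrier (T Bs)" for z x' y'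
      using tappend_assoc[OF mM As Bs that] by simp
    have pM: "?p p \<in> carrier (T [M])" if "p \<in> carrier U" for p
      using M m that by (intro closed_rules)
    have "tact U (M # As @ Bs) a (tappend U (M # As) Bs (tappend U [M] As (ptens_of U [M] [m]) x) y)
        = sweedler U (T (M # As @ Bs)) (\<lambda>p q. tappend U [M] (As @ Bs) (?p p) (tact U (As @ Bs) q (tappend U As Bs x y)))
          (comult U a)"
      using M As Bs m x y a by (simp add: assoc closed_rules tact_Cons)
    also have "\<dots> = sweedler U (T (M # As @ Bs)) (\<lambda>p q. sweedler U (T (M # As @ Bs)) (\<lambda>r s. ?g p r s) (comult U q)) (comult U a)"
    proof (rule sweedler_cong)
      fix p q assume pq: "p \<in> carrier U" "q \<in> carrier U"
      show "tappend U [M] (As @ Bs) (?p p) (tact U (As @ Bs) q (tappend U As Bs x y))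
          = sweedler U (T (M # As @ Bs)) (\<lambda>r s. ?g p r s) (comult U q)"
        unfolding Cons.IH[OF As Bs pq(2) x y]
        by (rule sweedler_compose[where L = "T (As @ Bs)"])
          (use M As Bs m x y pq in \<open>auto intro!: linear_rules closed_rules\<close>)
    qed (use M As Bs m x y a in \<open>auto intro!: linear_rules closed_rules\<close>)
    \<comment> \<open>Regrouping of the two coproducts by coassociativity.\<close>
    also have "\<dots> = sweedler U (T (M # As @ Bs)) (\<lambda>p q. sweedler U (T (M # As @ Bs)) (\<lambda>r s. ?g r s q) (comult U p)) (comult U a)"
      using M As Bs by (intro sweedler_coassoc[symmetric] L tri a) auto
    also have "\<dots> = sweedler U (T (M # As @ Bs))
        (\<lambda>p q. tappend U (M # As) Bs (tact U (M # As) p (tappend U [M] As (ptens_of U [M] [m]) x)) (tact U Bs q y))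
        (comult U a)"
    proof (rule sweedler_cong)
      fix p q assume pq: "p \<in> carrier U" "q \<in> carrier U"
      have "tappend U (M # As) Bs (sweedler U (T (M # As)) (\<lambda>r s. tappend U [M] As (?p r) (tact U As s x)) (comult U p)) (tact U Bs q y)
          = sweedler U (T (M # As @ Bs)) (\<lambda>r s. tappend U (M # As) Bs (tappend U [M] As (?p r) (tact U As s x)) (tact U Bs q y)) (comult U p)"
        by (rule sweedler_compose[where L = "T (M # As)"])
          (use M As Bs m x y pq in \<open>auto intro!: linear_rules closed_rules\<close>)
      also have "\<dots> = sweedler U (T (M # As @ Bs)) (\<lambda>r s. ?g r s q) (comult U p)"
      proof (rule sweedler_cong)
        fix r s assume "r \<in> carrier U" "s \<in> carrier U"
        then show "tappend U (M # As) Bs (tappend U [M] As (?p r) (tact U As s x)) (tact U Bs q y) = ?g r s q"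
          using As Bs x y pq by (intro assoc pM tact_closed)
      qed (use M As Bs m x y pq in \<open>auto intro!: linear_rules closed_rules\<close>)
      finally show "sweedler U (T (M # As @ Bs)) (\<lambda>r s. ?g r s q) (comult U p)
        = tappend U (M # As) Bs (tact U (M # As) p (tappend U [M] As (ptens_of U [M] [m]) x)) (tact U Bs q y)"
        using M As Bs m x y pq by (simp add: tact_Cons)
    qed (use M As Bs m x y a in \<open>auto intro!: linear_rules closed_rules\<close>)
    finally show "tact U (M # As @ Bs) a (tappend U (M # As) Bs (tappend U [M] As (ptens_of U [M] [m]) x) y)
      = sweedler U (T (M # As @ Bs))
        (\<lambda>p q. tappend U (M # As) Bs (tact U (M # As) p (tappend U [M] As (ptens_of U [M] [m]) x)) (tact U Bs q y))
        (comult U a)" .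
  qed (use M As Bs a y in \<open>auto intro!: linear_rules closed_rules\<close>)
qed

text \<open>By induction on the list, since the coproduct is multiplicative: both sides are the sum of the
  products of components of \<open>\<Delta> a\<close> and \<open>\<Delta> b\<close>.\<close>

lemma tact_mult:
  fixes Ms :: "('u, 'v) module list"
  assumes "mods Ms" "a \<in> carrier U" "b \<in> carrier U" "x \<in> carrier (T Ms)"
  shows "tact U Ms (a \<otimes> b) x = tact U Ms a (tact U Ms b x)"
  using assms
proof (induction Ms arbitrary: a b x)
  case Nil
  show ?case
  proof (rule tens_ext[OF Nil(4) Nil(1) T_module[OF Nil(1)]])
    show "is_linear K (T []) (T []) (tact U [] (a \<otimes> b))"
      "is_linear K (T []) (T []) (\<lambda>x. tact U [] a (tact U [] b x))"
      using Nil by (auto intro!: linear_rules closed_rules)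
    fix xs assume "xs \<in> tuples (map (restr U) ([] :: ('u, 'v) module list))"
    then have xs: "xs = []"
      by (simp add: tuples_iff)
    have p: "ptens_of U [] [] \<in> carrier (T ([] :: ('u, 'v) module list))"
      by (rule ptens_of_closed) (simp_all add: tuples_iff)
    interpret TT: module K "T ([] :: ('u, 'v) module list)"
      by (rule T_module) simp
    have c: "counit U a \<in> carrier K" "counit U b \<in> carrier K"
      using Nil ring_hom_closed[OF counit_hom] by auto
    show "tact U [] (a \<otimes> b) (ptens_of U [] xs) = tact U [] a (tact U [] b (ptens_of U [] xs))"
      using Nil is_linear_smult[OF tact_linear[OF Nil(1,2) is_linear_id] c(2) p] c p
      by (simp add: xs tact_Nil ring_hom_mult[OF counit_hom] U_m_closed TT.smult_assoc1 flip: R.m_comm[OF c])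
        (metis R.m_comm TT.smult_assoc1)
  qed
next
  case (Cons M Ms)
  then have M: "left_module U M" and Ms: "mods Ms" and a: "a \<in> carrier U" and b: "b \<in> carrier U"
    by auto
  note L = T_module[OF Cons.prems(1)]
  show ?case
  proof (rule tens_ext_Cons[OF Cons.prems(4) M Ms L])
    fix m x assume m: "m \<in> carrier M" and x: "x \<in> carrier (T Ms)"
    let ?h = "\<lambda>p q. tappend U [M] Ms (ptens_of U [M] [p \<odot>\<^bsub>M\<^esub> m]) (tact U Ms q x)"
    have "tact U (M # Ms) (a \<otimes> b) (tappend U [M] Ms (ptens_of U [M] [m]) x)
        = sweedler U (T (M # Ms)) ?h (tpow_mult U 2 (comult U a) (comult U b))"
      using M Ms a b m x by (simp add: tact_Cons U_m_closed comult_mult)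
    also have "\<dots> = sweedler U (T (M # Ms)) (\<lambda>p q. sweedler U (T (M # Ms)) (\<lambda>r s. ?h (p \<otimes> r) (q \<otimes> s)) (comult U b)) (comult U a)"
      by (rule sweedler_mult) (use M Ms a b m x in \<open>auto intro!: linear_rules closed_rules\<close>)
    also have "\<dots> = sweedler U (T (M # Ms)) (\<lambda>r s. sweedler U (T (M # Ms)) (\<lambda>p q. ?h (p \<otimes> r) (q \<otimes> s)) (comult U a)) (comult U b)"
      by (rule sweedler_swap) (use M Ms a b m x in \<open>auto intro!: linear_rules closed_rules\<close>)
    also have "\<dots> = sweedler U (T (M # Ms)) (\<lambda>r s. tact U (M # Ms) a (?h r s)) (comult U b)"
    proof (rule sweedler_cong)
      fix r s assume rs: "r \<in> carrier U" "s \<in> carrier U"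
      have rm: "r \<odot>\<^bsub>M\<^esub> m \<in> carrier M" "tact U Ms s x \<in> carrier (T Ms)"
        using M Ms m x rs by (auto intro!: closed_rules)
      have "sweedler U (T (M # Ms)) (\<lambda>p q. ?h (p \<otimes> r) (q \<otimes> s)) (comult U a)
          = sweedler U (T (M # Ms)) (\<lambda>p q. tappend U [M] Ms (ptens_of U [M] [p \<odot>\<^bsub>M\<^esub> (r \<odot>\<^bsub>M\<^esub> m)]) (tact U Ms q (tact U Ms s x)))
            (comult U a)"
        by (rule sweedler_cong)
          (use M Ms a m x rs rm in \<open>auto intro!: linear_rules closed_rules simp: Cons.IH left_module.action_mult\<close>)
      then show "sweedler U (T (M # Ms)) (\<lambda>p q. ?h (p \<otimes> r) (q \<otimes> s)) (comult U a) = tact U (M # Ms) a (?h r s)"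
        using M Ms a rm by (simp add: tact_Cons)
    qed (use M Ms a b m x in \<open>auto intro!: linear_rules closed_rules\<close>)
    also have "\<dots> = tact U (M # Ms) a (sweedler U (T (M # Ms)) ?h (comult U b))"
      by (rule sweedler_compose[where L = "T (M # Ms)", symmetric])
        (use M Ms a b m x in \<open>auto intro!: linear_rules closed_rules\<close>)
    finally show "tact U (M # Ms) (a \<otimes> b) (tappend U [M] Ms (ptens_of U [M] [m]) x)
      = tact U (M # Ms) a (tact U (M # Ms) b (tappend U [M] Ms (ptens_of U [M] [m]) x))"
      using M Ms b m x by (simp add: tact_Cons)
  qed (use M Ms a b in \<open>auto intro!: linear_rules closed_rules\<close>)
qed

lemma tact_one:
  fixes Ms :: "('u, 'v) module list"
  assumes "mods Ms" "x \<in> carrier (T Ms)"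
  shows "tact U Ms \<one> x = x"
  using assms
proof (induction Ms arbitrary: x)
  case Nil
  show ?case
  proof (rule tens_ext[OF Nil(2) Nil(1) T_module[OF Nil(1)]])
    show "is_linear K (T []) (T []) (tact U [] \<one>)" "is_linear K (T []) (T []) (\<lambda>x. x)"
      by (auto intro!: linear_rules closed_rules)
    fix xs assume "xs \<in> tuples (map (restr U) ([] :: ('u, 'v) module list))"
    then have xs: "xs = []"
      by (simp add: tuples_iff)
    have p: "ptens_of U [] [] \<in> carrier (T ([] :: ('u, 'v) module list))"
      by (rule ptens_of_closed) (simp_all add: tuples_iff)
    interpret TT: module K "T ([] :: ('u, 'v) module list)"
      by (rule T_module) simp
    show "tact U [] \<one> (ptens_of U [] xs) = ptens_of U [] xs"
      using p by (simp add: xs tact_Nil ring_hom_one[OF counit_hom])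
  qed
next
  case (Cons M Ms)
  then have M: "left_module U M" and Ms: "mods Ms"
    by auto
  note L = T_module[OF Cons.prems(1)]
  show ?case
  proof (rule tens_ext_Cons[OF Cons.prems(2) M Ms L])
    fix m x assume m: "m \<in> carrier M" and x: "x \<in> carrier (T Ms)"
    have "bilinear K U U (T (M # Ms)) (\<lambda>p q. tappend U [M] Ms (ptens_of U [M] [p \<odot>\<^bsub>M\<^esub> m]) (tact U Ms q x))"
      using M Ms m x by (auto intro!: linear_rules closed_rules)
    then show "tact U (M # Ms) \<one> (tappend U [M] Ms (ptens_of U [M] [m]) x) = tappend U [M] Ms (ptens_of U [M] [m]) x"
      using M Ms m x by (simp add: tact_Cons comult_one sweedler_pure[OF L] Cons.IH left_module.action_one)
  qed (use M Ms in \<open>auto intro!: linear_rules closed_rules\<close>)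
qed

end


section \<open>The strict monoidal category of intertwiners\<close>

lemma tmap_simps [simp]:
  "src (tid U As) = As" "tgt (tid U As) = As"
  "src (g \<bullet>\<^bsub>U\<^esub> f) = src f" "tgt (g \<bullet>\<^bsub>U\<^esub> f) = tgt g"
  "src (f \<boxtimes>\<^bsub>U\<^esub> g) = src f @ src g" "tgt (f \<boxtimes>\<^bsub>U\<^esub> g) = tgt f @ tgt g"
  "src (tinv U f) = tgt f" "tgt (tinv U f) = src f"
  "src (braiding U As Bs) = Bs @ As" "tgt (braiding U As Bs) = As @ Bs"
  by (simp_all add: tid_def tcomp_def tprod_def tinv_def braiding_def)

context hopf_algebra
begin

abbreviation tcomp' (infixr \<open>\<bullet>\<close> 65) where "g \<bullet> f \<equiv> g \<bullet>\<^bsub>U\<^esub> f"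
abbreviation tprod' (infixr \<open>\<boxtimes>\<close> 70) where "f \<boxtimes> g \<equiv> f \<boxtimes>\<^bsub>U\<^esub> g"
abbreviation tid' (\<open>\<I>\<close>) where "\<I> As \<equiv> tid U As"

text \<open>The maps are required to be extensional, so that maps between the same lists of modules are
  equal as soon as they agree on the carrier.\<close>

definition intertwiner :: "('k, 'u, 'v) tmap \<Rightarrow> bool" where
  "intertwiner f \<longleftrightarrow> mods (src f) \<and> mods (tgt f) \<and> app f \<in> extensional (carrier (T (src f))) \<and>
    is_linear K (T (src f)) (T (tgt f)) (app f) \<and>
    (\<forall>a\<in>carrier U. \<forall>x\<in>carrier (T (src f)). app f (tact U (src f) a x) = tact U (tgt f) a (app f x))"

lemma intertwiner_mods: "intertwiner f \<Longrightarrow> mods (src f)" "intertwiner f \<Longrightarrow> mods (tgt f)"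
  by (auto simp: intertwiner_def)

lemma intertwiner_linear: "intertwiner f \<Longrightarrow> is_linear K (T (src f)) (T (tgt f)) (app f)"
  by (simp add: intertwiner_def)

lemma app_linear:
  "intertwiner f \<Longrightarrow> C = tgt f \<Longrightarrow> is_linear K A (T (src f)) h \<Longrightarrow> is_linear K A (T C) (\<lambda>x. app f (h x))"
  using is_linear_compose[OF intertwiner_linear] by blast

lemma app_closed: "intertwiner f \<Longrightarrow> C = tgt f \<Longrightarrow> x \<in> carrier (T (src f)) \<Longrightarrow> app f x \<in> carrier (T C)"
  using is_linear_closed[OF intertwiner_linear] by blast

lemma app_tact:
  "intertwiner f \<Longrightarrow> a \<in> carrier U \<Longrightarrow> x \<in> carrier (T (src f)) \<Longrightarrow>
    app f (tact U (src f) a x) = tact U (tgt f) a (app f x)"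
  by (simp add: intertwiner_def)

lemma tmap_eqI:
  fixes f g :: "('k, 'u, 'v) tmap"
  assumes "intertwiner f" "intertwiner g" "src f = src g" "tgt f = tgt g"
    and "\<And>x. x \<in> carrier (T (src g)) \<Longrightarrow> app f x = app g x"
  shows "f = g"
proof -
  have "app f = app g"
    using assms by (intro extensionalityI[of _ "carrier (T (src g))"]) (auto simp: intertwiner_def)
  then show ?thesis
    using assms by (cases f, cases g) simp
qed

lemma app_tid: "x \<in> carrier (T As) \<Longrightarrow> app (\<I> As) x = x"
  by (simp add: tid_def)

lemma app_tcomp: "x \<in> carrier (T (src f)) \<Longrightarrow> app (g \<bullet> f) x = app g (app f x)"
  by (simp add: tcomp_def compose_def)

lemma intertwiner_tid: "mods As \<Longrightarrow> intertwiner (\<I> As)"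
  unfolding intertwiner_def tid_def
  by (auto intro: is_linear_cong[OF is_linear_id] T_module tact_closed)

lemma intertwiner_tcomp:
  assumes "intertwiner f" "intertwiner g" "src g = tgt f"
  shows "intertwiner (g \<bullet> f)"
proof -
  note m = intertwiner_mods[OF assms(1)] intertwiner_mods[OF assms(2)]
  have "is_linear K (T (src f)) (T (tgt g)) (app (g \<bullet> f))"
    by (rule is_linear_cong[OF is_linear_compose[OF intertwiner_linear[OF assms(2), unfolded assms(3)]
            intertwiner_linear[OF assms(1)]]])
      (use m in \<open>auto intro: T_module simp: app_tcomp\<close>)
  moreover have "app (g \<bullet> f) (tact U (src f) a x) = tact U (tgt g) a (app (g \<bullet> f) x)"
    if "a \<in> carrier U" "x \<in> carrier (T (src f))" for a x
    using that assms m app_tact[OF assms(2), unfolded assms(3)]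
    by (simp add: app_tcomp app_tact tact_closed app_closed)
  ultimately show ?thesis
    using m by (simp add: intertwiner_def[of "g \<bullet> f"]) (simp add: tcomp_def)
qed

lemma tprod_bilinear:
  assumes "intertwiner f" "intertwiner g"
  shows "bilinear K (T (src f)) (T (src g)) (T (tgt f @ tgt g)) (\<lambda>x y. tappend U (tgt f) (tgt g) (app f x) (app g y))"
  using intertwiner_mods[OF assms(1)] intertwiner_mods[OF assms(2)] assms
  by (auto intro!: linear_rules closed_rules app_linear app_closed)

lemma tprod_linear:
  assumes "intertwiner f" "intertwiner g"
  shows "is_linear K (T (src f @ src g)) (T (tgt f @ tgt g)) (app (f \<boxtimes> g))"
proof -
  note m = intertwiner_mods[OF assms(1)] intertwiner_mods[OF assms(2)]
  show ?thesis
    by (rule is_linear_cong[OF tlift_split_linear[OF m(1) m(3) _ tprod_bilinear[OF assms]]])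
      (use m in \<open>auto simp: tprod_def T_module\<close>)
qed

lemma app_tprod:
  assumes "intertwiner f" "intertwiner g" "As = src f" "Bs = src g" "x \<in> carrier (T As)" "y \<in> carrier (T Bs)"
  shows "app (f \<boxtimes> g) (tappend U As Bs x y) = tappend U (tgt f) (tgt g) (app f x) (app g y)"
proof -
  note m = intertwiner_mods[OF assms(1)] intertwiner_mods[OF assms(2)]
  show ?thesis
    using tlift_split_append[OF m(1) m(3) _ tprod_bilinear[OF assms(1,2)], of x y] m assms
    by (simp add: tprod_def T_module tappend_closed)
qed

text \<open>\<open>U\<close> acts on a product through the two legs of the coproduct, and each leg commutes with the
  respective factor of the map.\<close>

lemma intertwiner_tprod:
  assumes f: "intertwiner f" and g: "intertwiner g"
  shows "intertwiner (f \<boxtimes> g)"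
proof -
  note m = intertwiner_mods[OF f] intertwiner_mods[OF g]
  have L: "module K (T (tgt f @ tgt g))" "module K (T (src f @ src g))"
    using m by (auto intro: T_module)
  have lin: "is_linear K A (T (tgt f @ tgt g)) (\<lambda>x. app (f \<boxtimes> g) (h x))"
    if "is_linear K A (T (src f @ src g)) h" for h and A :: "('k, 'c, 'd) module_scheme"
    by (rule is_linear_compose[OF tprod_linear[OF f g] that])
  have "app (f \<boxtimes> g) (tact U (src f @ src g) a z) = tact U (tgt f @ tgt g) a (app (f \<boxtimes> g) z)"
    if a: "a \<in> carrier U" and z: "z \<in> carrier (T (src f @ src g))" for a z
  proof (rule tens_ext2[OF z m(1) m(3) L(1) HOL.refl])
    show "is_linear K (T (src f @ src g)) (T (tgt f @ tgt g)) (\<lambda>z. app (f \<boxtimes> g) (tact U (src f @ src g) a z))"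
      "is_linear K (T (src f @ src g)) (T (tgt f @ tgt g)) (\<lambda>z. tact U (tgt f @ tgt g) a (app (f \<boxtimes> g) z))"
      using m a by (auto intro!: lin tact_linear is_linear_id)
    fix x y assume x: "x \<in> carrier (T (src f))" and y: "y \<in> carrier (T (src g))"
    have b: "bilinear K U U (T (src f @ src g)) (\<lambda>p q. tappend U (src f) (src g) (tact U (src f) p x) (tact U (src g) q y))"
      using m x y by (auto intro!: linear_rules closed_rules)
    have fx: "app f x \<in> carrier (T (tgt f))" "app g y \<in> carrier (T (tgt g))"
      using x y f g by (auto intro: app_closed)
    have b': "bilinear K U U (T (tgt f @ tgt g))
        (\<lambda>p q. tappend U (tgt f) (tgt g) (tact U (tgt f) p (app f x)) (tact U (tgt g) q (app g y)))"
      using m fx by (auto intro!: linear_rules closed_rules)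
    have "app (f \<boxtimes> g) (tact U (src f @ src g) a (tappend U (src f) (src g) x y))
        = sweedler U (T (tgt f @ tgt g))
          (\<lambda>p q. app (f \<boxtimes> g) (tappend U (src f) (src g) (tact U (src f) p x) (tact U (src g) q y))) (comult U a)"
      unfolding tact_append[OF m(1) m(3) a x y]
      by (rule sweedler_compose[OF L(2,1) b tprod_linear[OF f g] comult_closed[OF a]])
    also have "\<dots> = sweedler U (T (tgt f @ tgt g))
          (\<lambda>p q. tappend U (tgt f) (tgt g) (tact U (tgt f) p (app f x)) (tact U (tgt g) q (app g y))) (comult U a)"
      by (rule sweedler_cong[OF L(1) b' comult_closed[OF a]])
        (use m x y f g in \<open>simp add: app_tprod app_tact tact_closed\<close>)
    also have "\<dots> = tact U (tgt f @ tgt g) a (app (f \<boxtimes> g) (tappend U (src f) (src g) x y))"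
      using tact_append[OF m(2) m(4) a fx] x y f g by (simp add: app_tprod)
    finally show "app (f \<boxtimes> g) (tact U (src f @ src g) a (tappend U (src f) (src g) x y))
      = tact U (tgt f @ tgt g) a (app (f \<boxtimes> g) (tappend U (src f) (src g) x y))" .
  qed
  then show ?thesis
    using m tprod_linear[OF f g] by (auto simp: intertwiner_def[of "f \<boxtimes> g"]) (simp add: tprod_def)
qed

lemmas intertwiner_rules = intertwiner_tid intertwiner_tcomp intertwiner_tprod

lemma tcomp_assoc:
  assumes "intertwiner f" "intertwiner g" "intertwiner h" "src g = tgt f" "src h = tgt g"
  shows "(h \<bullet> g) \<bullet> f = h \<bullet> (g \<bullet> f)"
  using assms by (intro tmap_eqI) (auto intro: intertwiner_tcomp simp: app_tcomp app_closed)

lemma tcomp_tid: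
  assumes "intertwiner f"
  shows "As = src f \<Longrightarrow> f \<bullet> \<I> As = f" "As = tgt f \<Longrightarrow> \<I> As \<bullet> f = f"
  using assms intertwiner_mods[OF assms]
  by (auto intro!: tmap_eqI intertwiner_tcomp intertwiner_tid simp: app_tcomp app_tid app_closed)

lemma tprod_tid:
  assumes m: "mods As" "mods Bs"
  shows "\<I> As \<boxtimes> \<I> Bs = \<I> (As @ Bs)"
proof (rule tmap_eqI)
  fix x assume "x \<in> carrier (T (src (\<I> (As @ Bs))))"
  then have x: "x \<in> carrier (T (As @ Bs))"
    by simp
  have "app (\<I> As \<boxtimes> \<I> Bs) x = x"
  proof (rule tens_ext2[OF x m _ HOL.refl _ is_linear_id])
    show "is_linear K (T (As @ Bs)) (T (As @ Bs)) (app (\<I> As \<boxtimes> \<I> Bs))"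
      using tprod_linear[OF intertwiner_tid intertwiner_tid, OF m] by simp
    show "app (\<I> As \<boxtimes> \<I> Bs) (tappend U As Bs x y) = tappend U As Bs x y"
      if "x \<in> carrier (T As)" "y \<in> carrier (T Bs)" for x y
      using m that by (simp add: app_tprod intertwiner_tid app_tid)
  qed (use m in \<open>simp add: T_module\<close>)
  then show "app (\<I> As \<boxtimes> \<I> Bs) x = app (\<I> (As @ Bs)) x"
    using x by (simp add: app_tid)
qed (simp_all add: intertwiner_rules m)

lemma tprod_assoc:
  assumes f: "intertwiner f" and g: "intertwiner g" and h: "intertwiner h"
  shows "(f \<boxtimes> g) \<boxtimes> h = f \<boxtimes> (g \<boxtimes> h)"
proof (rule tmap_eqI)
  note m = intertwiner_mods[OF f] intertwiner_mods[OF g] intertwiner_mods[OF h]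
  fix x assume x: "x \<in> carrier (T (src (f \<boxtimes> (g \<boxtimes> h))))"
  show "app ((f \<boxtimes> g) \<boxtimes> h) x = app (f \<boxtimes> (g \<boxtimes> h)) x"
  proof (rule tens_ext3[OF x m(1) m(3) m(5)])
    show "module K (T (tgt f @ tgt g @ tgt h))"
      using m by (intro T_module) simp
    show "is_linear K (T (src (f \<boxtimes> (g \<boxtimes> h)))) (T (tgt f @ tgt g @ tgt h)) (app ((f \<boxtimes> g) \<boxtimes> h))"
      using tprod_linear[OF intertwiner_tprod[OF f g] h] by simp
    show "is_linear K (T (src (f \<boxtimes> (g \<boxtimes> h)))) (T (tgt f @ tgt g @ tgt h)) (app (f \<boxtimes> (g \<boxtimes> h)))"
      using tprod_linear[OF f intertwiner_tprod[OF g h]] by simp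
    fix x y z assume xyz: "x \<in> carrier (T (src f))" "y \<in> carrier (T (src g))" "z \<in> carrier (T (src h))"
    then have fx: "app f x \<in> carrier (T (tgt f))" "app g y \<in> carrier (T (tgt g))" "app h z \<in> carrier (T (tgt h))"
      using f g h by (auto intro: app_closed)
    have "app ((f \<boxtimes> g) \<boxtimes> h) (tappend U (src f @ src g) (src h) (tappend U (src f) (src g) x y) z)
        = tappend U (tgt f @ tgt g) (tgt h) (tappend U (tgt f) (tgt g) (app f x) (app g y)) (app h z)"
      using xyz m f g h by (simp add: app_tprod intertwiner_tprod tappend_closed)
    moreover have "app (f \<boxtimes> (g \<boxtimes> h)) (tappend U (src f) (src g @ src h) x (tappend U (src g) (src h) y z))
        = tappend U (tgt f) (tgt g @ tgt h) (app f x) (tappend U (tgt g) (tgt h) (app g y) (app h z))"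
      using xyz m f g h by (simp add: app_tprod intertwiner_tprod tappend_closed)
    ultimately show "app ((f \<boxtimes> g) \<boxtimes> h) (tappend U (src f) (src g @ src h) x (tappend U (src g) (src h) y z))
      = app (f \<boxtimes> (g \<boxtimes> h)) (tappend U (src f) (src g @ src h) x (tappend U (src g) (src h) y z))"
      using tappend_assoc[OF m(1) m(3) m(5) xyz] tappend_assoc[OF m(2) m(4) m(6) fx] by simp
  qed simp
qed (use f g h in \<open>simp_all add: intertwiner_rules\<close>)

lemma interchange:
  assumes f: "intertwiner f" "intertwiner f'" "src f' = tgt f" and g: "intertwiner g" "intertwiner g'" "src g' = tgt g"
  shows "(f' \<boxtimes> g') \<bullet> (f \<boxtimes> g) = (f' \<bullet> f) \<boxtimes> (g' \<bullet> g)"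
proof (rule tmap_eqI)
  note m = intertwiner_mods[OF f(1)] intertwiner_mods[OF f(2)] intertwiner_mods[OF g(1)] intertwiner_mods[OF g(2)]
  note i = intertwiner_tprod[OF f(1) g(1)] intertwiner_tprod[OF f(2) g(2)] intertwiner_tcomp[OF f] intertwiner_tcomp[OF g]
  fix x assume x: "x \<in> carrier (T (src ((f' \<bullet> f) \<boxtimes> (g' \<bullet> g))))"
  show "app ((f' \<boxtimes> g') \<bullet> (f \<boxtimes> g)) x = app ((f' \<bullet> f) \<boxtimes> (g' \<bullet> g)) x"
  proof (rule tens_ext2[OF x m(1) m(5)])
    show "module K (T (tgt f' @ tgt g'))"
      using m by (intro T_module) simp
    show "is_linear K (T (src ((f' \<bullet> f) \<boxtimes> (g' \<bullet> g)))) (T (tgt f' @ tgt g')) (app ((f' \<boxtimes> g') \<bullet> (f \<boxtimes> g)))"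
      using intertwiner_linear[OF intertwiner_tcomp[OF i(1,2)]] f(3) g(3) by simp
    show "is_linear K (T (src ((f' \<bullet> f) \<boxtimes> (g' \<bullet> g)))) (T (tgt f' @ tgt g')) (app ((f' \<bullet> f) \<boxtimes> (g' \<bullet> g)))"
      using tprod_linear[OF i(3,4)] by simp
    fix x y assume "x \<in> carrier (T (src f))" "y \<in> carrier (T (src g))"
    then show "app ((f' \<boxtimes> g') \<bullet> (f \<boxtimes> g)) (tappend U (src f) (src g) x y)
      = app ((f' \<bullet> f) \<boxtimes> (g' \<bullet> g)) (tappend U (src f) (src g) x y)"
      using f g i m by (simp add: app_tcomp app_tprod tappend_closed app_closed)
  qed simp
qed (use f g in \<open>simp_all add: intertwiner_rules\<close>)

definition isom :: "('k, 'u, 'v) tmap \<Rightarrow> bool" where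
  "isom f \<longleftrightarrow> intertwiner f \<and> bij_betw (app f) (carrier (T (src f))) (carrier (T (tgt f)))"

lemma isom_intertwiner: "isom f \<Longrightarrow> intertwiner f"
  by (simp add: isom_def)

lemma isomI:
  assumes "intertwiner f" "intertwiner g" "src g = tgt f" "tgt g = src f" "g \<bullet> f = \<I> (src f)" "f \<bullet> g = \<I> (tgt f)"
  shows "isom f"
  unfolding isom_def
proof (intro conjI bij_betw_byWitness[where f' = "app g"] ballI)
  show "app g (app f x) = x" if "x \<in> carrier (T (src f))" for x
    using arg_cong[OF assms(5), of "\<lambda>f. app f x"] that by (simp add: app_tcomp app_tid)
  show "app f (app g x) = x" if "x \<in> carrier (T (tgt f))" for x
    using arg_cong[OF assms(6), of "\<lambda>f. app f x"] that assms(3) by (simp add: app_tcomp app_tid)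
qed (use assms in \<open>auto intro: app_closed\<close>)

text \<open>The inverse of a bijective intertwiner is an intertwiner, because equations can be checked
  after applying the injective map.\<close>

lemma tinv:
  assumes f: "isom f"
  shows "intertwiner (tinv U f)" and "tinv U f \<bullet> f = \<I> (src f)" and "f \<bullet> tinv U f = \<I> (tgt f)"
proof -
  note i = isom_intertwiner[OF f]
  note m = intertwiner_mods[OF i]
  have bij: "inj_on (app f) (carrier (T (src f)))" "app f ` carrier (T (src f)) = carrier (T (tgt f))"
    using f by (auto simp: isom_def bij_betw_def)
  have inv1: "app (tinv U f) (app f x) = x" if "x \<in> carrier (T (src f))" for x
    using bij that app_closed[OF i HOL.refl that] by (simp add: tinv_def)
  have inv2: "app f (app (tinv U f) y) = y" and cl: "app (tinv U f) y \<in> carrier (T (src f))"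
    if "y \<in> carrier (T (tgt f))" for y
    using bij that by (auto simp: tinv_def f_inv_into_f inv_into_into)
  interpret S: module K "T (src f)"
    by (rule T_module[OF m(1)])
  interpret D: module K "T (tgt f)"
    by (rule T_module[OF m(2)])
  have eqI: "x = x'" if "x \<in> carrier (T (src f))" "x' \<in> carrier (T (src f))" "app f x = app f x'" for x x'
    using bij(1) that by (auto dest: inj_onD)
  note lin = intertwiner_linear[OF i]
  show t: "intertwiner (tinv U f)"
    unfolding intertwiner_def tmap_simps
  proof (intro conjI m ballI is_linearI)
    show "app (tinv U f) \<in> extensional (carrier (T (tgt f)))"
      by (simp add: tinv_def)
    fix y assume y: "y \<in> carrier (T (tgt f))"
    show "app (tinv U f) y \<in> carrier (T (src f))"
      using y by (rule cl)
    show "app (tinv U f) (y \<oplus>\<^bsub>T (tgt f)\<^esub> y') = app (tinv U f) y \<oplus>\<^bsub>T (src f)\<^esub> app (tinv U f) y'"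
      if "y' \<in> carrier (T (tgt f))" for y'
      using y that by - (rule eqI, simp_all add: cl inv2 is_linear_add[OF lin])
    show "app (tinv U f) (c \<odot>\<^bsub>T (tgt f)\<^esub> y) = c \<odot>\<^bsub>T (src f)\<^esub> app (tinv U f) y" if "c \<in> carrier K" for c
      using y that by - (rule eqI, simp_all add: cl inv2 is_linear_smult[OF lin])
    show "app (tinv U f) (tact U (tgt f) a y) = tact U (src f) a (app (tinv U f) y)" if "a \<in> carrier U" for a
      using y that by - (rule eqI, simp_all add: cl inv2 m tact_closed app_tact[OF i])
  qed
  show "tinv U f \<bullet> f = \<I> (src f)"
    by (rule tmap_eqI) (use i m t in \<open>simp_all add: app_tcomp app_tid inv1 intertwiner_rules\<close>)
  show "f \<bullet> tinv U f = \<I> (tgt f)"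
    by (rule tmap_eqI) (use i m t in \<open>simp_all add: app_tcomp app_tid inv2 intertwiner_rules\<close>)
qed

lemma isom_tinv: "isom f \<Longrightarrow> isom (tinv U f)"
  using tinv isom_intertwiner by (intro isomI[of "tinv U f" f]) auto

lemma isom_tid: "mods As \<Longrightarrow> isom (\<I> As)"
  by (intro isomI[of _ "\<I> As"]) (simp_all add: intertwiner_tid tcomp_tid)

lemma isom_tcomp:
  assumes "isom f" "isom g" "src g = tgt f"
  shows "isom (g \<bullet> f)"
proof -
  have "bij_betw (app g \<circ> app f) (carrier (T (src f))) (carrier (T (tgt g)))"
    using assms by (intro bij_betw_trans[of _ _ "carrier (T (src g))"]) (auto simp: isom_def)
  then have "bij_betw (app (g \<bullet> f)) (carrier (T (src f))) (carrier (T (tgt g)))"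
    by (rule bij_betw_cong[THEN iffD1, rotated]) (simp add: app_tcomp)
  then show ?thesis
    using assms by (simp add: isom_def[of "g \<bullet> f"] intertwiner_tcomp isom_intertwiner)
qed

lemma isom_tprod:
  assumes "isom f" "isom g"
  shows "isom (f \<boxtimes> g)"
  using assms isom_intertwiner[OF assms(1)] isom_intertwiner[OF assms(2)] tinv[OF assms(1)] tinv[OF assms(2)]
  by (intro isomI[of _ "tinv U f \<boxtimes> tinv U g"])
    (simp_all add: interchange intertwiner_tprod tprod_tid intertwiner_mods)

end


section \<open>The braiding\<close>

context quasitriangular_hopf_algebra
begin

lemma braiding_bilinear:
  assumes "mods As" "mods Bs"
  shows "bilinear K (T Bs) (T As) (T (As @ Bs)) (\<lambda>b a. sweedler U (T (As @ Bs))
    (\<lambda>r1 r2. tappend U As Bs (tact U As r2 a) (tact U Bs r1 b)) (rmatrix U))"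
  using assms rmatrix_closed by (auto intro!: linear_rules closed_rules)

lemma braiding_linear:
  assumes "mods As" "mods Bs"
  shows "is_linear K (T (Bs @ As)) (T (As @ Bs)) (app (braiding U As Bs))"
  by (rule is_linear_cong[OF tlift_split_linear[OF assms(2,1) _ braiding_bilinear[OF assms]]])
    (use assms in \<open>auto simp: braiding_def T_module Let_def\<close>)

lemma app_braiding:
  assumes "mods As" "mods Bs" "x \<in> carrier (T As)" "y \<in> carrier (T Bs)"
  shows "app (braiding U As Bs) (tappend U Bs As y x)
    = sweedler U (T (As @ Bs)) (\<lambda>r1 r2. tappend U As Bs (tact U As r2 x) (tact U Bs r1 y)) (rmatrix U)"
  using tlift_split_append[OF assms(2,1) _ braiding_bilinear[OF assms(1,2)] assms(4,3)] assms
  by (simp add: braiding_def T_module Let_def tappend_closed)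

text \<open>This is the axiom \<open>R \<Delta>(a) = \<Delta>\<^sup>o\<^sup>p(a) R\<close>: moving \<open>a\<close> past the braiding exchanges the two legs of
  its coproduct.\<close>

lemma intertwiner_braiding:
  assumes A: "mods As" and B: "mods Bs"
  shows "intertwiner (braiding U As Bs)"
proof -
  note R = rmatrix_closed
  have L: "module K (T (As @ Bs))" "module K (T (Bs @ As))"
    using assms by (auto intro: T_module)
  have "app (braiding U As Bs) (tact U (Bs @ As) a z) = tact U (As @ Bs) a (app (braiding U As Bs) z)"
    if a: "a \<in> carrier U" and z: "z \<in> carrier (T (Bs @ As))" for a z
  proof (rule tens_ext2[OF z B A L(1) HOL.refl])
    show "is_linear K (T (Bs @ As)) (T (As @ Bs)) (\<lambda>z. app (braiding U As Bs) (tact U (Bs @ As) a z))"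
      "is_linear K (T (Bs @ As)) (T (As @ Bs)) (\<lambda>z. tact U (As @ Bs) a (app (braiding U As Bs) z))"
      using assms a is_linear_compose[OF braiding_linear[OF A B] tact_linear[OF _ a is_linear_id]]
        braiding_linear[OF A B] by (auto intro!: tact_linear is_linear_id)
    fix y x assume y: "y \<in> carrier (T Bs)" and x: "x \<in> carrier (T As)"
    let ?h = "\<lambda>u v. tappend U As Bs (tact U As v x) (tact U Bs u y)"
    let ?S = "sweedler U (T (As @ Bs))"
    note rules = linear_rules closed_rules
    have "app (braiding U As Bs) (tact U (Bs @ As) a (tappend U Bs As y x))
        = ?S (\<lambda>p q. app (braiding U As Bs) (tappend U Bs As (tact U Bs p y) (tact U As q x))) (comult U a)"
      unfolding tact_append[OF B A a y x]
      by (rule sweedler_compose[OF L(2,1)])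
        (use A B x y a braiding_linear[OF A B] in \<open>auto intro!: rules\<close>)
    also have "\<dots> = ?S (\<lambda>p q. ?S (\<lambda>r s. ?h (r \<otimes> p) (s \<otimes> q)) (rmatrix U)) (comult U a)"
    proof (rule sweedler_cong[OF L(1)])
      fix p q assume pq: "p \<in> carrier U" "q \<in> carrier U"
      have "app (braiding U As Bs) (tappend U Bs As (tact U Bs p y) (tact U As q x))
        = ?S (\<lambda>r s. tappend U As Bs (tact U As s (tact U As q x)) (tact U Bs r (tact U Bs p y))) (rmatrix U)"
        using A B x y pq by (intro app_braiding tact_closed)
      also have "\<dots> = ?S (\<lambda>r s. ?h (r \<otimes> p) (s \<otimes> q)) (rmatrix U)"
        by (rule sweedler_cong[OF L(1) _ R])
          (use A B x y pq in \<open>auto intro!: rules simp: tact_mult\<close>)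
      finally show "app (braiding U As Bs) (tappend U Bs As (tact U Bs p y) (tact U As q x))
        = ?S (\<lambda>r s. ?h (r \<otimes> p) (s \<otimes> q)) (rmatrix U)" .
    qed (use A B x y a R in \<open>auto intro!: rules\<close>)
    also have "\<dots> = ?S (\<lambda>r s. ?S (\<lambda>p q. ?h (r \<otimes> p) (s \<otimes> q)) (comult U a)) (rmatrix U)"
      by (rule sweedler_swap[OF L(1)]) (use A B x y a R in \<open>auto intro!: rules\<close>)
    also have "\<dots> = ?S ?h (tpow_mult U 2 (rmatrix U) (comult U a))"
      by (rule sweedler_mult[OF L(1), symmetric]) (use A B x y a R in \<open>auto intro!: rules\<close>)
    also have "\<dots> = ?S ?h (tpow_mult U 2 (flip U (comult U a)) (rmatrix U))"
      by (simp add: rmatrix_comult a)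
    also have "\<dots> = ?S (\<lambda>p q. ?S (\<lambda>r s. ?h (p \<otimes> r) (q \<otimes> s)) (rmatrix U)) (flip U (comult U a))"
      by (rule sweedler_mult[OF L(1)]) (use A B x y a R in \<open>auto intro!: rules flip_closed\<close>)
    also have "\<dots> = ?S (\<lambda>p q. ?S (\<lambda>r s. ?h (q \<otimes> r) (p \<otimes> s)) (rmatrix U)) (comult U a)"
      by (rule sweedler_flip[OF L(1)]) (use A B x y a R in \<open>auto intro!: rules\<close>)
    also have "\<dots> = ?S (\<lambda>r s. ?S (\<lambda>p q. ?h (q \<otimes> r) (p \<otimes> s)) (comult U a)) (rmatrix U)"
      by (rule sweedler_swap[OF L(1)]) (use A B x y a R in \<open>auto intro!: rules\<close>)
    also have "\<dots> = ?S (\<lambda>r s. tact U (As @ Bs) a (?h r s)) (rmatrix U)"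
    proof (rule sweedler_cong[OF L(1) _ R])
      fix r s assume rs: "r \<in> carrier U" "s \<in> carrier U"
      have "tact U (As @ Bs) a (?h r s)
        = ?S (\<lambda>p q. tappend U As Bs (tact U As p (tact U As s x)) (tact U Bs q (tact U Bs r y))) (comult U a)"
        using A B x y rs a by (intro tact_append tact_closed)
      also have "\<dots> = ?S (\<lambda>p q. ?h (q \<otimes> r) (p \<otimes> s)) (comult U a)"
        by (rule sweedler_cong[OF L(1) _ comult_closed[OF a]])
          (use A B x y rs in \<open>auto intro!: rules simp: tact_mult\<close>)
      finally show "?S (\<lambda>p q. ?h (q \<otimes> r) (p \<otimes> s)) (comult U a) = tact U (As @ Bs) a (?h r s)" ..
    qed (use A B x y a in \<open>auto intro!: rules\<close>)
    also have "\<dots> = tact U (As @ Bs) a (app (braiding U As Bs) (tappend U Bs As y x))"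
      unfolding app_braiding[OF A B x y]
      by (rule sweedler_compose[OF L(1,1), symmetric]) (use A B x y a R in \<open>auto intro!: rules\<close>)
    finally show "app (braiding U As Bs) (tact U (Bs @ As) a (tappend U Bs As y x))
      = tact U (As @ Bs) a (app (braiding U As Bs) (tappend U Bs As y x))" .
  qed
  then show ?thesis
    using assms braiding_linear[OF A B]
    by (auto simp: intertwiner_def) (simp add: braiding_def)
qed

text \<open>The inverse map is \<open>x \<otimes> y \<mapsto> \<Sum> R'\<^sub>1 y \<otimes> R'\<^sub>2 x\<close> for the inverse \<open>R'\<close> of the R-matrix: both composites
  are the action of a product of \<open>R\<close> and \<open>R'\<close>.\<close>

lemma isom_braiding:
  assumes A: "mods As" and B: "mods Bs"
  shows "isom (braiding U As Bs)"
proof -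
  note R = rmatrix_closed
  obtain R' where R': "R' \<in> carrier (tpow U 2)"
    and inv: "tpow_mult U 2 (rmatrix U) R' = ptens U [\<one>, \<one>]" "tpow_mult U 2 R' (rmatrix U) = ptens U [\<one>, \<one>]"
    using rmatrix_invertible by blast
  have L: "module K (T (As @ Bs))" "module K (T (Bs @ As))"
    using assms by (auto intro: T_module)
  note rules = linear_rules closed_rules
  define h where "h = (\<lambda>x y. sweedler U (T (Bs @ As)) (\<lambda>p q. tappend U Bs As (tact U Bs p y) (tact U As q x)) R')"
  define g where "g = tlift U (As @ Bs) (T (Bs @ As))
    (\<lambda>zs. h (ptens_of U As (take (length As) zs)) (ptens_of U Bs (drop (length As) zs)))"
  have bh: "bilinear K (T As) (T Bs) (T (Bs @ As)) h"
    unfolding h_def using A B R' by (auto intro!: rules)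
  have g: "is_linear K (T (As @ Bs)) (T (Bs @ As)) g"
    unfolding g_def by (rule tlift_split_linear[OF A B L(2) bh])
  have app_g: "g (tappend U As Bs x y) = h x y" if "x \<in> carrier (T As)" "y \<in> carrier (T Bs)" for x y
    unfolding g_def by (rule tlift_split_append[OF A B L(2) bh that])
  note b = braiding_linear[OF A B]
  have "g (app (braiding U As Bs) z) = z" if z: "z \<in> carrier (T (Bs @ As))" for z
  proof (rule tens_ext2[OF z B A L(2) HOL.refl is_linear_compose[OF g b] is_linear_id])
    fix y x assume y: "y \<in> carrier (T Bs)" and x: "x \<in> carrier (T As)"
    let ?k = "\<lambda>u v. tappend U Bs As (tact U Bs u y) (tact U As v x)"
    let ?S = "sweedler U (T (Bs @ As))"
    have "g (app (braiding U As Bs) (tappend U Bs As y x))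
        = ?S (\<lambda>r s. g (tappend U As Bs (tact U As s x) (tact U Bs r y))) (rmatrix U)"
      unfolding app_braiding[OF A B x y]
      by (rule sweedler_compose[OF L]) (use A B x y R g in \<open>auto intro!: rules\<close>)
    also have "\<dots> = ?S (\<lambda>r s. ?S (\<lambda>p q. ?k (p \<otimes> r) (q \<otimes> s)) R') (rmatrix U)"
    proof (rule sweedler_cong[OF L(2) _ R])
      fix r s assume rs: "r \<in> carrier U" "s \<in> carrier U"
      have "g (tappend U As Bs (tact U As s x) (tact U Bs r y))
          = ?S (\<lambda>p q. tappend U Bs As (tact U Bs p (tact U Bs r y)) (tact U As q (tact U As s x))) R'"
        using A B x y rs by (subst app_g) (auto simp: h_def tact_closed)
      also have "\<dots> = ?S (\<lambda>p q. ?k (p \<otimes> r) (q \<otimes> s)) R'"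
        by (rule sweedler_cong[OF L(2) _ R']) (use A B x y rs in \<open>auto intro!: rules simp: tact_mult\<close>)
      finally show "g (tappend U As Bs (tact U As s x) (tact U Bs r y)) = ?S (\<lambda>p q. ?k (p \<otimes> r) (q \<otimes> s)) R'" .
    qed (use A B x y R' in \<open>auto intro!: rules\<close>)
    also have "\<dots> = ?S (\<lambda>p q. ?S (\<lambda>r s. ?k (p \<otimes> r) (q \<otimes> s)) (rmatrix U)) R'"
      by (rule sweedler_swap[OF L(2)]) (use A B x y R R' in \<open>auto intro!: rules\<close>)
    also have "\<dots> = ?S ?k (tpow_mult U 2 R' (rmatrix U))"
      by (rule sweedler_mult[OF L(2), symmetric]) (use A B x y R R' in \<open>auto intro!: rules\<close>)
    also have "\<dots> = ?k \<one> \<one>"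
      unfolding inv by (rule sweedler_pure[OF L(2)]) (use A B x y in \<open>auto intro!: rules\<close>)
    also have "\<dots> = tappend U Bs As y x"
      using A B x y by (simp add: tact_one)
    finally show "g (app (braiding U As Bs) (tappend U Bs As y x)) = tappend U Bs As y x" .
  qed
  moreover have "app (braiding U As Bs) (g z) = z" if z: "z \<in> carrier (T (As @ Bs))" for z
  proof (rule tens_ext2[OF z A B L(1) HOL.refl is_linear_compose[OF b g] is_linear_id])
    fix x y assume y: "y \<in> carrier (T Bs)" and x: "x \<in> carrier (T As)"
    let ?k = "\<lambda>u v. tappend U As Bs (tact U As v x) (tact U Bs u y)"
    let ?S = "sweedler U (T (As @ Bs))"
    have "app (braiding U As Bs) (g (tappend U As Bs x y))
        = ?S (\<lambda>p q. app (braiding U As Bs) (tappend U Bs As (tact U Bs p y) (tact U As q x))) R'"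
      unfolding app_g[OF x y] h_def
      by (rule sweedler_compose[OF L(2,1)]) (use A B x y R' b in \<open>auto intro!: rules\<close>)
    also have "\<dots> = ?S (\<lambda>p q. ?S (\<lambda>r s. ?k (r \<otimes> p) (s \<otimes> q)) (rmatrix U)) R'"
    proof (rule sweedler_cong[OF L(1) _ R'])
      fix p q assume pq: "p \<in> carrier U" "q \<in> carrier U"
      have "app (braiding U As Bs) (tappend U Bs As (tact U Bs p y) (tact U As q x))
          = ?S (\<lambda>r s. tappend U As Bs (tact U As s (tact U As q x)) (tact U Bs r (tact U Bs p y))) (rmatrix U)"
        using A B x y pq by (intro app_braiding tact_closed)
      also have "\<dots> = ?S (\<lambda>r s. ?k (r \<otimes> p) (s \<otimes> q)) (rmatrix U)"
        by (rule sweedler_cong[OF L(1) _ R]) (use A B x y pq in \<open>auto intro!: rules simp: tact_mult\<close>)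
      finally show "app (braiding U As Bs) (tappend U Bs As (tact U Bs p y) (tact U As q x))
        = ?S (\<lambda>r s. ?k (r \<otimes> p) (s \<otimes> q)) (rmatrix U)" .
    qed (use A B x y R in \<open>auto intro!: rules\<close>)
    also have "\<dots> = ?S (\<lambda>r s. ?S (\<lambda>p q. ?k (r \<otimes> p) (s \<otimes> q)) R') (rmatrix U)"
      by (rule sweedler_swap[OF L(1)]) (use A B x y R R' in \<open>auto intro!: rules\<close>)
    also have "\<dots> = ?S ?k (tpow_mult U 2 (rmatrix U) R')"
      by (rule sweedler_mult[OF L(1), symmetric]) (use A B x y R R' in \<open>auto intro!: rules\<close>)
    also have "\<dots> = ?k \<one> \<one>"
      unfolding inv by (rule sweedler_pure[OF L(1)]) (use A B x y in \<open>auto intro!: rules\<close>)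
    also have "\<dots> = tappend U As Bs x y"
      using A B x y by (simp add: tact_one)
    finally show "app (braiding U As Bs) (g (tappend U As Bs x y)) = tappend U As Bs x y" .
  qed
  ultimately have "bij_betw (app (braiding U As Bs)) (carrier (T (Bs @ As))) (carrier (T (As @ Bs)))"
    using is_linear_closed[OF b] is_linear_closed[OF g]
    by (intro bij_betw_byWitness[where f' = g]) auto
  then show ?thesis
    using intertwiner_braiding[OF A B] by (simp add: isom_def)
qed

text \<open>The braiding is a flip preceded by the action of \<open>R\<close>. Intertwiners commute with the action of
  each leg of \<open>R\<close>, and the flip exchanges the two maps.\<close>

lemma braiding_natural:
  assumes f: "intertwiner f" and g: "intertwiner g"
  shows "braiding U (tgt f) (tgt g) \<bullet> (g \<boxtimes> f) = (f \<boxtimes> g) \<bullet> braiding U (src f) (src g)"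
proof (rule tmap_eqI)
  note m = intertwiner_mods[OF f] intertwiner_mods[OF g]
  note R = rmatrix_closed
  note rules = linear_rules closed_rules
  have L: "module K (T (tgt f @ tgt g))" "module K (T (src f @ src g))"
    using m by (auto intro: T_module)
  show i: "intertwiner (braiding U (tgt f) (tgt g) \<bullet> (g \<boxtimes> f))" "intertwiner ((f \<boxtimes> g) \<bullet> braiding U (src f) (src g))"
    using f g m by (auto intro!: intertwiner_rules intertwiner_braiding)
  fix z assume "z \<in> carrier (T (src ((f \<boxtimes> g) \<bullet> braiding U (src f) (src g))))"
  then have z: "z \<in> carrier (T (src g @ src f))"
    by simp
  show "app (braiding U (tgt f) (tgt g) \<bullet> (g \<boxtimes> f)) z = app ((f \<boxtimes> g) \<bullet> braiding U (src f) (src g)) z"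
  proof (rule tens_ext2[OF z m(3) m(1) L(1) HOL.refl intertwiner_linear[OF i(1), simplified] intertwiner_linear[OF i(2), simplified]])
    fix y x assume y: "y \<in> carrier (T (src g))" and x: "x \<in> carrier (T (src f))"
    let ?S = "sweedler U (T (tgt f @ tgt g))"
    have fx: "app f x \<in> carrier (T (tgt f))" "app g y \<in> carrier (T (tgt g))"
      using x y f g by (auto intro: app_closed)
    have "app (braiding U (tgt f) (tgt g) \<bullet> (g \<boxtimes> f)) (tappend U (src g) (src f) y x)
        = ?S (\<lambda>r s. tappend U (tgt f) (tgt g) (tact U (tgt f) s (app f x)) (tact U (tgt g) r (app g y))) (rmatrix U)"
      using f g m x y fx by (simp add: app_tcomp tappend_closed app_tprod app_braiding)
    also have "\<dots> = ?S (\<lambda>r s. app (f \<boxtimes> g) (tappend U (src f) (src g) (tact U (src f) s x) (tact U (src g) r y))) (rmatrix U)"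
      by (rule sweedler_cong[OF L(1) _ R, symmetric])
        (use f g m x y fx in \<open>auto intro!: rules simp: app_tprod app_tact tact_closed\<close>)
    also have "\<dots> = app ((f \<boxtimes> g) \<bullet> braiding U (src f) (src g)) (tappend U (src g) (src f) y x)"
      using m x y by (simp add: app_tcomp tappend_closed app_braiding)
        (rule sweedler_compose[OF L(2,1) _ tprod_linear[OF f g] R, symmetric], auto intro!: rules)
    finally show "app (braiding U (tgt f) (tgt g) \<bullet> (g \<boxtimes> f)) (tappend U (src g) (src f) y x)
      = app ((f \<boxtimes> g) \<bullet> braiding U (src f) (src g)) (tappend U (src g) (src f) y x)" .
  qed
qed simp_all

text \<open>The second leg of \<open>R\<close> acts on the block \<open>As @ Bs\<close> through its coproduct, and
  \<open>(id \<otimes> \<Delta>) R = R\<^sub>1\<^sub>3 R\<^sub>1\<^sub>2\<close> splits this into two successive crossings.\<close>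

lemma braiding_cabling_left:
  assumes A: "mods As" and B: "mods Bs" and C: "mods Cs"
  shows "braiding U (As @ Bs) Cs = (\<I> As \<boxtimes> braiding U Bs Cs) \<bullet> (braiding U As Cs \<boxtimes> \<I> Bs)"
proof (rule tmap_eqI)
  note R = rmatrix_closed
  note rules = linear_rules closed_rules
  let ?L = "T (As @ Bs @ Cs)"
  have L: "module K ?L" "module K (T (As @ Cs))" "module K (T (Bs @ Cs))" "module K (T (As @ Cs @ Bs))"
    using assms by (auto intro: T_module)
  note ib = intertwiner_braiding[OF _ C]
  show i: "intertwiner (braiding U (As @ Bs) Cs)" "intertwiner ((\<I> As \<boxtimes> braiding U Bs Cs) \<bullet> (braiding U As Cs \<boxtimes> \<I> Bs))"
    using assms by (auto intro!: intertwiner_rules intertwiner_braiding)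
  fix w assume "w \<in> carrier (T (src ((\<I> As \<boxtimes> braiding U Bs Cs) \<bullet> (braiding U As Cs \<boxtimes> \<I> Bs))))"
  then have w: "w \<in> carrier (T (Cs @ As @ Bs))"
    by simp
  show "app (braiding U (As @ Bs) Cs) w = app ((\<I> As \<boxtimes> braiding U Bs Cs) \<bullet> (braiding U As Cs \<boxtimes> \<I> Bs)) w"
  proof (rule tens_ext3[OF w C A B L(1) HOL.refl intertwiner_linear[OF i(1), simplified] intertwiner_linear[OF i(2), simplified]])
    fix z x y assume z: "z \<in> carrier (T Cs)" and x: "x \<in> carrier (T As)" and y: "y \<in> carrier (T Bs)"
    let ?S = "sweedler U ?L"
    let ?g = "\<lambda>r p q. tappend U As (Bs @ Cs) (tact U As p x) (tappend U Bs Cs (tact U Bs q y) (tact U Cs r z))"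
    have assoc: "tappend U (As @ Bs) Cs (tappend U As Bs x' y') z' = tappend U As (Bs @ Cs) x' (tappend U Bs Cs y' z')"
      if "x' \<in> carrier (T As)" "y' \<in> carrier (T Bs)" "z' \<in> carrier (T Cs)" for x' y' z'
      using tappend_assoc[OF A B C that] .
    have assoc': "tappend U (As @ Cs) Bs (tappend U As Cs x' z') y' = tappend U As (Cs @ Bs) x' (tappend U Cs Bs z' y')"
      if "x' \<in> carrier (T As)" "y' \<in> carrier (T Bs)" "z' \<in> carrier (T Cs)" for x' y' z'
      using tappend_assoc[OF A C B that(1,3,2)] .
    have tri: "trilinear K U U U ?L ?g"
      using assms x y z by (auto intro!: rules)
    have "app (braiding U (As @ Bs) Cs) (tappend U Cs (As @ Bs) z (tappend U As Bs x y))
        = ?S (\<lambda>r s. tappend U (As @ Bs) Cs (tact U (As @ Bs) s (tappend U As Bs x y)) (tact U Cs r z)) (rmatrix U)"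
      using app_braiding[of "As @ Bs" Cs "tappend U As Bs x y" z] assms x y z by (simp add: tappend_closed)
    also have "\<dots> = ?S (\<lambda>r s. ?S (\<lambda>p q. ?g r p q) (comult U s)) (rmatrix U)"
    proof (rule sweedler_cong[OF L(1) _ R])
      fix r s assume rs: "r \<in> carrier U" "s \<in> carrier U"
      have "tappend U (As @ Bs) Cs (tact U (As @ Bs) s (tappend U As Bs x y)) (tact U Cs r z)
          = ?S (\<lambda>p q. tappend U (As @ Bs) Cs (tappend U As Bs (tact U As p x) (tact U Bs q y)) (tact U Cs r z)) (comult U s)"
        unfolding tact_append[OF A B rs(2) x y]
        by (rule sweedler_compose[where L = "T (As @ Bs)"]) (use assms x y z rs in \<open>auto intro!: rules\<close>)
      also have "\<dots> = ?S (\<lambda>p q. ?g r p q) (comult U s)"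
      proof (rule sweedler_cong[OF L(1) _ comult_closed[OF rs(2)]])
        fix p q assume "p \<in> carrier U" "q \<in> carrier U"
        then show "tappend U (As @ Bs) Cs (tappend U As Bs (tact U As p x) (tact U Bs q y)) (tact U Cs r z) = ?g r p q"
          using assms x y z rs by (intro assoc tact_closed)
      qed (use assms x y z rs in \<open>auto intro!: rules\<close>)
      finally show "tappend U (As @ Bs) Cs (tact U (As @ Bs) s (tappend U As Bs x y)) (tact U Cs r z)
        = ?S (\<lambda>p q. ?g r p q) (comult U s)" .
    qed (use assms x y z in \<open>auto intro!: rules\<close>)
    also have "\<dots> = ?S (\<lambda>a b. ?S (\<lambda>c d. ?g (a \<otimes> c) d b) (rmatrix U)) (rmatrix U)"
      by (rule sweedler_cabling_right[OF L(1) tri])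
    also have "\<dots> = ?S (\<lambda>c d. ?S (\<lambda>a b. ?g (a \<otimes> c) d b) (rmatrix U)) (rmatrix U)"
      by (rule sweedler_swap[OF L(1) R R]) (use assms x y z R in \<open>auto intro!: rules\<close>)
    also have "\<dots> = ?S (\<lambda>c d. app (\<I> As \<boxtimes> braiding U Bs Cs)
        (tappend U As (Cs @ Bs) (tact U As d x) (tappend U Cs Bs (tact U Cs c z) y))) (rmatrix U)"
    proof (rule sweedler_cong[OF L(1) _ R, symmetric])
      fix c d assume cd: "c \<in> carrier U" "d \<in> carrier U"
      then have "app (\<I> As \<boxtimes> braiding U Bs Cs) (tappend U As (Cs @ Bs) (tact U As d x) (tappend U Cs Bs (tact U Cs c z) y))
        = tappend U As (Bs @ Cs) (tact U As d x)
          (sweedler U (T (Bs @ Cs)) (\<lambda>a b. tappend U Bs Cs (tact U Bs b y) (tact U Cs a (tact U Cs c z))) (rmatrix U))"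
        using assms x y z ib[OF B]
        by (simp add: app_tprod intertwiner_tid tact_closed tappend_closed app_tid app_braiding)
      also have "\<dots> = ?S (\<lambda>a b. tappend U As (Bs @ Cs) (tact U As d x)
          (tappend U Bs Cs (tact U Bs b y) (tact U Cs a (tact U Cs c z)))) (rmatrix U)"
        by (rule sweedler_compose[OF L(3,1) _ _ R]) (use assms x y z cd in \<open>auto intro!: rules\<close>)
      also have "\<dots> = ?S (\<lambda>a b. ?g (a \<otimes> c) d b) (rmatrix U)"
        by (rule sweedler_cong[OF L(1) _ R]) (use assms x y z cd in \<open>auto intro!: rules simp: tact_mult\<close>)
      finally show "app (\<I> As \<boxtimes> braiding U Bs Cs) (tappend U As (Cs @ Bs) (tact U As d x) (tappend U Cs Bs (tact U Cs c z) y))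
        = ?S (\<lambda>a b. ?g (a \<otimes> c) d b) (rmatrix U)" .
    qed (use assms x y z R in \<open>auto intro!: rules\<close>)
    also have "\<dots> = app (\<I> As \<boxtimes> braiding U Bs Cs) (sweedler U (T (As @ Cs @ Bs))
        (\<lambda>c d. tappend U As (Cs @ Bs) (tact U As d x) (tappend U Cs Bs (tact U Cs c z) y)) (rmatrix U))"
      by (rule sweedler_compose[OF L(4,1) _ _ R, symmetric])
        (use assms x y z intertwiner_linear[OF intertwiner_tprod[OF intertwiner_tid[OF A] ib[OF B]]] in \<open>auto intro!: rules\<close>)
    also have "sweedler U (T (As @ Cs @ Bs)) (\<lambda>c d. tappend U As (Cs @ Bs) (tact U As d x) (tappend U Cs Bs (tact U Cs c z) y)) (rmatrix U)
      = sweedler U (T (As @ Cs @ Bs)) (\<lambda>c d. tappend U (As @ Cs) Bs (tappend U As Cs (tact U As d x) (tact U Cs c z)) y) (rmatrix U)"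
    proof (rule sweedler_cong[OF L(4) _ R])
      fix c d assume "c \<in> carrier U" "d \<in> carrier U"
      then show "tappend U As (Cs @ Bs) (tact U As d x) (tappend U Cs Bs (tact U Cs c z) y)
        = tappend U (As @ Cs) Bs (tappend U As Cs (tact U As d x) (tact U Cs c z)) y"
        using assms x y z by (intro assoc'[symmetric] tact_closed)
    qed (use assms x y z in \<open>auto intro!: rules\<close>)
    also have "\<dots> = tappend U (As @ Cs) Bs (app (braiding U As Cs) (tappend U Cs As z x)) y"
      unfolding app_braiding[OF A C x z]
      by (rule sweedler_compose[OF L(2,4) _ _ R, symmetric]) (use assms x y z in \<open>auto intro!: rules\<close>)
    also have "\<dots> = app (braiding U As Cs \<boxtimes> \<I> Bs) (tappend U (Cs @ As) Bs (tappend U Cs As z x) y)"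
      using assms x y z ib[OF A] by (simp add: app_tprod intertwiner_tid app_tid tappend_closed)
    also have "tappend U (Cs @ As) Bs (tappend U Cs As z x) y = tappend U Cs (As @ Bs) z (tappend U As Bs x y)"
      by (rule tappend_assoc[OF C A B z x y])
    also have "app (\<I> As \<boxtimes> braiding U Bs Cs) (app (braiding U As Cs \<boxtimes> \<I> Bs) (tappend U Cs (As @ Bs) z (tappend U As Bs x y)))
      = app ((\<I> As \<boxtimes> braiding U Bs Cs) \<bullet> (braiding U As Cs \<boxtimes> \<I> Bs)) (tappend U Cs (As @ Bs) z (tappend U As Bs x y))"
      using assms x y z by (simp add: app_tcomp tappend_closed)
    finally show "app (braiding U (As @ Bs) Cs) (tappend U Cs (As @ Bs) z (tappend U As Bs x y))
      = app ((\<I> As \<boxtimes> braiding U Bs Cs) \<bullet> (braiding U As Cs \<boxtimes> \<I> Bs)) (tappend U Cs (As @ Bs) z (tappend U As Bs x y))" .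
  qed
qed simp_all

text \<open>Here the first leg of \<open>R\<close> acts on a block, and the two crossings come from
  \<open>(\<Delta> \<otimes> id) R = R\<^sub>1\<^sub>3 R\<^sub>2\<^sub>3\<close>.\<close>

lemma braiding_cabling_right:
  assumes A: "mods As" and B: "mods Bs" and C: "mods Cs"
  shows "braiding U As (Bs @ Cs) = (braiding U As Bs \<boxtimes> \<I> Cs) \<bullet> (\<I> Bs \<boxtimes> braiding U As Cs)"
proof (rule tmap_eqI)
  note R = rmatrix_closed
  note rules = linear_rules closed_rules
  let ?L = "T (As @ Bs @ Cs)"
  have L: "module K ?L" "module K (T (As @ Cs))" "module K (T (As @ Bs))" "module K (T (Bs @ As @ Cs))"
    using assms by (auto intro: T_module)
  note ib = intertwiner_braiding[OF A]
  show i: "intertwiner (braiding U As (Bs @ Cs))" "intertwiner ((braiding U As Bs \<boxtimes> \<I> Cs) \<bullet> (\<I> Bs \<boxtimes> braiding U As Cs))"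
    using assms by (auto intro!: intertwiner_rules intertwiner_braiding)
  fix w assume "w \<in> carrier (T (src ((braiding U As Bs \<boxtimes> \<I> Cs) \<bullet> (\<I> Bs \<boxtimes> braiding U As Cs))))"
  then have w: "w \<in> carrier (T (Bs @ Cs @ As))"
    by simp
  show "app (braiding U As (Bs @ Cs)) w = app ((braiding U As Bs \<boxtimes> \<I> Cs) \<bullet> (\<I> Bs \<boxtimes> braiding U As Cs)) w"
  proof (rule tens_ext3[OF w B C A L(1) HOL.refl intertwiner_linear[OF i(1), simplified] intertwiner_linear[OF i(2), simplified]])
    fix y z x assume z: "z \<in> carrier (T Cs)" and x: "x \<in> carrier (T As)" and y: "y \<in> carrier (T Bs)"
    let ?S = "sweedler U ?L"
    let ?g = "\<lambda>p q s. tappend U As (Bs @ Cs) (tact U As s x) (tappend U Bs Cs (tact U Bs p y) (tact U Cs q z))"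
    have tri: "trilinear K U U U ?L ?g"
      using assms x y z by (auto intro!: rules)
    have "app (braiding U As (Bs @ Cs)) (tappend U Bs (Cs @ As) y (tappend U Cs As z x))
        = app (braiding U As (Bs @ Cs)) (tappend U (Bs @ Cs) As (tappend U Bs Cs y z) x)"
      by (simp add: tappend_assoc[OF B C A y z x])
    also have "\<dots> = ?S (\<lambda>r s. tappend U As (Bs @ Cs) (tact U As s x) (tact U (Bs @ Cs) r (tappend U Bs Cs y z))) (rmatrix U)"
      using app_braiding[of As "Bs @ Cs" x "tappend U Bs Cs y z"] assms x y z by (simp add: tappend_closed)
    also have "\<dots> = ?S (\<lambda>r s. ?S (\<lambda>p q. ?g p q s) (comult U r)) (rmatrix U)"
    proof (rule sweedler_cong[OF L(1) _ R])
      fix r s assume rs: "r \<in> carrier U" "s \<in> carrier U"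
      show "tappend U As (Bs @ Cs) (tact U As s x) (tact U (Bs @ Cs) r (tappend U Bs Cs y z))
          = ?S (\<lambda>p q. ?g p q s) (comult U r)"
        unfolding tact_append[OF B C rs(1) y z]
        by (rule sweedler_compose[where L = "T (Bs @ Cs)"]) (use assms x y z rs in \<open>auto intro!: rules\<close>)
    qed (use assms x y z in \<open>auto intro!: rules\<close>)
    also have "\<dots> = ?S (\<lambda>a b. ?S (\<lambda>c d. ?g a c (b \<otimes> d)) (rmatrix U)) (rmatrix U)"
      by (rule sweedler_cabling_left[OF L(1) tri])
    also have "\<dots> = ?S (\<lambda>c d. ?S (\<lambda>a b. ?g a c (b \<otimes> d)) (rmatrix U)) (rmatrix U)"
      by (rule sweedler_swap[OF L(1) R R]) (use assms x y z R in \<open>auto intro!: rules\<close>)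
    also have "\<dots> = ?S (\<lambda>c d. app (braiding U As Bs \<boxtimes> \<I> Cs)
        (tappend U Bs (As @ Cs) y (tappend U As Cs (tact U As d x) (tact U Cs c z)))) (rmatrix U)"
    proof (rule sweedler_cong[OF L(1) _ R, symmetric])
      fix c d assume cd: "c \<in> carrier U" "d \<in> carrier U"
      have "app (braiding U As Bs \<boxtimes> \<I> Cs) (tappend U Bs (As @ Cs) y (tappend U As Cs (tact U As d x) (tact U Cs c z)))
        = app (braiding U As Bs \<boxtimes> \<I> Cs) (tappend U (Bs @ As) Cs (tappend U Bs As y (tact U As d x)) (tact U Cs c z))"
        using assms x y z cd by (simp add: tappend_assoc tact_closed)
      also have "\<dots> = tappend U (As @ Bs) Cs
          (sweedler U (T (As @ Bs)) (\<lambda>a b. tappend U As Bs (tact U As b (tact U As d x)) (tact U Bs a y)) (rmatrix U)) (tact U Cs c z)"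
        using assms x y z cd ib[OF B]
        by (simp add: app_tprod intertwiner_tid tact_closed tappend_closed app_tid app_braiding)
      also have "\<dots> = ?S (\<lambda>a b. tappend U (As @ Bs) Cs
          (tappend U As Bs (tact U As b (tact U As d x)) (tact U Bs a y)) (tact U Cs c z)) (rmatrix U)"
        by (rule sweedler_compose[OF L(3,1) _ _ R]) (use assms x y z cd in \<open>auto intro!: rules\<close>)
      also have "\<dots> = ?S (\<lambda>a b. ?g a c (b \<otimes> d)) (rmatrix U)"
      proof (rule sweedler_cong[OF L(1) _ R])
        fix a b assume ab: "a \<in> carrier U" "b \<in> carrier U"
        then have "tact U As b (tact U As d x) = tact U As (b \<otimes> d) x"
          using A x cd by (simp add: tact_mult)
        then show "tappend U (As @ Bs) Cs (tappend U As Bs (tact U As b (tact U As d x)) (tact U Bs a y)) (tact U Cs c z)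
          = ?g a c (b \<otimes> d)"
          using assms x y z cd ab by (simp add: tappend_assoc tact_closed U_m_closed)
      qed (use assms x y z cd in \<open>auto intro!: rules\<close>)
      finally show "app (braiding U As Bs \<boxtimes> \<I> Cs) (tappend U Bs (As @ Cs) y (tappend U As Cs (tact U As d x) (tact U Cs c z)))
        = ?S (\<lambda>a b. ?g a c (b \<otimes> d)) (rmatrix U)" .
    qed (use assms x y z R in \<open>auto intro!: rules\<close>)
    also have "\<dots> = app (braiding U As Bs \<boxtimes> \<I> Cs) (sweedler U (T (Bs @ As @ Cs))
        (\<lambda>c d. tappend U Bs (As @ Cs) y (tappend U As Cs (tact U As d x) (tact U Cs c z))) (rmatrix U))"
      by (rule sweedler_compose[OF L(4,1) _ _ R, symmetric])
        (use assms x y z intertwiner_linear[OF intertwiner_tprod[OF ib[OF B] intertwiner_tid[OF C]]] in \<open>auto intro!: rules\<close>)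
    also have "sweedler U (T (Bs @ As @ Cs)) (\<lambda>c d. tappend U Bs (As @ Cs) y (tappend U As Cs (tact U As d x) (tact U Cs c z))) (rmatrix U)
      = tappend U Bs (As @ Cs) y (app (braiding U As Cs) (tappend U Cs As z x))"
      unfolding app_braiding[OF A C x z]
      by (rule sweedler_compose[OF L(2,4) _ _ R, symmetric]) (use assms x y z in \<open>auto intro!: rules\<close>)
    also have "\<dots> = app (\<I> Bs \<boxtimes> braiding U As Cs) (tappend U Bs (Cs @ As) y (tappend U Cs As z x))"
      using assms x y z ib[OF C] by (simp add: app_tprod intertwiner_tid app_tid tappend_closed)
    also have "app (braiding U As Bs \<boxtimes> \<I> Cs) (app (\<I> Bs \<boxtimes> braiding U As Cs) (tappend U Bs (Cs @ As) y (tappend U Cs As z x)))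
      = app ((braiding U As Bs \<boxtimes> \<I> Cs) \<bullet> (\<I> Bs \<boxtimes> braiding U As Cs)) (tappend U Bs (Cs @ As) y (tappend U Cs As z x))"
      using assms x y z by (simp add: app_tcomp tappend_closed)
    finally show "app (braiding U As (Bs @ Cs)) (tappend U Bs (Cs @ As) y (tappend U Cs As z x))
      = app ((braiding U As Bs \<boxtimes> \<I> Cs) \<bullet> (\<I> Bs \<boxtimes> braiding U As Cs)) (tappend U Bs (Cs @ As) y (tappend U Cs As z x))" .
  qed
qed simp_all

end


section \<open>Braid relations\<close>

context quasitriangular_hopf_algebra
begin

abbreviation braiding' (\<open>\<beta>\<close>) where "\<beta> As Bs \<equiv> braiding U As Bs"

lemmas typing = intertwiner_rules intertwiner_braiding isom_braiding tinv(1)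

text \<open>Slide the crossing of \<open>As\<close> and \<open>Bs\<close> through the braiding of the block \<open>As @ Bs\<close> with \<open>Cs\<close>, and
  expand that braiding by cabling before and after.\<close>

lemma yang_baxter:
  assumes m: "mods As" "mods Bs" "mods Cs"
  shows "(\<I> As \<boxtimes> \<beta> Bs Cs) \<bullet> (\<beta> As Cs \<boxtimes> \<I> Bs) \<bullet> (\<I> Cs \<boxtimes> \<beta> As Bs)
    = (\<beta> As Bs \<boxtimes> \<I> Cs) \<bullet> (\<I> Bs \<boxtimes> \<beta> As Cs) \<bullet> (\<beta> Bs Cs \<boxtimes> \<I> As)"
proof -
  have "(\<I> As \<boxtimes> \<beta> Bs Cs) \<bullet> (\<beta> As Cs \<boxtimes> \<I> Bs) \<bullet> (\<I> Cs \<boxtimes> \<beta> As Bs) = \<beta> (As @ Bs) Cs \<bullet> (\<I> Cs \<boxtimes> \<beta> As Bs)"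
    using m by (simp add: braiding_cabling_left tcomp_assoc typing)
  also have "\<dots> = (\<beta> As Bs \<boxtimes> \<I> Cs) \<bullet> \<beta> (Bs @ As) Cs"
    using braiding_natural[OF intertwiner_braiding[OF m(1,2)] intertwiner_tid[OF m(3)]] by simp
  finally show ?thesis
    using m by (simp add: braiding_cabling_left)
qed

definition double_braiding where
  "double_braiding As Bs = \<beta> As Bs \<bullet> \<beta> Bs As"

lemma double_braiding_simps [simp]:
  "src (double_braiding As Bs) = As @ Bs" "tgt (double_braiding As Bs) = As @ Bs"
  by (simp_all add: double_braiding_def)

lemma isom_double_braiding: "mods As \<Longrightarrow> mods Bs \<Longrightarrow> isom (double_braiding As Bs)"
  by (simp add: double_braiding_def isom_tcomp isom_braiding)

lemma intertwiner_double_braiding: "mods As \<Longrightarrow> mods Bs \<Longrightarrow> intertwiner (double_braiding As Bs)"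
  by (simp add: isom_double_braiding isom_intertwiner)

lemma double_braiding_natural:
  assumes f: "intertwiner f" "src f = As" "tgt f = As" and g: "intertwiner g" "src g = Bs" "tgt g = Bs"
  shows "double_braiding As Bs \<bullet> (f \<boxtimes> g) = (f \<boxtimes> g) \<bullet> double_braiding As Bs"
proof -
  note m = intertwiner_mods[OF f(1)] intertwiner_mods[OF g(1)]
  have "double_braiding As Bs \<bullet> (f \<boxtimes> g) = \<beta> As Bs \<bullet> (\<beta> Bs As \<bullet> (f \<boxtimes> g))"
    using m f g by (simp add: double_braiding_def tcomp_assoc typing)
  also have "\<dots> = \<beta> As Bs \<bullet> ((g \<boxtimes> f) \<bullet> \<beta> Bs As)"
    using braiding_natural[OF g(1) f(1)] f g by simp
  also have "\<dots> = (\<beta> As Bs \<bullet> (g \<boxtimes> f)) \<bullet> \<beta> Bs As"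
    using m f g by (simp add: tcomp_assoc typing)
  also have "\<dots> = ((f \<boxtimes> g) \<bullet> \<beta> As Bs) \<bullet> \<beta> Bs As"
    using braiding_natural[OF f(1) g(1)] f g by simp
  also have "\<dots> = (f \<boxtimes> g) \<bullet> double_braiding As Bs"
    using m f g by (simp add: double_braiding_def tcomp_assoc typing)
  finally show ?thesis .
qed

text \<open>With \<open>H\<close> and \<open>G\<close> the braidings that take the block \<open>Vs @ Vs\<close> across \<open>As\<close> and back, the
  Yang--Baxter equation gives \<open>Z \<bullet> C \<bullet> Z = G \<bullet> c \<bullet> H\<close>, where \<open>c\<close> is the crossing of the two strands on
  the other side of \<open>As\<close>. By naturality the crossing slides through \<open>H\<close> and through \<open>G\<close>. Hence both
  sides are equal to \<open>G \<bullet> c \<bullet> c \<bullet> H\<close>.\<close>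

lemma reflection_equation:
  assumes m: "mods As" "mods Vs"
  defines "Z \<equiv> double_braiding As Vs \<boxtimes> \<I> Vs" and "C \<equiv> \<I> As \<boxtimes> \<beta> Vs Vs"
  shows "Z \<bullet> C \<bullet> Z \<bullet> C = C \<bullet> Z \<bullet> C \<bullet> Z"
proof -
  define c where "c = \<beta> Vs Vs \<boxtimes> \<I> As"
  define a where "a = \<beta> As Vs \<boxtimes> \<I> Vs"
  define b where "b = \<beta> Vs As \<boxtimes> \<I> Vs"
  define a' where "a' = \<I> Vs \<boxtimes> \<beta> As Vs"
  define b' where "b' = \<I> Vs \<boxtimes> \<beta> Vs As"
  define H where "H = \<beta> (Vs @ Vs) As"
  define G where "G = \<beta> As (Vs @ Vs)"
  note defs = c_def a_def b_def a'_def b'_def H_def G_def C_def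
  have ty: "intertwiner c" "intertwiner a" "intertwiner b" "intertwiner a'" "intertwiner b'" "intertwiner C"
    "intertwiner H" "intertwiner G"
    using m by (auto simp: defs typing)
  have st [simp]: "src c = Vs @ Vs @ As" "tgt c = Vs @ Vs @ As" "src a = Vs @ As @ Vs" "tgt a = As @ Vs @ Vs"
    "src b = As @ Vs @ Vs" "tgt b = Vs @ As @ Vs" "src a' = Vs @ Vs @ As" "tgt a' = Vs @ As @ Vs"
    "src b' = Vs @ As @ Vs" "tgt b' = Vs @ Vs @ As" "src C = As @ Vs @ Vs" "tgt C = As @ Vs @ Vs"
    "src H = As @ Vs @ Vs" "tgt H = Vs @ Vs @ As" "src G = Vs @ Vs @ As" "tgt G = As @ Vs @ Vs"
    by (auto simp: defs)
  note assoc = tcomp_assoc intertwiner_tcomp ty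
  have Z: "Z = a \<bullet> b"
    using interchange[of "\<beta> Vs As" "\<beta> As Vs" "\<I> Vs" "\<I> Vs"] m
    by (simp add: Z_def double_braiding_def a_def b_def tcomp_tid typing)
  have H: "H = b' \<bullet> b" and G: "G = a \<bullet> a'"
    using m by (auto simp: defs braiding_cabling_left braiding_cabling_right)
  have HC: "H \<bullet> C = c \<bullet> H" and CG: "C \<bullet> G = G \<bullet> c"
    using m braiding_natural[OF intertwiner_braiding[OF m(2,2)] intertwiner_tid[OF m(1)]]
      braiding_natural[OF intertwiner_tid[OF m(1)] intertwiner_braiding[OF m(2,2)]]
    by (auto simp: defs)
  have yb: "b \<bullet> C \<bullet> a = a' \<bullet> c \<bullet> b'"
    using yang_baxter[OF m(2,1,2)] by (simp add: defs)
  have "Z \<bullet> C \<bullet> Z = a \<bullet> (b \<bullet> C \<bullet> a) \<bullet> b"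
    by (simp add: Z assoc)
  also have "\<dots> = G \<bullet> c \<bullet> H"
    by (simp add: yb G H assoc)
  finally have ZCZ: "Z \<bullet> C \<bullet> Z = G \<bullet> c \<bullet> H" .
  have "Z \<bullet> C \<bullet> Z \<bullet> C = (Z \<bullet> C \<bullet> Z) \<bullet> C"
    by (simp add: Z assoc)
  also have "\<dots> = G \<bullet> c \<bullet> (H \<bullet> C)"
    by (simp add: ZCZ assoc)
  also have "\<dots> = (C \<bullet> G) \<bullet> c \<bullet> H"
    by (simp add: HC CG assoc)
  also have "\<dots> = C \<bullet> (Z \<bullet> C \<bullet> Z)"
    by (simp add: ZCZ assoc)
  finally show ?thesis .
qed

lemma isom_cancel:
  assumes "isom h" "intertwiner f" "intertwiner g" "src f = tgt h" "src g = tgt h" "f \<bullet> h = g \<bullet> h"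
  shows "f = g"
proof -
  note h = isom_intertwiner[OF assms(1)]
  have "f = (f \<bullet> h) \<bullet> tinv U h"
    using assms(2,4) tinv[OF assms(1)] h by (simp add: tcomp_assoc tcomp_tid)
  also have "\<dots> = (g \<bullet> h) \<bullet> tinv U h"
    by (simp add: assms)
  also have "\<dots> = g"
    using assms(3,5) tinv[OF assms(1)] h by (simp add: tcomp_assoc tcomp_tid)
  finally show ?thesis .
qed

text \<open>Pure braids on three strands \<open>As\<close>, \<open>Bs\<close>, \<open>Vs\<close>, the first two of which are the poles: \<open>Vs\<close> encircles the
  left pole (passing the right pole by a conjugation), the right pole, or both poles, and for
  \<open>pole_twist\<close> the two poles encircle each other.\<close>

definition left_pole where
  "left_pole As Bs Vs = (\<I> As \<boxtimes> \<beta> Bs Vs) \<bullet> (double_braiding As Vs \<boxtimes> \<I> Bs) \<bullet> (\<I> As \<boxtimes> tinv U (\<beta> Bs Vs))"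

definition right_pole where
  "right_pole As Bs Vs = \<I> As \<boxtimes> double_braiding Bs Vs"

definition both_poles where
  "both_poles As Bs Vs = double_braiding (As @ Bs) Vs"

definition pole_twist where
  "pole_twist As Bs Vs = double_braiding As Bs \<boxtimes> \<I> Vs"

lemma pole_simps [simp]:
  "src (left_pole As Bs Vs) = As @ Bs @ Vs" "tgt (left_pole As Bs Vs) = As @ Bs @ Vs"
  "src (right_pole As Bs Vs) = As @ Bs @ Vs" "tgt (right_pole As Bs Vs) = As @ Bs @ Vs"
  "src (both_poles As Bs Vs) = As @ Bs @ Vs" "tgt (both_poles As Bs Vs) = As @ Bs @ Vs"
  "src (pole_twist As Bs Vs) = As @ Bs @ Vs" "tgt (pole_twist As Bs Vs) = As @ Bs @ Vs"
  by (simp_all add: left_pole_def right_pole_def both_poles_def pole_twist_def)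

lemma isom_poles:
  assumes "mods As" "mods Bs" "mods Vs"
  shows "isom (left_pole As Bs Vs)" "isom (right_pole As Bs Vs)" "isom (both_poles As Bs Vs)"
    "isom (pole_twist As Bs Vs)"
  using assms
  by (simp_all add: left_pole_def right_pole_def both_poles_def pole_twist_def isom_tcomp isom_tprod
      isom_tid isom_braiding isom_tinv isom_double_braiding)

text \<open>Cabling writes the loop around both poles as two crossings followed by two crossings back. In
  the product of the two single loops the crossing of \<open>Bs\<close> and \<open>Vs\<close> cancels against its inverse.\<close>

lemma both_poles_eq:
  assumes m: "mods As" "mods Bs" "mods Vs"
  shows "both_poles As Bs Vs = left_pole As Bs Vs \<bullet> right_pole As Bs Vs"
proof -
  let ?b = "\<I> As \<boxtimes> \<beta> Bs Vs" and ?i = "\<I> As \<boxtimes> tinv U (\<beta> Bs Vs)"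
  let ?c = "\<I> As \<boxtimes> \<beta> Vs Bs"
  let ?z = "double_braiding As Vs \<boxtimes> \<I> Bs"
  note ty = m typing intertwiner_double_braiding
  have r: "right_pole As Bs Vs = ?b \<bullet> ?c"
    using interchange[of "\<I> As" "\<I> As" "\<beta> Vs Bs" "\<beta> Bs Vs"] m
    by (simp add: right_pole_def double_braiding_def ty tcomp_tid)
  have z: "?z = (\<beta> As Vs \<boxtimes> \<I> Bs) \<bullet> (\<beta> Vs As \<boxtimes> \<I> Bs)"
    using interchange[of "\<beta> Vs As" "\<beta> As Vs" "\<I> Bs" "\<I> Bs"] m
    by (simp add: double_braiding_def ty tcomp_tid)
  have i: "?i \<bullet> ?b = \<I> (As @ Vs @ Bs)"
    using interchange[of "\<I> As" "\<I> As" "\<beta> Bs Vs" "tinv U (\<beta> Bs Vs)"] tinv(2)[OF isom_braiding[OF m(2,3)]] m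
    by (simp add: ty tcomp_tid tprod_tid)
  have "left_pole As Bs Vs \<bullet> right_pole As Bs Vs = ?b \<bullet> ?z \<bullet> (?i \<bullet> ?b) \<bullet> ?c"
    by (simp add: left_pole_def r ty tcomp_assoc)
  also have "\<dots> = (?b \<bullet> (\<beta> As Vs \<boxtimes> \<I> Bs)) \<bullet> ((\<beta> Vs As \<boxtimes> \<I> Bs) \<bullet> ?c)"
    by (simp add: i z ty tcomp_assoc tcomp_tid)
  also have "\<dots> = \<beta> (As @ Bs) Vs \<bullet> \<beta> Vs (As @ Bs)"
    using m by (simp add: braiding_cabling_left braiding_cabling_right)
  finally show ?thesis
    by (simp add: both_poles_def double_braiding_def)
qed

lemma both_poles_twist_commute:
  assumes "mods As" "mods Bs" "mods Vs"
  shows "both_poles As Bs Vs \<bullet> pole_twist As Bs Vs = pole_twist As Bs Vs \<bullet> both_poles As Bs Vs"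
  using double_braiding_natural[of "double_braiding As Bs" "As @ Bs" "\<I> Vs" Vs] assms
  by (simp add: both_poles_def pole_twist_def intertwiner_double_braiding intertwiner_tid)

text \<open>Both sides are the full twist of the three strands \<open>As\<close>, \<open>Bs\<close>, \<open>Vs\<close>: either the poles are twisted
  first and then \<open>Vs\<close> encircles both of them, or \<open>Bs\<close> and \<open>Vs\<close> together encircle \<open>As\<close> and then are twisted. The
  passage from one to the other moves the double braiding of \<open>As\<close> and \<open>Vs\<close> through the strand \<open>Bs\<close>.\<close>

lemma full_twist:
  assumes m: "mods As" "mods Bs" "mods Vs"
  shows "both_poles As Bs Vs \<bullet> pole_twist As Bs Vs = right_pole As Bs Vs \<bullet> double_braiding As (Bs @ Vs)"
proof -
  note ty = m typing intertwiner_double_braiding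
  define a where "a = \<beta> As Vs \<boxtimes> \<I> Bs"
  define b where "b = \<beta> Vs As \<boxtimes> \<I> Bs"
  define c where "c = \<I> As \<boxtimes> \<beta> Vs Bs"
  define d where "d = \<I> As \<boxtimes> \<beta> Bs Vs"
  define e where "e = \<beta> As Bs \<boxtimes> \<I> Vs"
  define f where "f = \<beta> Bs As \<boxtimes> \<I> Vs"
  define g where "g = \<I> Bs \<boxtimes> \<beta> As Vs"
  define h where "h = \<I> Bs \<boxtimes> \<beta> Vs As"
  note defs = a_def b_def c_def d_def e_def f_def g_def h_def
  have t: "intertwiner a" "intertwiner b" "intertwiner c" "intertwiner d" "intertwiner e" "intertwiner f"
    "intertwiner g" "intertwiner h"
    by (simp_all add: defs ty)
  have st [simp]: "src a = Vs @ As @ Bs" "tgt a = As @ Vs @ Bs" "src b = As @ Vs @ Bs" "tgt b = Vs @ As @ Bs"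
    "src c = As @ Bs @ Vs" "tgt c = As @ Vs @ Bs" "src d = As @ Vs @ Bs" "tgt d = As @ Bs @ Vs"
    "src e = Bs @ As @ Vs" "tgt e = As @ Bs @ Vs" "src f = As @ Bs @ Vs" "tgt f = Bs @ As @ Vs"
    "src g = Bs @ Vs @ As" "tgt g = Bs @ As @ Vs" "src h = Bs @ As @ Vs" "tgt h = Bs @ Vs @ As"
    by (simp_all add: defs)
  note assoc = tcomp_assoc intertwiner_tcomp t
  have ab: "double_braiding As Vs \<boxtimes> \<I> Bs = a \<bullet> b"
    using interchange[of "\<beta> Vs As" "\<beta> As Vs" "\<I> Bs" "\<I> Bs"]
    by (simp add: double_braiding_def defs ty tcomp_tid)
  have gh: "\<I> Bs \<boxtimes> double_braiding As Vs = g \<bullet> h"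
    using interchange[of "\<I> Bs" "\<I> Bs" "\<beta> Vs As" "\<beta> As Vs"]
    by (simp add: double_braiding_def defs ty tcomp_tid)
  have "\<beta> (As @ Vs) Bs = c \<bullet> e"
    using m by (simp add: braiding_cabling_left defs)
  then have key: "a \<bullet> b \<bullet> c \<bullet> e = c \<bullet> e \<bullet> g \<bullet> h"
    using braiding_natural[OF intertwiner_double_braiding[OF m(1,3)] intertwiner_tid[OF m(2)]]
    by (simp add: ab gh assoc)
  have "both_poles As Bs Vs = (d \<bullet> a) \<bullet> (b \<bullet> c)"
    using m by (simp add: both_poles_def double_braiding_def braiding_cabling_left braiding_cabling_right defs)
  moreover have "pole_twist As Bs Vs = e \<bullet> f"
    using interchange[of "\<beta> Bs As" "\<beta> As Bs" "\<I> Vs" "\<I> Vs"]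
    by (simp add: pole_twist_def double_braiding_def defs ty tcomp_tid)
  ultimately have "both_poles As Bs Vs \<bullet> pole_twist As Bs Vs = d \<bullet> (a \<bullet> b \<bullet> c \<bullet> e) \<bullet> f"
    by (simp add: assoc)
  also have "\<dots> = (d \<bullet> c) \<bullet> ((e \<bullet> g) \<bullet> (h \<bullet> f))"
    by (simp add: key assoc)
  also have "d \<bullet> c = right_pole As Bs Vs"
    using interchange[of "\<I> As" "\<I> As" "\<beta> Vs Bs" "\<beta> Bs Vs"]
    by (simp add: right_pole_def double_braiding_def defs ty tcomp_tid)
  also have "(e \<bullet> g) \<bullet> (h \<bullet> f) = double_braiding As (Bs @ Vs)"
    using m by (simp add: double_braiding_def braiding_cabling_left braiding_cabling_right defs)
  finally show ?thesis .
qed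

text \<open>In the second description of the full twist, the loop of \<open>Vs\<close> around \<open>Bs\<close> is an endomorphism
  of one of the two blocks of a double braiding, so naturality applies.\<close>

lemma full_twist_right_pole_commute:
  assumes m: "mods As" "mods Bs" "mods Vs"
  shows "(both_poles As Bs Vs \<bullet> pole_twist As Bs Vs) \<bullet> right_pole As Bs Vs
    = right_pole As Bs Vs \<bullet> (both_poles As Bs Vs \<bullet> pole_twist As Bs Vs)"
proof -
  have "double_braiding As (Bs @ Vs) \<bullet> right_pole As Bs Vs = right_pole As Bs Vs \<bullet> double_braiding As (Bs @ Vs)"
    using double_braiding_natural[of "\<I> As" As "double_braiding Bs Vs" "Bs @ Vs"] m
    by (simp add: right_pole_def intertwiner_double_braiding intertwiner_tid)
  then show ?thesis
    unfolding full_twist[OF m] using m isom_poles[OF m, THEN isom_intertwiner]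
    by (simp add: tcomp_assoc intertwiner_double_braiding)
qed

lemma tprod_tid_right_tcomp:
  assumes "intertwiner f" "intertwiner g" "src g = tgt f" "mods Cs"
  shows "(g \<boxtimes> \<I> Cs) \<bullet> (f \<boxtimes> \<I> Cs) = (g \<bullet> f) \<boxtimes> \<I> Cs"
  using assms by (simp add: interchange intertwiner_tid tcomp_tid)

lemma tprod_tid_left_tcomp:
  assumes "intertwiner f" "intertwiner g" "src g = tgt f" "mods Cs"
  shows "(\<I> Cs \<boxtimes> g) \<bullet> (\<I> Cs \<boxtimes> f) = \<I> Cs \<boxtimes> (g \<bullet> f)"
  using assms by (simp add: interchange intertwiner_tid tcomp_tid)

lemma both_poles_reflection:
  assumes m: "mods As" "mods Bs" "mods Vs"
  defines "Z \<equiv> both_poles As Bs Vs \<boxtimes> \<I> Vs" and "C \<equiv> \<I> (As @ Bs) \<boxtimes> \<beta> Vs Vs"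
  shows "Z \<bullet> C \<bullet> Z \<bullet> C = C \<bullet> Z \<bullet> C \<bullet> Z"
  using reflection_equation[of "As @ Bs" Vs] m by (simp add: Z_def C_def both_poles_def)

lemma right_pole_reflection:
  assumes m: "mods As" "mods Bs" "mods Vs"
  defines "Z \<equiv> right_pole As Bs Vs \<boxtimes> \<I> Vs" and "C \<equiv> \<I> (As @ Bs) \<boxtimes> \<beta> Vs Vs"
  shows "Z \<bullet> C \<bullet> Z \<bullet> C = C \<bullet> Z \<bullet> C \<bullet> Z"
proof -
  let ?Z = "double_braiding Bs Vs \<boxtimes> \<I> Vs" and ?C = "\<I> Bs \<boxtimes> \<beta> Vs Vs"
  note ty = m typing intertwiner_double_braiding
  have "Z = \<I> As \<boxtimes> ?Z" "C = \<I> As \<boxtimes> ?C"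
    by (simp_all add: Z_def C_def right_pole_def tprod_assoc ty flip: tprod_tid)
  then show ?thesis
    using reflection_equation[OF m(2,3)] by (simp add: tprod_tid_left_tcomp ty)
qed

text \<open>The braiding \<open>q\<close> of the right pole with both strands moves that pole out of the way. It conjugates
  the loop around the left pole to a loop that no longer meets \<open>Bs\<close>, and the crossing of the strands to
  itself, so the reflection equation for the pole \<open>As\<close> alone carries over.\<close>

lemma left_pole_reflection:
  assumes m: "mods As" "mods Bs" "mods Vs"
  defines "X \<equiv> left_pole As Bs Vs \<boxtimes> \<I> Vs" and "C \<equiv> \<I> (As @ Bs) \<boxtimes> \<beta> Vs Vs"
  shows "X \<bullet> C \<bullet> X \<bullet> C = C \<bullet> X \<bullet> C \<bullet> X"
proof -
  note ty = m typing intertwiner_double_braiding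
  define b where "b = \<I> As \<boxtimes> \<beta> Bs Vs \<boxtimes> \<I> Vs"
  define i where "i = \<I> As \<boxtimes> tinv U (\<beta> Bs Vs) \<boxtimes> \<I> Vs"
  define d where "d = \<I> As \<boxtimes> \<I> Vs \<boxtimes> \<beta> Bs Vs"
  define z where "z = double_braiding As Vs \<boxtimes> \<I> (Bs @ Vs)"
  define z' where "z' = double_braiding As Vs \<boxtimes> \<I> (Vs @ Bs)"
  define c where "c = \<I> As \<boxtimes> \<beta> Vs Vs \<boxtimes> \<I> Bs"
  define q where "q = \<I> As \<boxtimes> \<beta> Bs (Vs @ Vs)"
  note defs = b_def i_def d_def z_def z'_def c_def q_def C_def
  have t: "intertwiner b" "intertwiner i" "intertwiner d" "intertwiner z" "intertwiner z'" "intertwiner c"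
    "intertwiner q" "intertwiner C"
    by (simp_all add: defs ty)
  have st [simp]: "src b = As @ Vs @ Bs @ Vs" "tgt b = As @ Bs @ Vs @ Vs"
    "src i = As @ Bs @ Vs @ Vs" "tgt i = As @ Vs @ Bs @ Vs"
    "src d = As @ Vs @ Vs @ Bs" "tgt d = As @ Vs @ Bs @ Vs"
    "src z = As @ Vs @ Bs @ Vs" "tgt z = As @ Vs @ Bs @ Vs"
    "src z' = As @ Vs @ Vs @ Bs" "tgt z' = As @ Vs @ Vs @ Bs"
    "src c = As @ Vs @ Vs @ Bs" "tgt c = As @ Vs @ Vs @ Bs"
    "src q = As @ Vs @ Vs @ Bs" "tgt q = As @ Bs @ Vs @ Vs"
    "src C = As @ Bs @ Vs @ Vs" "tgt C = As @ Bs @ Vs @ Vs"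
    by (simp_all add: defs)
  note assoc = tcomp_assoc intertwiner_tcomp t
  have X: "X = b \<bullet> z \<bullet> i"
    by (simp add: X_def left_pole_def defs ty tprod_assoc flip: tprod_tid_right_tcomp tprod_tid)
  have q: "q = b \<bullet> d"
    by (simp add: defs ty braiding_cabling_right flip: tprod_tid_left_tcomp)
  have ib: "i \<bullet> b = \<I> (As @ Vs @ Bs @ Vs)"
    using tinv(2)[OF isom_braiding[OF m(2,3)]]
    by (simp add: defs ty tprod_tid_left_tcomp tprod_tid_right_tcomp tprod_tid)
  have zd: "z \<bullet> d = d \<bullet> z'"
  proof -
    have "d = \<I> (As @ Vs) \<boxtimes> \<beta> Bs Vs"
      by (simp add: d_def ty tprod_assoc flip: tprod_tid)
    then show ?thesis
      by (simp add: z_def z'_def ty interchange tcomp_tid)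
  qed
  have Xq: "X \<bullet> q = q \<bullet> z'"
  proof -
    have "X \<bullet> q = b \<bullet> z \<bullet> (i \<bullet> b) \<bullet> d"
      by (simp add: X q assoc)
    also have "\<dots> = b \<bullet> (z \<bullet> d)"
      by (simp add: ib assoc tcomp_tid)
    also have "\<dots> = q \<bullet> z'"
      by (simp add: zd q assoc)
    finally show ?thesis .
  qed
  have Cq: "C \<bullet> q = q \<bullet> c"
    using braiding_natural[OF intertwiner_tid[OF m(2)] intertwiner_braiding[OF m(3,3)]]
    by (simp add: defs ty tprod_assoc tprod_tid_left_tcomp flip: tprod_tid)
  have zc: "z' \<bullet> c \<bullet> z' \<bullet> c = c \<bullet> z' \<bullet> c \<bullet> z'"
  proof -
    have "z' = (double_braiding As Vs \<boxtimes> \<I> Vs) \<boxtimes> \<I> Bs" "c = (\<I> As \<boxtimes> \<beta> Vs Vs) \<boxtimes> \<I> Bs"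
      by (simp_all add: defs ty tprod_assoc flip: tprod_tid)
    then show ?thesis
      using reflection_equation[OF m(1,3)] by (simp add: tprod_tid_right_tcomp ty)
  qed
  have tX: "intertwiner X" "src X = As @ Bs @ Vs @ Vs" "tgt X = As @ Bs @ Vs @ Vs"
    by (simp_all add: X assoc)
  note assoc = assoc tX
  have "(X \<bullet> C \<bullet> X \<bullet> C) \<bullet> q = X \<bullet> C \<bullet> X \<bullet> (C \<bullet> q)"
    by (simp add: assoc)
  also have "\<dots> = X \<bullet> C \<bullet> (X \<bullet> q) \<bullet> c"
    by (simp add: Cq assoc)
  also have "\<dots> = X \<bullet> (C \<bullet> q) \<bullet> z' \<bullet> c"
    by (simp add: Xq assoc)
  also have "\<dots> = (X \<bullet> q) \<bullet> c \<bullet> z' \<bullet> c"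
    by (simp add: Cq assoc)
  also have "\<dots> = q \<bullet> (z' \<bullet> c \<bullet> z' \<bullet> c)"
    by (simp add: Xq assoc)
  also have "\<dots> = (q \<bullet> c) \<bullet> z' \<bullet> c \<bullet> z'"
    unfolding zc by (simp add: assoc)
  also have "\<dots> = C \<bullet> (q \<bullet> z') \<bullet> c \<bullet> z'"
    by (simp add: Cq[symmetric] assoc)
  also have "\<dots> = C \<bullet> X \<bullet> (q \<bullet> c) \<bullet> z'"
    by (simp add: Xq[symmetric] assoc)
  also have "\<dots> = C \<bullet> X \<bullet> C \<bullet> (q \<bullet> z')"
    by (simp add: Cq[symmetric] assoc)
  also have "\<dots> = (C \<bullet> X \<bullet> C \<bullet> X) \<bullet> q"
    by (simp add: Xq[symmetric] assoc)
  finally have "(X \<bullet> C \<bullet> X \<bullet> C) \<bullet> q = (C \<bullet> X \<bullet> C \<bullet> X) \<bullet> q" .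
  moreover have "isom q"
    using m by (simp add: q_def isom_tprod isom_tid isom_braiding)
  ultimately show ?thesis
    by - (rule isom_cancel[of q], simp_all add: assoc)
qed

lemma commute_disjoint:
  assumes "intertwiner f" "src f = As" "tgt f = As" "intertwiner g" "src g = Bs" "tgt g = Bs"
  shows "(f \<boxtimes> \<I> Bs) \<bullet> (\<I> As \<boxtimes> g) = (\<I> As \<boxtimes> g) \<bullet> (f \<boxtimes> \<I> Bs)"
  using assms intertwiner_mods[OF assms(1)] intertwiner_mods[OF assms(4)]
  by (simp add: interchange intertwiner_tid tcomp_tid)

end


section \<open>Groups given by generators and relations\<close>

locale group_presentation =
  fixes S :: "'s set" and E :: "('s word \<times> 's word) set"
  assumes relations: "(v, w) \<in> E \<Longrightarrow> v \<in> lists (S \<times> UNIV) \<and> w \<in> lists (S \<times> UNIV)"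
begin

abbreviation words :: "'s word set" where "words \<equiv> lists (S \<times> UNIV)"
abbreviation cls :: "'s word \<Rightarrow> 's word set" where "cls \<equiv> word_class S E"

lemma word_eq_words: "word_eq S E v w \<Longrightarrow> v \<in> words \<and> w \<in> words"
  by (induction rule: word_eq.induct) (use relations in auto)

lemma cls_eq: "word_eq S E v w \<Longrightarrow> cls v = cls w"
  unfolding word_class_def by (blast intro: word_eq.sym word_eq.trans)

lemma in_cls: "v \<in> words \<Longrightarrow> v \<in> cls v"
  by (simp add: word_class_def word_eq.refl)

lemma carrier_presented: "carrier (presented_group S E) = cls ` words"
  and one_presented: "\<one>\<^bsub>presented_group S E\<^esub> = cls []"
  by (simp_all add: presented_group_def)

lemma cls_closed: "v \<in> words \<Longrightarrow> cls v \<in> carrier (presented_group S E)"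
  by (simp add: carrier_presented)

lemma cls_mult:
  assumes "v \<in> words" "w \<in> words"
  shows "cls v \<otimes>\<^bsub>presented_group S E\<^esub> cls w = cls (v @ w)"
proof -
  have "cls (v' @ w') = cls (v @ w)" if "v' \<in> cls v" "w' \<in> cls w" for v' w'
    using that by (intro cls_eq) (auto simp: word_class_def intro: word_eq.append word_eq.sym)
  then have "(\<Union>v'\<in>cls v. \<Union>w'\<in>cls w. cls (v' @ w')) = cls (v @ w)"
    using in_cls[OF assms(1)] in_cls[OF assms(2)] by blast
  then show ?thesis
    by (simp add: presented_group_def)
qed

definition inverse_word :: "'s word \<Rightarrow> 's word" where
  "inverse_word w = rev (map (\<lambda>(s, b). (s, \<not> b)) w)"

lemma inverse_word_words: "w \<in> words \<Longrightarrow> inverse_word w \<in> words"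
  by (auto simp: inverse_word_def)

lemma inverse_word_cancel: "w \<in> words \<Longrightarrow> word_eq S E (inverse_word w @ w) []"
proof (induction w)
  case Nil
  show ?case
    by (simp add: inverse_word_def word_eq.refl)
next
  case (Cons l w)
  obtain s b where l: "l = (s, b)" "s \<in> S"
    using Cons.prems by (cases l) auto
  have w: "w \<in> words"
    using Cons.prems by simp
  have "word_eq S E [(s, \<not> b), (s, b)] []"
    using word_eq.cancel[OF l(2), of E "\<not> b"] by simp
  then have "word_eq S E ([(s, \<not> b), (s, b)] @ w) ([] @ w)"
    by (intro word_eq.append word_eq.refl[OF w])
  then have "word_eq S E (inverse_word w @ [(s, \<not> b), (s, b)] @ w) (inverse_word w @ [] @ w)"
    by (rule word_eq.append[OF word_eq.refl[OF inverse_word_words[OF w]]])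
  then show ?case
    using Cons.IH[OF w] by (auto simp: l(1) inverse_word_def intro: word_eq.trans)
qed

lemma group_presented: "group (presented_group S E)"
proof (rule groupI)
  fix x assume "x \<in> carrier (presented_group S E)"
  then obtain w where w: "w \<in> words" "x = cls w"
    by (auto simp: carrier_presented)
  show "\<exists>y\<in>carrier (presented_group S E). y \<otimes>\<^bsub>presented_group S E\<^esub> x = \<one>\<^bsub>presented_group S E\<^esub>"
    using w cls_eq[OF inverse_word_cancel[OF w(1)]]
    by (intro bexI[of _ "cls (inverse_word w)"]) (auto simp: cls_mult one_presented inverse_word_words cls_closed)
next
  show "\<one>\<^bsub>presented_group S E\<^esub> \<in> carrier (presented_group S E)"
    using cls_closed[of "[]"] by (simp add: one_presented)
  fix x assume "x \<in> carrier (presented_group S E)"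
  then show "\<one>\<^bsub>presented_group S E\<^esub> \<otimes>\<^bsub>presented_group S E\<^esub> x = x"
    using cls_mult[of "[]"] by (auto simp: carrier_presented one_presented)
next
  fix x y z
  assume "x \<in> carrier (presented_group S E)" "y \<in> carrier (presented_group S E)" "z \<in> carrier (presented_group S E)"
  then obtain u v w where "u \<in> words" "x = cls u" "v \<in> words" "y = cls v" "w \<in> words" "z = cls w"
    unfolding carrier_presented by blast
  then show "x \<otimes>\<^bsub>presented_group S E\<^esub> y \<in> carrier (presented_group S E)"
    "x \<otimes>\<^bsub>presented_group S E\<^esub> y \<otimes>\<^bsub>presented_group S E\<^esub> z
      = x \<otimes>\<^bsub>presented_group S E\<^esub> (y \<otimes>\<^bsub>presented_group S E\<^esub> z)"
    by (simp_all add: cls_mult cls_closed)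
qed

end

definition eval_word :: "('h, 'e) monoid_scheme \<Rightarrow> ('s \<Rightarrow> 'h) \<Rightarrow> 's word \<Rightarrow> 'h" where
  "eval_word H f w = foldr (\<lambda>(s, b) x. (if b then f s else inv\<^bsub>H\<^esub> f s) \<otimes>\<^bsub>H\<^esub> x) w \<one>\<^bsub>H\<^esub>"

lemma eval_word_simps [simp]:
  "eval_word H f [] = \<one>\<^bsub>H\<^esub>"
  "eval_word H f ((s, True) # w) = f s \<otimes>\<^bsub>H\<^esub> eval_word H f w"
  "eval_word H f ((s, False) # w) = inv\<^bsub>H\<^esub> f s \<otimes>\<^bsub>H\<^esub> eval_word H f w"
  by (simp_all add: eval_word_def)

text \<open>The universal property of a group given by generators and relations: evaluation of words
  respects \<open>word_eq\<close>, by induction over its rules.\<close>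

theorem (in group_presentation) presented_group_hom:
  assumes "group H" "f \<in> S \<rightarrow> carrier H" "\<And>v w. (v, w) \<in> E \<Longrightarrow> eval_word H f v = eval_word H f w"
  obtains h where "h \<in> hom (presented_group S E) H" "\<And>s. s \<in> S \<Longrightarrow> h (cls [(s, True)]) = f s"
proof -
  interpret H: group H by fact
  have closed: "eval_word H f w \<in> carrier H" if "w \<in> words" for w
    using that
  proof (induction w)
    case (Cons l w)
    then show ?case
      using assms(2) by (cases l; cases "snd l") auto
  qed simp
  have eval_append: "eval_word H f (v @ w) = eval_word H f v \<otimes>\<^bsub>H\<^esub> eval_word H f w" if "v \<in> words" "w \<in> words" for v w
    using that(1)
  proof (induction v)
    case Nil
    then show ?case
      using closed[OF that(2)] by simp
  next
    case (Cons l v)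
    then have "fst l \<in> S" "v \<in> words"
      by auto
    then have "f (fst l) \<in> carrier H" "eval_word H f v \<in> carrier H"
      using assms(2) closed by auto
    with Cons closed[OF that(2)] show ?case
      by (cases l; cases "snd l") (auto simp: H.m_assoc)
  qed
  have wd: "eval_word H f v = eval_word H f w" if "word_eq S E v w" for v w
    using that
  proof (induction rule: word_eq.induct)
    case (append v v' w w')
    then show ?case
      using word_eq_words eval_append by metis
  next
    case (cancel s b)
    then show ?case
      using assms(2) by (cases b) (auto simp: Pi_def)
  qed (use assms(3) in auto)
  define h where "h A = eval_word H f (SOME w. w \<in> A)" for A
  have h: "h (cls w) = eval_word H f w" if "w \<in> words" for w
  proof -
    have "(SOME v. v \<in> cls w) \<in> cls w"
      using in_cls[OF that] by (rule someI[of "\<lambda>v. v \<in> cls w"])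
    then show ?thesis
      using wd by (simp add: h_def word_class_def)
  qed
  show ?thesis
  proof
    show "h \<in> hom (presented_group S E) H"
    proof (rule homI)
      fix x y assume "x \<in> carrier (presented_group S E)" "y \<in> carrier (presented_group S E)"
      then obtain v w where "v \<in> words" "x = cls v" "w \<in> words" "y = cls w"
        unfolding carrier_presented by blast
      then show "h x \<in> carrier H" "h (x \<otimes>\<^bsub>presented_group S E\<^esub> y) = h x \<otimes>\<^bsub>H\<^esub> h y"
        by (simp_all add: cls_mult h eval_append closed)
    qed
    show "h (cls [(s, True)]) = f s" if "s \<in> S" for s
      using that assms(2) by (auto simp: h Pi_def)
  qed
qed


section \<open>Group algebras\<close>

lemma free_module_ext:
  assumes "cring K" "module K L" "is_linear K (free_module K B) L f" "is_linear K (free_module K B) L g"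
    and "\<And>x. x \<in> B \<Longrightarrow> f (free_gen K x) = g (free_gen K x)" "a \<in> carrier (free_module K B)"
  shows "f a = g a"
  using assms(1,6)
proof (induction rule: free_module_induct)
  case zero
  then show ?case
    using is_linear_zero[OF free_module_module[OF assms(1)] assms(2)] assms(3,4) by metis
next
  case (add a b)
  then show ?case
    by (simp only: is_linear_add[OF assms(3) add(1,2)] is_linear_add[OF assms(4) add(1,2)])
next
  case (smult c a)
  then show ?case
    by (simp only: is_linear_smult[OF assms(3) smult(1,2)] is_linear_smult[OF assms(4) smult(1,2)])
qed (rule assms(5))

lemma free_module_finsum_apply:
  assumes "cring K" "finite A" "h \<in> A \<rightarrow> carrier (free_module K B)"
  shows "(\<Oplus>\<^bsub>free_module K B\<^esub>x\<in>A. h x) y = (\<Oplus>\<^bsub>K\<^esub>x\<in>A. h x y)"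
proof -
  interpret K: cring K by fact
  interpret F: module K "free_module K B" by (rule free_module_module) fact
  show ?thesis
    using assms(2,3)
  proof (induction A rule: finite_induct)
    case (insert x A)
    then have "h x \<in> carrier (free_module K B)" "h \<in> A \<rightarrow> carrier (free_module K B)"
      "(\<lambda>x. h x y) \<in> A \<rightarrow> carrier K" "h x y \<in> carrier K"
      by (auto simp: free_module_carrier Pi_def)
    with insert show ?case
      by simp
  qed simp
qed

locale group_algebra_setup = Z: cring Z + G: group G
  for Z :: "'z ring" and G :: "('g, 'f) monoid_scheme"
begin

abbreviation "F \<equiv> free_module Z (carrier G)"
abbreviation "A \<equiv> group_algebra Z G"

sublocale F: module Z F
  by (rule free_module_module) (rule Z.is_cring)

lemma group_algebra_simps:
  "carrier A = carrier F" "\<zero>\<^bsub>A\<^esub> = \<zero>\<^bsub>F\<^esub>" "add A = add F" "\<one>\<^bsub>A\<^esub> = free_gen Z \<one>\<^bsub>G\<^esub>"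
  by (auto simp: group_algebra_def free_module_def free_gen_def)

definition translate :: "'g \<Rightarrow> ('g \<Rightarrow> 'z) \<Rightarrow> 'g \<Rightarrow> 'z" where
  "translate h b = (\<lambda>g. if g \<in> carrier G then b (inv\<^bsub>G\<^esub> h \<otimes>\<^bsub>G\<^esub> g) else \<zero>\<^bsub>Z\<^esub>)"

lemma translate_closed:
  assumes "h \<in> carrier G" "b \<in> carrier F"
  shows "translate h b \<in> carrier F"
proof (rule free_moduleI)
  show "finite ((\<lambda>g. h \<otimes>\<^bsub>G\<^esub> g) ` {g. b g \<noteq> \<zero>\<^bsub>Z\<^esub>})"
    using assms by (simp add: free_module_carrier)
  show "(\<lambda>g. h \<otimes>\<^bsub>G\<^esub> g) ` {g. b g \<noteq> \<zero>\<^bsub>Z\<^esub>} \<subseteq> carrier G"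
    using assms by (auto simp: free_module_carrier)
  show "translate h b x \<in> carrier Z" for x
    using assms by (simp add: translate_def free_module_carrier)
  show "x \<in> (\<lambda>g. h \<otimes>\<^bsub>G\<^esub> g) ` {g. b g \<noteq> \<zero>\<^bsub>Z\<^esub>}" if "translate h b x \<noteq> \<zero>\<^bsub>Z\<^esub>" for x
    using that assms
    by (intro image_eqI[of _ _ "inv\<^bsub>G\<^esub> h \<otimes>\<^bsub>G\<^esub> x"]) (auto simp: translate_def G.m_assoc[symmetric] split: if_splits)
qed

lemma translate_linear: "h \<in> carrier G \<Longrightarrow> is_linear Z F F (translate h)"
  by (rule is_linearI) (auto simp: translate_closed, auto simp: translate_def fun_eq_iff)

lemma translate_gen:
  assumes "h \<in> carrier G" "g \<in> carrier G"
  shows "translate h (free_gen Z g) = free_gen Z (h \<otimes>\<^bsub>G\<^esub> g)"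
proof -
  have "inv\<^bsub>G\<^esub> h \<otimes>\<^bsub>G\<^esub> x = g \<longleftrightarrow> x = h \<otimes>\<^bsub>G\<^esub> g" if "x \<in> carrier G" for x
    using assms that G.inv_solve_left' by metis
  then show ?thesis
    using assms by (auto simp: translate_def free_gen_def fun_eq_iff)
qed

text \<open>Convolution is the linear extension of translation in its first argument. It is therefore
  bilinear, and identities about it can be checked on group elements.\<close>

lemma mult_eq:
  assumes "a \<in> carrier F" "b \<in> carrier F"
  shows "a \<otimes>\<^bsub>A\<^esub> b = lin_ext Z F (\<lambda>h. translate h b) a"
proof
  fix g
  have supp: "finite {h. a h \<noteq> \<zero>\<^bsub>Z\<^esub>}" "{h. a h \<noteq> \<zero>\<^bsub>Z\<^esub>} \<subseteq> carrier G" "\<And>h. a h \<in> carrier Z"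
    using assms(1) by (auto simp: free_module_carrier)
  have "lin_ext Z F (\<lambda>h. translate h b) a g = (\<Oplus>\<^bsub>Z\<^esub>h\<in>{h. a h \<noteq> \<zero>\<^bsub>Z\<^esub>}. a h \<otimes>\<^bsub>Z\<^esub> translate h b g)"
    unfolding lin_ext_def using supp assms(2)
    by (subst free_module_finsum_apply[OF Z.is_cring])
      (auto intro!: F.smult_closed translate_closed simp del: free_module_simps(3), auto)
  also have "\<dots> = (a \<otimes>\<^bsub>A\<^esub> b) g"
  proof (cases "g \<in> carrier G")
    case True
    then show ?thesis
      by (simp add: group_algebra_def translate_def)
  next
    case False
    then have "(\<Oplus>\<^bsub>Z\<^esub>h\<in>{h. a h \<noteq> \<zero>\<^bsub>Z\<^esub>}. a h \<otimes>\<^bsub>Z\<^esub> translate h b g) = (\<Oplus>\<^bsub>Z\<^esub>h\<in>{h. a h \<noteq> \<zero>\<^bsub>Z\<^esub>}. \<zero>\<^bsub>Z\<^esub>)"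
      using supp(3) by (intro Z.finsum_cong') (auto simp: translate_def)
    then show ?thesis
      using False by (simp add: group_algebra_def)
  qed
  finally show "(a \<otimes>\<^bsub>A\<^esub> b) g = lin_ext Z F (\<lambda>h. translate h b) a g" ..
qed

lemma mult_bilinear: "bilinear Z F F F (mult A)"
proof (rule bilinearI)
  fix a assume a: "a \<in> carrier F"
  have "is_linear Z F F (\<lambda>b. lin_ext Z F (\<lambda>h. translate h b) a)"
    by (intro lin_ext_param_linear[OF F.module_axioms F.module_axioms a] translate_linear)
  then show "is_linear Z F F (\<lambda>b. a \<otimes>\<^bsub>A\<^esub> b)"
    by (rule is_linear_cong) (simp_all add: mult_eq a F.module_axioms)
next
  fix b assume b: "b \<in> carrier F"
  have "is_linear Z F F (lin_ext Z F (\<lambda>h. translate h b))"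
    using b by (intro lin_ext_linear F.module_axioms) (auto intro: translate_closed)
  then show "is_linear Z F F (\<lambda>a. a \<otimes>\<^bsub>A\<^esub> b)"
    by (rule is_linear_cong) (simp_all add: mult_eq b F.module_axioms)
qed

lemma gen_closed: "g \<in> carrier G \<Longrightarrow> free_gen Z g \<in> carrier F"
  by (rule free_gen_closed) (rule Z.is_cring)

lemma mult_gen_left: "g \<in> carrier G \<Longrightarrow> b \<in> carrier F \<Longrightarrow> free_gen Z g \<otimes>\<^bsub>A\<^esub> b = translate g b"
  by (simp add: mult_eq gen_closed) (rule lin_ext_gen, auto intro: F.module_axioms translate_closed)

lemma mult_gen: "g \<in> carrier G \<Longrightarrow> h \<in> carrier G \<Longrightarrow> free_gen Z g \<otimes>\<^bsub>A\<^esub> free_gen Z h = free_gen Z (g \<otimes>\<^bsub>G\<^esub> h)"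
  by (simp add: mult_gen_left gen_closed translate_gen)

lemma group_algebra_ring: "ring A"
proof (rule ringI)
  note ext = free_module_ext[OF Z.is_cring F.module_axioms]
  note lin = bilinear_left[OF mult_bilinear] bilinear_right[OF mult_bilinear]
  have cl: "a \<otimes>\<^bsub>A\<^esub> b \<in> carrier F" if "a \<in> carrier F" "b \<in> carrier F" for a b
    using bilinear_closed[OF mult_bilinear that] .
  show "abelian_group A"
  proof (intro abelian_groupI; (simp only: group_algebra_simps)?)
    fix x assume "x \<in> carrier F"
    then show "\<exists>y\<in>carrier F. y \<oplus>\<^bsub>F\<^esub> x = \<zero>\<^bsub>F\<^esub>"
      by (intro bexI[of _ "\<ominus>\<^bsub>F\<^esub> x"]) (auto simp: F.M.l_neg simp del: free_module_simps)
  qed (auto simp: F.M.a_assoc F.M.a_comm F.M.a_lcomm simp del: free_module_simps)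
  show "monoid A"
  proof (rule monoidI; (simp only: group_algebra_simps)?)
    fix a b c assume a: "a \<in> carrier F" and b: "b \<in> carrier F" and c: "c \<in> carrier F"
    show "a \<otimes>\<^bsub>A\<^esub> b \<in> carrier F"
      using a b by (rule cl)
    show "(a \<otimes>\<^bsub>A\<^esub> b) \<otimes>\<^bsub>A\<^esub> c = a \<otimes>\<^bsub>A\<^esub> (b \<otimes>\<^bsub>A\<^esub> c)"
    proof (rule ext[OF is_linear_compose[OF lin(1)[OF c] lin(1)[OF b]] lin(1)[OF cl[OF b c]] _ a])
      fix g assume g: "g \<in> carrier G"
      show "(free_gen Z g \<otimes>\<^bsub>A\<^esub> b) \<otimes>\<^bsub>A\<^esub> c = free_gen Z g \<otimes>\<^bsub>A\<^esub> (b \<otimes>\<^bsub>A\<^esub> c)"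
      proof (rule ext[OF is_linear_compose[OF lin(1)[OF c] lin(2)[OF gen_closed[OF g]]]
            is_linear_compose[OF lin(2)[OF gen_closed[OF g]] lin(1)[OF c]] _ b])
        fix h assume h: "h \<in> carrier G"
        show "(free_gen Z g \<otimes>\<^bsub>A\<^esub> free_gen Z h) \<otimes>\<^bsub>A\<^esub> c = free_gen Z g \<otimes>\<^bsub>A\<^esub> (free_gen Z h \<otimes>\<^bsub>A\<^esub> c)"
          by (rule ext[OF lin(2)[OF cl[OF gen_closed[OF g] gen_closed[OF h]]]
                is_linear_compose[OF lin(2)[OF gen_closed[OF g]] lin(2)[OF gen_closed[OF h]]] _ c])
            (use g h in \<open>simp add: mult_gen G.m_assoc\<close>)
      qed
    qed
    show "free_gen Z \<one>\<^bsub>G\<^esub> \<otimes>\<^bsub>A\<^esub> a = a"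
      by (rule ext[OF lin(2)[OF gen_closed[OF G.one_closed]] is_linear_id _ a]) (simp add: mult_gen)
    show "a \<otimes>\<^bsub>A\<^esub> free_gen Z \<one>\<^bsub>G\<^esub> = a"
      by (rule ext[OF lin(1)[OF gen_closed[OF G.one_closed]] is_linear_id _ a]) (simp add: mult_gen)
  next
    show "free_gen Z \<one>\<^bsub>G\<^esub> \<in> carrier F"
      by (simp add: gen_closed)
  qed
qed (use is_linear_add[OF bilinear_left[OF mult_bilinear]] is_linear_add[OF bilinear_right[OF mult_bilinear]]
  in \<open>simp_all add: group_algebra_simps del: free_module_simps\<close>)

lemma monomial_eq: "z \<in> carrier Z \<Longrightarrow> monomial Z z g = z \<odot>\<^bsub>F\<^esub> free_gen Z g"
  by (auto simp: monomial_def free_gen_def fun_eq_iff)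

text \<open>The universal property of the group algebra. The target becomes a module over the coefficients
  by \<open>\<zeta>\<close>, and the extension of \<open>\<rho>\<close> is linear. It is multiplicative on group elements, and then
  everywhere, since coefficients can be moved past group elements.\<close>

theorem group_algebra_hom:
  assumes "ring R" and \<zeta>: "\<zeta> \<in> ring_hom Z R" and \<rho>: "\<rho> \<in> hom G R" "\<rho> \<one>\<^bsub>G\<^esub> = \<one>\<^bsub>R\<^esub>"
    and comm: "\<And>z g. z \<in> carrier Z \<Longrightarrow> g \<in> carrier G \<Longrightarrow> \<zeta> z \<otimes>\<^bsub>R\<^esub> \<rho> g = \<rho> g \<otimes>\<^bsub>R\<^esub> \<zeta> z"
  obtains \<Phi> where "\<Phi> \<in> ring_hom A R"
    "\<And>z g. z \<in> carrier Z \<Longrightarrow> g \<in> carrier G \<Longrightarrow> \<Phi> (monomial Z z g) = \<zeta> z \<otimes>\<^bsub>R\<^esub> \<rho> g"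
proof -
  interpret R: ring R by fact
  note \<zeta>c = ring_hom_closed[OF \<zeta>]
  have \<rho>c: "\<rho> g \<in> carrier R" if "g \<in> carrier G" for g
    using \<rho>(1) that by (auto simp: hom_def)
  define L where "L = \<lparr>carrier = carrier R, mult = mult R, one = one R, zero = zero R, add = add R,
    smult = (\<lambda>z x. \<zeta> z \<otimes>\<^bsub>R\<^esub> x)\<rparr>"
  have L_simps [simp]: "carrier L = carrier R" "add L = add R" "\<zero>\<^bsub>L\<^esub> = \<zero>\<^bsub>R\<^esub>" "z \<odot>\<^bsub>L\<^esub> x = \<zeta> z \<otimes>\<^bsub>R\<^esub> x" for z x
    by (simp_all add: L_def)
  have L: "module Z L"
  proof (intro moduleI abelian_groupI; (simp only: L_simps)?)
    fix x assume "x \<in> carrier R"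
    then show "\<exists>y\<in>carrier R. y \<oplus>\<^bsub>R\<^esub> x = \<zero>\<^bsub>R\<^esub>"
      by (intro bexI[of _ "\<ominus>\<^bsub>R\<^esub> x"]) (auto simp: R.l_neg)
  qed (auto simp: Z.is_cring R.a_assoc R.a_comm R.a_lcomm \<zeta>c ring_hom_add[OF \<zeta>] ring_hom_mult[OF \<zeta>] ring_hom_one[OF \<zeta>]
      R.l_distr R.r_distr R.m_assoc)
  define \<Phi> where "\<Phi> = lin_ext Z L \<rho>"
  have lin: "is_linear Z F L \<Phi>"
    unfolding \<Phi>_def using \<rho>c by (intro lin_ext_linear L) auto
  have gen: "\<Phi> (free_gen Z g) = \<rho> g" if "g \<in> carrier G" for g
    unfolding \<Phi>_def using \<rho>c that by (intro lin_ext_gen[OF L]) auto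
  have cl: "\<Phi> a \<in> carrier R" if "a \<in> carrier F" for a
    using is_linear_closed[OF lin that] by simp
  have mult: "\<Phi> (a \<otimes>\<^bsub>A\<^esub> b) = \<Phi> a \<otimes>\<^bsub>R\<^esub> \<Phi> b" if a: "a \<in> carrier F" and b: "b \<in> carrier F" for a b
  proof (rule free_module_ext[OF Z.is_cring L is_linear_compose[OF lin bilinear_left[OF mult_bilinear b]] _ _ a])
    show "is_linear Z F L (\<lambda>a. \<Phi> a \<otimes>\<^bsub>R\<^esub> \<Phi> b)"
      using b by (intro is_linearI)
        (simp_all add: cl \<zeta>c is_linear_add[OF lin] is_linear_smult[OF lin] R.l_distr R.m_assoc del: free_module_simps)
    fix g assume g: "g \<in> carrier G"
    show "\<Phi> (free_gen Z g \<otimes>\<^bsub>A\<^esub> b) = \<Phi> (free_gen Z g) \<otimes>\<^bsub>R\<^esub> \<Phi> b"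
    proof (rule free_module_ext[OF Z.is_cring L is_linear_compose[OF lin bilinear_right[OF mult_bilinear gen_closed[OF g]]] _ _ b])
      have "\<rho> g \<otimes>\<^bsub>R\<^esub> (\<zeta> c \<otimes>\<^bsub>R\<^esub> \<Phi> x) = \<zeta> c \<otimes>\<^bsub>R\<^esub> (\<rho> g \<otimes>\<^bsub>R\<^esub> \<Phi> x)" if "c \<in> carrier Z" "x \<in> carrier F" for c x
        using that g comm[OF that(1) g] by (simp add: \<rho>c \<zeta>c cl flip: R.m_assoc)
      then show "is_linear Z F L (\<lambda>b. \<Phi> (free_gen Z g) \<otimes>\<^bsub>R\<^esub> \<Phi> b)"
        using g by (intro is_linearI)
          (simp_all add: gen cl \<zeta>c \<rho>c is_linear_add[OF lin] is_linear_smult[OF lin] R.r_distr del: free_module_simps)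
      show "\<Phi> (free_gen Z g \<otimes>\<^bsub>A\<^esub> free_gen Z h) = \<Phi> (free_gen Z g) \<otimes>\<^bsub>R\<^esub> \<Phi> (free_gen Z h)" if "h \<in> carrier G" for h
        using g that hom_mult[OF \<rho>(1)] by (simp add: mult_gen gen)
    qed
  qed
  show ?thesis
  proof
    show "\<Phi> \<in> ring_hom A R"
      by (rule ring_hom_memI)
        (simp_all add: group_algebra_simps cl mult is_linear_add[OF lin] gen \<rho>(2) del: free_module_simps)
    show "\<Phi> (monomial Z z g) = \<zeta> z \<otimes>\<^bsub>R\<^esub> \<rho> g" if "z \<in> carrier Z" "g \<in> carrier G" for z g
      using that by (simp add: monomial_eq is_linear_smult[OF lin] gen_closed gen del: free_module_simps)
  qed
qed

end


section \<open>Endomorphism rings\<close>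

lemma center_ring_cring:
  assumes "ring A"
  shows "cring (center_ring A)"
proof -
  interpret A: ring A by fact
  have neg: "\<ominus>\<^bsub>A\<^esub> z \<in> center A" if "z \<in> center A" for z
    using that by (auto simp: center_def A.l_minus A.r_minus)
  have centerD: "z \<in> carrier A" "z \<otimes>\<^bsub>A\<^esub> a = a \<otimes>\<^bsub>A\<^esub> z" if "z \<in> center A" "a \<in> carrier A" for z a
    using that by (auto simp: center_def)
  have mult: "x \<otimes>\<^bsub>A\<^esub> y \<in> center A" if x: "x \<in> center A" and y: "y \<in> center A" for x y
  proof -
    have c: "x \<in> carrier A" "y \<in> carrier A"
      using x y by (auto simp: center_def)
    have "(x \<otimes>\<^bsub>A\<^esub> y) \<otimes>\<^bsub>A\<^esub> a = a \<otimes>\<^bsub>A\<^esub> (x \<otimes>\<^bsub>A\<^esub> y)" if a: "a \<in> carrier A" for a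
    proof -
      have "(x \<otimes>\<^bsub>A\<^esub> y) \<otimes>\<^bsub>A\<^esub> a = x \<otimes>\<^bsub>A\<^esub> (a \<otimes>\<^bsub>A\<^esub> y)"
        using c a centerD(2)[OF y a] by (simp add: A.m_assoc)
      also have "\<dots> = (a \<otimes>\<^bsub>A\<^esub> x) \<otimes>\<^bsub>A\<^esub> y"
        using c a by (simp add: centerD(2)[OF x a] flip: A.m_assoc)
      finally show ?thesis
        using c a by (simp add: A.m_assoc)
    qed
    then show ?thesis
      using c unfolding center_def by simp
  qed
  have comm: "x \<otimes>\<^bsub>A\<^esub> y = y \<otimes>\<^bsub>A\<^esub> x" if "x \<in> center A" "y \<in> center A" for x y
    using centerD(2)[OF that(1)] that(2) unfolding center_def by blast
  have add: "x \<oplus>\<^bsub>A\<^esub> y \<in> center A" if "x \<in> center A" "y \<in> center A" for x y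
    using that by (auto simp: center_def A.l_distr A.r_distr)
  have units: "\<zero>\<^bsub>A\<^esub> \<in> center A" "\<one>\<^bsub>A\<^esub> \<in> center A"
    by (auto simp: center_def)
  have carrier: "x \<in> carrier A" if "x \<in> center A" for x
    using that by (simp add: center_def)
  show ?thesis
  proof (intro cringI abelian_groupI comm_monoidI; (simp only: center_ring_def ring.simps monoid.simps partial_object.simps)?)
    fix x assume "x \<in> center A"
    then show "\<exists>y\<in>center A. y \<oplus>\<^bsub>A\<^esub> x = \<zero>\<^bsub>A\<^esub>"
      using neg by (intro bexI[of _ "\<ominus>\<^bsub>A\<^esub> x"]) (auto simp: carrier A.l_neg)
  qed (auto simp: mult add units carrier A.l_distr A.a_assoc A.a_comm A.a_lcomm A.m_assoc intro: comm)
qed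

lemma End_ring_simps [simp]:
  "f \<otimes>\<^bsub>End_ring R W\<^esub> g = compose (carrier W) f g" "\<one>\<^bsub>End_ring R W\<^esub> = (\<lambda>x\<in>carrier W. x)"
  "f \<oplus>\<^bsub>End_ring R W\<^esub> g = (\<lambda>x\<in>carrier W. f x \<oplus>\<^bsub>W\<^esub> g x)" "\<zero>\<^bsub>End_ring R W\<^esub> = (\<lambda>x\<in>carrier W. \<zero>\<^bsub>W\<^esub>)"
  by (simp_all add: End_ring_def)

lemma End_ring_carrier:
  "f \<in> carrier (End_ring R W) \<longleftrightarrow> f \<in> carrier W \<rightarrow>\<^sub>E carrier W \<and>
    (\<forall>x\<in>carrier W. \<forall>y\<in>carrier W. f (x \<oplus>\<^bsub>W\<^esub> y) = f x \<oplus>\<^bsub>W\<^esub> f y) \<and>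
    (\<forall>a\<in>carrier R. \<forall>x\<in>carrier W. f (a \<odot>\<^bsub>W\<^esub> x) = a \<odot>\<^bsub>W\<^esub> f x)"
  by (simp add: End_ring_def)

lemma End_ring_apply:
  "f \<in> carrier (End_ring R W) \<Longrightarrow> x \<in> carrier W \<Longrightarrow> f x \<in> carrier W"
  "f \<in> carrier (End_ring R W) \<Longrightarrow> x \<in> carrier W \<Longrightarrow> y \<in> carrier W \<Longrightarrow> f (x \<oplus>\<^bsub>W\<^esub> y) = f x \<oplus>\<^bsub>W\<^esub> f y"
  "f \<in> carrier (End_ring R W) \<Longrightarrow> a \<in> carrier R \<Longrightarrow> x \<in> carrier W \<Longrightarrow> f (a \<odot>\<^bsub>W\<^esub> x) = a \<odot>\<^bsub>W\<^esub> f x"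
  by (auto simp: End_ring_carrier)

context left_module
begin

lemma action_zero:
  assumes "a \<in> carrier R"
  shows "a \<odot>\<^bsub>M\<^esub> \<zero>\<^bsub>M\<^esub> = \<zero>\<^bsub>M\<^esub>"
proof -
  have c: "a \<odot>\<^bsub>M\<^esub> \<zero>\<^bsub>M\<^esub> \<in> carrier M"
    using assms by (simp add: action_closed)
  have "a \<odot>\<^bsub>M\<^esub> \<zero>\<^bsub>M\<^esub> \<oplus>\<^bsub>M\<^esub> a \<odot>\<^bsub>M\<^esub> \<zero>\<^bsub>M\<^esub> = a \<odot>\<^bsub>M\<^esub> \<zero>\<^bsub>M\<^esub>"
    using action_r_distr[OF assms M.zero_closed M.zero_closed] by simp
  then show ?thesis
    using c M.add.l_cancel_one' by metis
qed

lemma action_neg: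
  assumes "a \<in> carrier R" "x \<in> carrier M"
  shows "a \<odot>\<^bsub>M\<^esub> (\<ominus>\<^bsub>M\<^esub> x) = \<ominus>\<^bsub>M\<^esub> (a \<odot>\<^bsub>M\<^esub> x)"
proof -
  have "a \<odot>\<^bsub>M\<^esub> (\<ominus>\<^bsub>M\<^esub> x) \<oplus>\<^bsub>M\<^esub> a \<odot>\<^bsub>M\<^esub> x = \<zero>\<^bsub>M\<^esub>"
    using action_r_distr[of a "\<ominus>\<^bsub>M\<^esub> x" x] assms by (simp add: M.l_neg action_zero)
  then show ?thesis
    using assms by (simp add: M.minus_equality action_closed)
qed

lemma End_ring_ring: "ring (End_ring R M)"
proof (rule ringI)
  let ?E = "End_ring R M"
  note ap = End_ring_apply
  have eqI: "f = g" if "f \<in> extensional (carrier M)" "g \<in> extensional (carrier M)"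
    "\<And>x. x \<in> carrier M \<Longrightarrow> f x = g x" for f g
    using that by (rule extensionalityI)
  have ext: "f \<in> extensional (carrier M)" if "f \<in> carrier ?E" for f
    using that by (auto simp: End_ring_carrier PiE_def)
  show "abelian_group ?E"
  proof (rule abelian_groupI)
    fix f g h assume f: "f \<in> carrier ?E" and g: "g \<in> carrier ?E" and h: "h \<in> carrier ?E"
    show "f \<oplus>\<^bsub>?E\<^esub> g \<in> carrier ?E"
      using f g by (auto simp: End_ring_carrier[of "\<lambda>x\<in>carrier M. _ x"] ap M.a_assoc M.a_comm M.a_lcomm
          action_closed action_r_distr)
    show "f \<oplus>\<^bsub>?E\<^esub> g \<oplus>\<^bsub>?E\<^esub> h = f \<oplus>\<^bsub>?E\<^esub> (g \<oplus>\<^bsub>?E\<^esub> h)" "f \<oplus>\<^bsub>?E\<^esub> g = g \<oplus>\<^bsub>?E\<^esub> f" "\<zero>\<^bsub>?E\<^esub> \<oplus>\<^bsub>?E\<^esub> f = f"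
      using f g h by (auto intro!: eqI simp: ext ap M.a_assoc M.a_comm M.a_lcomm)
    have "(\<lambda>x\<in>carrier M. \<ominus>\<^bsub>M\<^esub> f x) \<in> carrier ?E"
      using f by (auto simp: End_ring_carrier[of "\<lambda>x\<in>carrier M. _ x"] ap M.minus_add action_closed action_neg)
    then show "\<exists>y\<in>carrier ?E. y \<oplus>\<^bsub>?E\<^esub> f = \<zero>\<^bsub>?E\<^esub>"
      using f by (intro bexI[of _ "\<lambda>x\<in>carrier M. \<ominus>\<^bsub>M\<^esub> f x"]) (auto simp: ap M.l_neg)
  next
    show "\<zero>\<^bsub>?E\<^esub> \<in> carrier ?E"
      by (auto simp: End_ring_carrier action_zero action_closed)
  qed
  have mc: "f \<otimes>\<^bsub>?E\<^esub> g \<in> carrier ?E" if f: "f \<in> carrier ?E" and g: "g \<in> carrier ?E" for f g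
    using f g by (auto simp: End_ring_carrier[of "\<lambda>x\<in>carrier M. f (g x)"] ap compose_def action_closed)
  show "monoid ?E"
  proof (rule monoidI)
    fix f g h assume f: "f \<in> carrier ?E" and g: "g \<in> carrier ?E" and h: "h \<in> carrier ?E"
    show "f \<otimes>\<^bsub>?E\<^esub> g \<in> carrier ?E"
      using f g by (rule mc)
    show "f \<otimes>\<^bsub>?E\<^esub> g \<otimes>\<^bsub>?E\<^esub> h = f \<otimes>\<^bsub>?E\<^esub> (g \<otimes>\<^bsub>?E\<^esub> h)" "\<one>\<^bsub>?E\<^esub> \<otimes>\<^bsub>?E\<^esub> f = f" "f \<otimes>\<^bsub>?E\<^esub> \<one>\<^bsub>?E\<^esub> = f"
      using f g h by (auto intro!: eqI simp: ext ap compose_def)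
  next
    show "\<one>\<^bsub>?E\<^esub> \<in> carrier ?E"
      by (auto simp: End_ring_carrier action_closed)
  qed
  fix f g h assume f: "f \<in> carrier ?E" and g: "g \<in> carrier ?E" and h: "h \<in> carrier ?E"
  show "(f \<oplus>\<^bsub>?E\<^esub> g) \<otimes>\<^bsub>?E\<^esub> h = f \<otimes>\<^bsub>?E\<^esub> h \<oplus>\<^bsub>?E\<^esub> g \<otimes>\<^bsub>?E\<^esub> h" "h \<otimes>\<^bsub>?E\<^esub> (f \<oplus>\<^bsub>?E\<^esub> g) = h \<otimes>\<^bsub>?E\<^esub> f \<oplus>\<^bsub>?E\<^esub> h \<otimes>\<^bsub>?E\<^esub> g"
    using f g h by (auto intro!: eqI simp: ext ap compose_def)
qed

text \<open>Central elements act by module endomorphisms because they commute with the acting ring.\<close>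

lemma central_action_hom: "(\<lambda>z. \<lambda>x\<in>carrier M. z \<odot>\<^bsub>M\<^esub> x) \<in> ring_hom (center_ring R) (End_ring R M)"
proof (rule ring_hom_memI)
  fix z assume "z \<in> carrier (center_ring R)"
  then have z: "z \<in> carrier R" "\<And>a. a \<in> carrier R \<Longrightarrow> z \<otimes> a = a \<otimes> z"
    by (auto simp: center_ring_def center_def)
  then show "(\<lambda>x\<in>carrier M. z \<odot>\<^bsub>M\<^esub> x) \<in> carrier (End_ring R M)"
    by (auto simp: End_ring_carrier action_closed action_r_distr simp flip: action_mult)
  fix w assume "w \<in> carrier (center_ring R)"
  then have w: "w \<in> carrier R"
    by (auto simp: center_ring_def center_def)
  show "(\<lambda>x\<in>carrier M. (z \<otimes>\<^bsub>center_ring R\<^esub> w) \<odot>\<^bsub>M\<^esub> x)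
      = (\<lambda>x\<in>carrier M. z \<odot>\<^bsub>M\<^esub> x) \<otimes>\<^bsub>End_ring R M\<^esub> (\<lambda>x\<in>carrier M. w \<odot>\<^bsub>M\<^esub> x)"
    "(\<lambda>x\<in>carrier M. (z \<oplus>\<^bsub>center_ring R\<^esub> w) \<odot>\<^bsub>M\<^esub> x)
      = (\<lambda>x\<in>carrier M. z \<odot>\<^bsub>M\<^esub> x) \<oplus>\<^bsub>End_ring R M\<^esub> (\<lambda>x\<in>carrier M. w \<odot>\<^bsub>M\<^esub> x)"
    using z(1) w by (auto simp: center_ring_def compose_def action_closed action_mult action_l_distr fun_eq_iff)
next
  show "(\<lambda>x\<in>carrier M. \<one>\<^bsub>center_ring R\<^esub> \<odot>\<^bsub>M\<^esub> x) = \<one>\<^bsub>End_ring R M\<^esub>"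
    by (auto simp: center_ring_def action_one fun_eq_iff)
qed

lemma left_module_with_action:
  assumes "ring A" "\<Phi> \<in> ring_hom A (End_ring R M)"
  shows "left_module A (with_action M \<Phi>)"
proof -
  have simps: "carrier (with_action M \<Phi>) = carrier M" "add (with_action M \<Phi>) = add M"
    "\<zero>\<^bsub>with_action M \<Phi>\<^esub> = \<zero>\<^bsub>M\<^esub>" "smult (with_action M \<Phi>) = \<Phi>"
    by (simp_all add: with_action_def)
  note cl = ring_hom_closed[OF assms(2)]
  have "abelian_group (with_action M \<Phi>)"
  proof (intro abelian_groupI; (simp only: simps)?)
    fix x assume "x \<in> carrier M"
    then show "\<exists>y\<in>carrier M. y \<oplus>\<^bsub>M\<^esub> x = \<zero>\<^bsub>M\<^esub>"
      by (intro bexI[of _ "\<ominus>\<^bsub>M\<^esub> x"]) (auto simp: M.l_neg)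
  qed (auto simp: M.a_assoc M.a_comm M.a_lcomm)
  then show ?thesis
    by (intro left_module.intro left_module_axioms.intro assms)
      (simp_all add: simps End_ring_apply[OF cl] ring_hom_add[OF assms(2)] ring_hom_mult[OF assms(2)]
        ring_hom_one[OF assms(2)] compose_def)
qed

end


section \<open>The action of the extended two boundary braid group\<close>

text \<open>The product \<open>z \<otimes> p\<close> commutes with \<open>y\<close> and with \<open>z\<close>, hence with \<open>x\<close> since \<open>z = x \<otimes> y\<close>. For an element
  that commutes with \<open>z \<otimes> p\<close>, conjugation by \<open>p\<close> is conjugation by the inverse of \<open>z\<close>.\<close>

lemma (in group) full_twist_conjugation:
  assumes "x \<in> carrier G" "y \<in> carrier G" "z \<in> carrier G" "p \<in> carrier G"
    and z: "z = x \<otimes> y" and zp: "z \<otimes> p = p \<otimes> z" and y: "(z \<otimes> p) \<otimes> y = y \<otimes> (z \<otimes> p)"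
  shows "p \<otimes> (x \<otimes> inv p) = inv z \<otimes> (x \<otimes> z)"
    and "p \<otimes> (y \<otimes> inv p) = inv z \<otimes> (y \<otimes> z)"
    and "p \<otimes> (z \<otimes> inv p) = z"
proof -
  have conj: "p \<otimes> (a \<otimes> inv p) = inv z \<otimes> (a \<otimes> z)"
    if a: "a \<in> carrier G" and comm: "(z \<otimes> p) \<otimes> a = a \<otimes> (z \<otimes> p)" for a
  proof -
    have "z \<otimes> (p \<otimes> (a \<otimes> inv p)) = ((z \<otimes> p) \<otimes> a) \<otimes> inv p"
      using assms(1-4) a by (simp add: m_assoc)
    also have "\<dots> = a \<otimes> z"
      unfolding comm using assms(1-4) a by (simp add: m_assoc)
    finally have "inv z \<otimes> (z \<otimes> (p \<otimes> (a \<otimes> inv p))) = inv z \<otimes> (a \<otimes> z)"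
      by simp
    then show ?thesis
      using assms(1-4) a by (simp flip: m_assoc)
  qed
  show "p \<otimes> (y \<otimes> inv p) = inv z \<otimes> (y \<otimes> z)"
    by (rule conj[OF assms(2) y])
  have z': "(z \<otimes> p) \<otimes> z = z \<otimes> (z \<otimes> p)"
    using assms(3,4) m_assoc[of z p z] zp by simp
  show "p \<otimes> (z \<otimes> inv p) = z"
    using conj[OF assms(3) z'] assms(3) by (simp flip: m_assoc)
  have "((z \<otimes> p) \<otimes> x) \<otimes> y = (z \<otimes> p) \<otimes> z"
    using assms(1-4) z by (simp add: m_assoc)
  also have "\<dots> = x \<otimes> (y \<otimes> (z \<otimes> p))"
    using assms(1-4) z' z by (simp add: m_assoc)
  also have "\<dots> = (x \<otimes> (z \<otimes> p)) \<otimes> y"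
    using assms(1-4) by (simp add: m_assoc flip: y)
  finally have "(z \<otimes> p) \<otimes> x = x \<otimes> (z \<otimes> p)"
    using assms(1-4) by simp
  then show "p \<otimes> (x \<otimes> inv p) = inv z \<otimes> (x \<otimes> z)"
    by (rule conj[OF assms(1)])
qed

context hopf_algebra
begin

lemma tensor_module_simps:
  "carrier (tensor_module U Ms) = carrier (T Ms)" "add (tensor_module U Ms) = add (T Ms)"
  "\<zero>\<^bsub>tensor_module U Ms\<^esub> = \<zero>\<^bsub>T Ms\<^esub>" "smult (tensor_module U Ms) = tact U Ms"
  by (simp_all add: tensor_module_def)

lemma left_module_tensor_module:
  assumes "mods Ms"
  shows "left_module U (tensor_module U Ms)"
proof -
  interpret TM: module K "T Ms"
    by (rule T_module) fact
  have "abelian_group (tensor_module U Ms)"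
  proof (intro abelian_groupI; (simp only: tensor_module_simps)?)
    fix x assume "x \<in> carrier (T Ms)"
    then show "\<exists>y\<in>carrier (T Ms). y \<oplus>\<^bsub>T Ms\<^esub> x = \<zero>\<^bsub>T Ms\<^esub>"
      by (intro bexI[of _ "\<ominus>\<^bsub>T Ms\<^esub> x"]) (auto simp: TM.M.l_neg)
  qed (auto simp: TM.M.a_assoc TM.M.a_comm TM.M.a_lcomm)
  then show ?thesis
    using assms
    by (intro left_module.intro left_module_axioms.intro U_ring; (simp only: tensor_module_simps)?)
      (simp_all add: tact_closed tact_mult tact_one is_linear_add[OF tact_linear[OF _ _ is_linear_id]]
        is_linear_add[OF tact_elt_linear[OF _ _ is_linear_id]])
qed

lemma app_End:
  assumes "intertwiner f" "src f = Ms" "tgt f = Ms"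
  shows "app f \<in> carrier (End_ring U (tensor_module U Ms))"
  using assms app_closed[OF assms(1)] app_tact[OF assms(1)] is_linear_add[OF intertwiner_linear[OF assms(1)]]
  by (auto simp: End_ring_carrier tensor_module_simps PiE_def intertwiner_def)

lemma app_End_mult: "src f = Ms \<Longrightarrow> app g \<otimes>\<^bsub>End_ring U (tensor_module U Ms)\<^esub> app f = app (g \<bullet> f)"
  by (simp add: tcomp_def tensor_module_simps)

lemma app_End_one: "\<one>\<^bsub>End_ring U (tensor_module U Ms)\<^esub> = app (\<I> Ms)"
  by (simp add: tid_def tensor_module_simps)

lemma app_Units:
  assumes "isom f" "src f = Ms" "tgt f = Ms"
  shows "app f \<in> Units (End_ring U (tensor_module U Ms))"
  using assms tinv[OF assms(1)] isom_intertwiner[OF assms(1)]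
  unfolding Units_def
  by (auto simp: app_End app_End_one app_End_mult simp del: End_ring_simps
      intro!: bexI[of _ "app (tinv U f)"])

end

fun braid_action where
  "braid_action U M N V k X1 = Rcheck_M_sq U M N V k"
| "braid_action U M N V k Y1 = Rcheck_N_sq U M N V k"
| "braid_action U M N V k Z1 = Rcheck_0_sq U M N V k"
| "braid_action U M N V k P = Rcheck_P U M N V k"
| "braid_action U M N V k (T i) = Rcheck_i U M N V k i"

lemma braid_rels_cases:
  assumes "(v, w) \<in> braid_rels k"
  obtains
      (braid) i where "1 \<le> i" "i + 1 < k" "v = map gen [T i, T (i + 1), T i]"
        "w = map gen [T (i + 1), T i, T (i + 1)]"
    | (far) i j where "1 \<le> i" "i < k" "1 \<le> j" "j < k" "i + 2 \<le> j \<or> j + 2 \<le> i"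
        "v = map gen [T i, T j]" "w = map gen [T j, T i]"
    | (reflection) A where "A \<in> {X1, Y1, Z1}" "1 < k" "v = map gen [A, T 1, A, T 1]"
        "w = map gen [T 1, A, T 1, A]"
    | (pole_far) A i where "A \<in> {X1, Y1, Z1}" "2 \<le> i" "i < k" "v = map gen [A, T i]" "w = map gen [T i, A]"
    | (poles) "v = map gen [Z1]" "w = map gen [X1, Y1]"
    | (twist) A where "A \<in> {X1, Y1}" "v = [gen P, gen A, geninv P]" "w = [geninv Z1, gen A, gen Z1]"
    | (twist_Z) "v = [gen P, gen Z1, geninv P]" "w = [gen Z1]"
    | (twist_T) i where "1 \<le> i" "i < k" "v = [gen P, gen (T i), geninv P]" "w = [gen (T i)]"
  using assms unfolding braid_rels_def
proof (elim UnE, goal_cases)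
  case 1
  from 1(9) show ?case
    by (elim CollectE exE conjE Pair_inject) (rule 1(1))
next
  case 2
  from 2(9) show ?case
    by (elim CollectE exE conjE Pair_inject) (rule 2(2))
next
  case 3
  from 3(9) show ?case
    by (elim CollectE exE conjE Pair_inject) (rule 3(3))
next
  case 4
  from 4(9) show ?case
    by (elim CollectE exE conjE Pair_inject) (rule 4(4))
next
  case 5
  from 5(9) show ?case
    using 5(5,6,7) by auto
next
  case 6
  from 6(9) show ?case
    by (elim CollectE exE conjE Pair_inject) (rule 6(8))
qed

lemma replicate_split: "i + j = k \<Longrightarrow> replicate k x = replicate i x @ replicate j x"
  by (auto simp: replicate_add)

context quasitriangular_hopf_algebra
begin

context
  fixes M N V :: "('a, 'v) module"
  assumes M: "left_module U M" and N: "left_module U N" and V: "left_module U V"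
begin

private abbreviation "rep n \<equiv> replicate n V"
private abbreviation "c \<equiv> \<beta> [V] [V]"

lemma factor_mods: "mods [M]" "mods [N]" "mods [V]" "mods (rep n)" "mods (M # N # rep n)"
  using M N V by auto

lemmas typed = typing intertwiner_double_braiding isom_poles[THEN isom_intertwiner] factor_mods M N V

text \<open>Every generator acts as a small braid padded by identities. The following equations bring the
  padding into a form in which generators that occur in one relation have the same padding, so that the
  relation reduces to an identity of small braids.\<close>

lemma Rcheck_M_sq_eq: "Rcheck_M_sq U M N V (Suc n) = left_pole [M] [N] [V] \<boxtimes> \<I> (rep n)"
  by (simp add: Rcheck_M_sq_def left_pole_def double_braiding_def)

lemma Rcheck_N_sq_eq: "Rcheck_N_sq U M N V (Suc n) = right_pole [M] [N] [V] \<boxtimes> \<I> (rep n)"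
  using tprod_assoc[of "\<I> [M]" "double_braiding [N] [V]" "\<I> (rep n)"]
  by (simp add: Rcheck_N_sq_def right_pole_def typed flip: double_braiding_def)

lemma Rcheck_0_sq_eq: "Rcheck_0_sq U M N V (Suc n) = both_poles [M] [N] [V] \<boxtimes> \<I> (rep n)"
  by (simp add: Rcheck_0_sq_def both_poles_def double_braiding_def)

lemma Rcheck_P_eq: "Rcheck_P U M N V k = double_braiding [M] [N] \<boxtimes> \<I> (rep k)"
  by (simp add: Rcheck_P_def double_braiding_def)

lemma Rcheck_P_eq': "Rcheck_P U M N V (Suc n) = pole_twist [M] [N] [V] \<boxtimes> \<I> (rep n)"
  using tprod_assoc[of "double_braiding [M] [N]" "\<I> [V]" "\<I> (rep n)"]
  by (simp add: Rcheck_P_eq pole_twist_def typed tprod_tid)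

lemma Rcheck_i_eq: "Rcheck_i U M N V k i = \<I> ([M, N] @ rep (i - 1)) \<boxtimes> (c \<boxtimes> \<I> (rep (k - i - 1)))"
proof -
  have "\<I> ([M, N] @ rep (i - 1)) = \<I> [M] \<boxtimes> \<I> [N] \<boxtimes> \<I> (rep (i - 1))"
    by (simp add: tprod_tid typed)
  then show ?thesis
    by (simp only: Rcheck_i_def) (simp add: tprod_assoc typed)
qed

lemma braid_relation:
  assumes "1 \<le> i" "i + 1 < k"
  defines "R \<equiv> Rcheck_i U M N V k i" and "R' \<equiv> Rcheck_i U M N V k (i + 1)"
  shows "R \<bullet> R' \<bullet> R = R' \<bullet> R \<bullet> R'"
proof -
  let ?p = "\<I> ([M, N] @ rep (i - 1))" and ?q = "\<I> (rep (k - i - 2))"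
  have R: "R = ?p \<boxtimes> ((c \<boxtimes> \<I> [V]) \<boxtimes> ?q)"
  proof -
    have "\<I> (rep (k - i - 1)) = \<I> [V] \<boxtimes> ?q"
      using replicate_split[of 1 "k - i - 2" "k - i - 1" V] assms(2) by (simp add: tprod_tid typed)
    then show ?thesis
      by (simp add: R_def Rcheck_i_eq tprod_assoc typed)
  qed
  have R': "R' = ?p \<boxtimes> ((\<I> [V] \<boxtimes> c) \<boxtimes> ?q)"
  proof -
    have "\<I> ([M, N] @ rep i) = ?p \<boxtimes> \<I> [V]"
      using replicate_split[of "i - 1" 1 i V] assms(1) by (simp add: tprod_tid typed)
    moreover have "Rcheck_i U M N V k (i + 1) = \<I> ([M, N] @ rep i) \<boxtimes> (c \<boxtimes> ?q)"
      by (simp only: Rcheck_i_eq) simp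
    ultimately show ?thesis
      by (simp add: R'_def tprod_assoc typed)
  qed
  show ?thesis
    using yang_baxter[of "[V]" "[V]" "[V]"]
    by (simp add: R R' tprod_tid_left_tcomp tprod_tid_right_tcomp typed)
qed

text \<open>Crossings on disjoint pairs of strands commute by the interchange law; \<open>g\<close> is the second
  crossing, seen as a map on the strands to the right of the first one.\<close>

lemma braid_far_commute:
  assumes "1 \<le> i" "i + 2 \<le> j" "j < k"
  defines "R \<equiv> Rcheck_i U M N V k i" and "R' \<equiv> Rcheck_i U M N V k j"
  shows "R \<bullet> R' = R' \<bullet> R"
proof -
  let ?p = "\<I> ([M, N] @ rep (i - 1))"
  define g where "g = \<I> (rep (j - i - 2)) \<boxtimes> (c \<boxtimes> \<I> (rep (k - j - 1)))"
  have g: "intertwiner g" "src g = rep (k - i - 1)" "tgt g = rep (k - i - 1)"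
    using assms(1-3) replicate_split[of "j - i - 2" "Suc (Suc (k - j - 1))" "k - i - 1" V]
    by (simp_all add: g_def typed)
  have "\<I> ([M, N] @ rep (j - 1)) = ?p \<boxtimes> \<I> [V, V] \<boxtimes> \<I> (rep (j - i - 2))"
    using assms(1-3) replicate_split[of "i - 1" "Suc (Suc (j - i - 2))" "j - 1" V] by (simp add: tprod_tid typed)
  then have R': "R' = ?p \<boxtimes> (\<I> [V, V] \<boxtimes> g)"
    by (simp add: R'_def Rcheck_i_eq g_def tprod_assoc typed)
  show ?thesis
    using commute_disjoint[of c "[V, V]" g "rep (k - i - 1)"] g
    by (simp add: R_def Rcheck_i_eq R' tprod_tid_left_tcomp typed)
qed

text \<open>One strand of the padding takes part in the relation and is split off.\<close>

lemma pole_reflection_padded: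
  fixes n :: nat
  assumes "intertwiner f" "src f = [M, N, V]" "tgt f = [M, N, V]"
    and "(f \<boxtimes> \<I> [V]) \<bullet> (\<I> [M, N] \<boxtimes> c) \<bullet> (f \<boxtimes> \<I> [V]) \<bullet> (\<I> [M, N] \<boxtimes> c)
      = (\<I> [M, N] \<boxtimes> c) \<bullet> (f \<boxtimes> \<I> [V]) \<bullet> (\<I> [M, N] \<boxtimes> c) \<bullet> (f \<boxtimes> \<I> [V])"
  defines "F \<equiv> f \<boxtimes> \<I> (rep (Suc n))" and "R \<equiv> Rcheck_i U M N V (Suc (Suc n)) 1"
  shows "F \<bullet> R \<bullet> F \<bullet> R = R \<bullet> F \<bullet> R \<bullet> F"
proof -
  have "\<I> (rep (Suc n)) = \<I> [V] \<boxtimes> \<I> (rep n)"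
    by (simp add: tprod_tid typed)
  then have F: "F = (f \<boxtimes> \<I> [V]) \<boxtimes> \<I> (rep n)"
    by (simp add: F_def tprod_assoc typed assms(1))
  have R: "R = (\<I> [M, N] \<boxtimes> c) \<boxtimes> \<I> (rep n)"
    by (simp add: R_def Rcheck_i_eq tprod_assoc typed)
  show ?thesis
    using assms(4) by (simp add: F R tprod_tid_right_tcomp typed assms(1-3))
qed

lemma pole_far_commute:
  assumes "intertwiner f" "src f = [M, N, V]" "tgt f = [M, N, V]" "2 \<le> i" "i < Suc n"
  defines "R \<equiv> Rcheck_i U M N V (Suc n) i"
  shows "(f \<boxtimes> \<I> (rep n)) \<bullet> R = R \<bullet> (f \<boxtimes> \<I> (rep n))"
proof -
  define g where "g = \<I> (rep (i - 2)) \<boxtimes> (c \<boxtimes> \<I> (rep (n - i)))"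
  have g: "intertwiner g" "src g = rep n" "tgt g = rep n"
    using assms(4,5) replicate_split[of "i - 2" "Suc (Suc (n - i))" n V] by (simp_all add: g_def typed)
  have "\<I> ([M, N] @ rep (i - 1)) = \<I> [M, N, V] \<boxtimes> \<I> (rep (i - 2))"
    using assms(4) replicate_split[of 1 "i - 2" "i - 1" V] by (simp add: tprod_tid typed)
  then have "R = \<I> [M, N, V] \<boxtimes> g"
    by (simp add: R_def Rcheck_i_eq g_def tprod_assoc typed)
  then show ?thesis
    using commute_disjoint[OF assms(1-3) g] by simp
qed

lemma twist_braid_commute:
  assumes "1 \<le> i" "i < k"
  defines "R \<equiv> Rcheck_i U M N V k i" and "Q \<equiv> Rcheck_P U M N V k"
  shows "Q \<bullet> R = R \<bullet> Q"
proof -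
  define g where "g = \<I> (rep (i - 1)) \<boxtimes> (c \<boxtimes> \<I> (rep (k - i - 1)))"
  have g: "intertwiner g" "src g = rep k" "tgt g = rep k"
    using assms(1,2) replicate_split[of "i - 1" "Suc (Suc (k - i - 1))" k V] by (simp_all add: g_def typed)
  have "\<I> ([M, N] @ rep (i - 1)) = \<I> [M, N] \<boxtimes> \<I> (rep (i - 1))"
    by (simp add: tprod_tid typed)
  then have "R = \<I> [M, N] \<boxtimes> g"
    by (simp add: R_def Rcheck_i_eq g_def tprod_assoc typed)
  then show ?thesis
    using commute_disjoint[of "double_braiding [M] [N]" "[M, N]" g] g by (simp add: Q_def Rcheck_P_eq typed)
qed

lemma braid_action_isom:
  assumes "s \<in> braid_gens (Suc n)"
  shows "isom (braid_action U M N V (Suc n) s)"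
    and "src (braid_action U M N V (Suc n) s) = M # N # rep (Suc n)"
    and "tgt (braid_action U M N V (Suc n) s) = M # N # rep (Suc n)"
proof -
  have r: "rep (i - 1) @ V # V # rep (Suc n - i - 1) = V # rep n" if "1 \<le> i" "i < Suc n" for i
    using that replicate_split[of "i - 1" "Suc (Suc (Suc n - i - 1))" "Suc n" V] by simp
  show "isom (braid_action U M N V (Suc n) s)"
    "src (braid_action U M N V (Suc n) s) = M # N # rep (Suc n)"
    "tgt (braid_action U M N V (Suc n) s) = M # N # rep (Suc n)"
    using assms r
    by (auto simp: braid_gens_def Rcheck_M_sq_eq Rcheck_N_sq_eq Rcheck_0_sq_eq Rcheck_P_eq' Rcheck_i_eq
        isom_tprod isom_tid isom_poles isom_braiding factor_mods M N V)
qed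

theorem braid_action_relations:
  fixes n :: nat
  defines "W \<equiv> tensor_module U (M # N # rep (Suc n))"
  defines "H \<equiv> units_of (End_ring U W)" and "f \<equiv> \<lambda>s. app (braid_action U M N V (Suc n) s)"
  assumes "(v, w) \<in> braid_rels (Suc n)"
  shows "eval_word H f v = eval_word H f w"
proof -
  interpret W: left_module U W
    unfolding W_def by (rule left_module_tensor_module) (rule factor_mods)
  interpret E: ring "End_ring U W"
    by (rule W.End_ring_ring)
  interpret H: group H
    unfolding H_def by (rule E.units_group)
  let ?b = "braid_action U M N V (Suc n)"
  have f: "f s \<in> carrier H" if "s \<in> braid_gens (Suc n)" for s
    unfolding f_def H_def units_of_carrier W_def using braid_action_isom[OF that] by (rule app_Units)
  have int: "intertwiner (?b s)" "src (?b s) = M # N # rep (Suc n)" "tgt (?b s) = M # N # rep (Suc n)"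
    if "s \<in> braid_gens (Suc n)" for s
    using braid_action_isom[OF that] by (auto intro: isom_intertwiner)
  have mult: "app g \<otimes>\<^bsub>H\<^esub> app h = app (g \<bullet> h)" if "src h = M # N # rep (Suc n)" for g h
    unfolding H_def units_of_mult W_def using that by (rule app_End_mult)
  have pole: "X1 \<in> braid_gens (Suc n)" "Y1 \<in> braid_gens (Suc n)" "Z1 \<in> braid_gens (Suc n)" "P \<in> braid_gens (Suc n)"
    by (auto simp: braid_gens_def)
  have strand: "braid_gen.T i \<in> braid_gens (Suc n)" if "1 \<le> i" "i < Suc n" for i
    using that by (auto simp: braid_gens_def)
  note poles = Rcheck_M_sq_eq Rcheck_N_sq_eq Rcheck_0_sq_eq Rcheck_P_eq'
  note pole_isom = isom_poles[OF factor_mods(1,2,3), THEN isom_intertwiner]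
  have pole_cases: "\<exists>g. ?b A = g \<boxtimes> \<I> (rep n) \<and> intertwiner g \<and> src g = [M, N, V] \<and> tgt g = [M, N, V] \<and>
      (g \<boxtimes> \<I> [V]) \<bullet> (\<I> [M, N] \<boxtimes> c) \<bullet> (g \<boxtimes> \<I> [V]) \<bullet> (\<I> [M, N] \<boxtimes> c)
        = (\<I> [M, N] \<boxtimes> c) \<bullet> (g \<boxtimes> \<I> [V]) \<bullet> (\<I> [M, N] \<boxtimes> c) \<bullet> (g \<boxtimes> \<I> [V])"
    if A: "A \<in> {X1, Y1, Z1}" for A
  proof -
    consider "A = X1" | "A = Y1" | "A = Z1"
      using A by blast
    then show ?thesis
    proof cases
      case 1
      show ?thesis
        using left_pole_reflection[OF factor_mods(1,2,3)] pole_isom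
        by (intro exI[of _ "left_pole [M] [N] [V]"]) (simp add: 1 poles)
    next
      case 2
      show ?thesis
        using right_pole_reflection[OF factor_mods(1,2,3)] pole_isom
        by (intro exI[of _ "right_pole [M] [N] [V]"]) (simp add: 2 poles)
    next
      case 3
      show ?thesis
        using both_poles_reflection[OF factor_mods(1,2,3)] pole_isom
        by (intro exI[of _ "both_poles [M] [N] [V]"]) (simp add: 3 poles)
    qed
  qed
  have z: "f Z1 = f X1 \<otimes>\<^bsub>H\<^esub> f Y1"
    using both_poles_eq[OF factor_mods(1,2,3)] int(2)[OF pole(2)]
    by (simp add: f_def mult) (simp add: poles tprod_tid_right_tcomp pole_isom factor_mods)
  have zp: "f Z1 \<otimes>\<^bsub>H\<^esub> f P = f P \<otimes>\<^bsub>H\<^esub> f Z1"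
    using both_poles_twist_commute[OF factor_mods(1,2,3)] int(2)[OF pole(3)] int(2)[OF pole(4)]
    by (simp add: f_def mult) (simp add: poles tprod_tid_right_tcomp pole_isom factor_mods)
  have zpy: "(f Z1 \<otimes>\<^bsub>H\<^esub> f P) \<otimes>\<^bsub>H\<^esub> f Y1 = f Y1 \<otimes>\<^bsub>H\<^esub> (f Z1 \<otimes>\<^bsub>H\<^esub> f P)"
    using full_twist_right_pole_commute[OF factor_mods(1,2,3)] int(2)[OF pole(2)] int(2)[OF pole(4)]
    by (simp add: f_def mult) (simp add: poles tprod_tid_right_tcomp pole_isom factor_mods intertwiner_tcomp)
  note conjugation = H.full_twist_conjugation[OF f[OF pole(1)] f[OF pole(2)] f[OF pole(3)] f[OF pole(4)] z zp zpy]
  note fc = f[OF pole(1)] f[OF pole(2)] f[OF pole(3)] f[OF pole(4)] f[OF strand]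
  from assms(4) show ?thesis
  proof (cases rule: braid_rels_cases)
    case (braid i)
    have s: "braid_gen.T i \<in> braid_gens (Suc n)" "braid_gen.T (i + 1) \<in> braid_gens (Suc n)"
      using braid by (auto intro: strand)
    show ?thesis
      using braid_relation[OF braid(1,2)] int(2)[OF s(1)] int(2)[OF s(2)] f[OF s(1)] f[OF s(2)]
      by (simp add: braid(3,4) gen_def f_def mult)
  next
    case (far i j)
    have s: "braid_gen.T i \<in> braid_gens (Suc n)" "braid_gen.T j \<in> braid_gens (Suc n)"
      using far by (auto intro: strand)
    have "Rcheck_i U M N V (Suc n) i \<bullet> Rcheck_i U M N V (Suc n) j = Rcheck_i U M N V (Suc n) j \<bullet> Rcheck_i U M N V (Suc n) i"
      using far braid_far_commute[of i j "Suc n"] braid_far_commute[of j i "Suc n"] by auto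
    then show ?thesis
      using int(2)[OF s(1)] int(2)[OF s(2)] f[OF s(1)] f[OF s(2)]
      by (simp add: far(6,7) gen_def f_def mult)
  next
    case (reflection A)
    obtain m where n: "n = Suc m"
      using reflection(2) by (cases n) auto
    have s: "A \<in> braid_gens (Suc n)" "braid_gen.T 1 \<in> braid_gens (Suc n)"
      using reflection pole by (auto intro!: strand)
    obtain g where g: "?b A = g \<boxtimes> \<I> (rep n)" "intertwiner g" "src g = [M, N, V]" "tgt g = [M, N, V]"
      "(g \<boxtimes> \<I> [V]) \<bullet> (\<I> [M, N] \<boxtimes> c) \<bullet> (g \<boxtimes> \<I> [V]) \<bullet> (\<I> [M, N] \<boxtimes> c)
        = (\<I> [M, N] \<boxtimes> c) \<bullet> (g \<boxtimes> \<I> [V]) \<bullet> (\<I> [M, N] \<boxtimes> c) \<bullet> (g \<boxtimes> \<I> [V])"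
      using pole_cases[OF reflection(1)] by blast
    have "?b A \<bullet> ?b (braid_gen.T 1) \<bullet> ?b A \<bullet> ?b (braid_gen.T 1) = ?b (braid_gen.T 1) \<bullet> ?b A \<bullet> ?b (braid_gen.T 1) \<bullet> ?b A"
      using pole_reflection_padded[OF g(2-5), of m] by (simp only: g(1)[unfolded n] n braid_action.simps)
    then show ?thesis
      using int(2)[OF s(1)] int(2)[OF s(2)] f[OF s(1)] f[OF s(2)]
      by (simp add: reflection(3,4) gen_def f_def mult del: braid_action.simps)
  next
    case (pole_far A i)
    have s: "A \<in> braid_gens (Suc n)" "braid_gen.T i \<in> braid_gens (Suc n)"
      using pole_far pole by (auto intro!: strand)
    obtain g where g: "?b A = g \<boxtimes> \<I> (rep n)" "intertwiner g" "src g = [M, N, V]" "tgt g = [M, N, V]"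
      using pole_cases[OF pole_far(1)] by blast
    have "?b A \<bullet> ?b (braid_gen.T i) = ?b (braid_gen.T i) \<bullet> ?b A"
      using pole_far_commute[OF g(2-4) pole_far(2,3)] by (simp only: g(1) braid_action.simps)
    then show ?thesis
      using int(2)[OF s(1)] int(2)[OF s(2)] f[OF s(1)] f[OF s(2)]
      by (simp add: pole_far(4,5) gen_def f_def mult del: braid_action.simps)
  next
    case poles
    show ?thesis
      using z fc(1-4) by (simp add: poles gen_def)
  next
    case (twist A)
    then show ?thesis
      using conjugation fc(1-4)
      by (auto simp: gen_def geninv_def)
  next
    case twist_Z
    show ?thesis
      using conjugation fc(1-4) by (simp add: twist_Z gen_def geninv_def)
  next
    case (twist_T i)
    have s: "braid_gen.T i \<in> braid_gens (Suc n)"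
      using twist_T by (auto intro: strand)
    have "f P \<otimes>\<^bsub>H\<^esub> f (braid_gen.T i) = f (braid_gen.T i) \<otimes>\<^bsub>H\<^esub> f P"
      using twist_braid_commute[OF twist_T(1,2)] int(2)[OF pole(4)] int(2)[OF s] by (simp add: f_def mult)
    then have "f P \<otimes>\<^bsub>H\<^esub> (f (braid_gen.T i) \<otimes>\<^bsub>H\<^esub> inv\<^bsub>H\<^esub> f P) = f (braid_gen.T i)"
      using fc(4) f[OF s] by (simp add: H.m_assoc flip: H.m_assoc[of "f P" "f (braid_gen.T i)"])
    then show ?thesis
      using fc(4) f[OF s] by (simp add: twist_T(3,4) gen_def geninv_def)
  qed
qed

end

end

theorem proposition5p1:
  fixes scale :: "complex \<Rightarrow> 'g::ab_group_add \<Rightarrow> 'g"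
    and bracket :: "'g \<Rightarrow> 'g \<Rightarrow> 'g"
    and form :: "'g \<Rightarrow> 'g \<Rightarrow> complex"
    and U :: "('k, 'u) ribbon_hopf"
    and M N V :: "('u, 'v) module"
    and k :: nat
  defines "W \<equiv> tensor_module U ([M, N] @ replicate k V)"
    and "ZB \<equiv> group_algebra (center_ring U) (ext_braid_group k)"
    and "b \<equiv> \<lambda>s. monomial (center_ring U) \<one>\<^bsub>U\<^esub> (bgen k s)"
  assumes "quadratic_lie_algebra scale bracket form"
    and "ribbon_hopf_algebra U"
    and "left_module U M" and "left_module U N" and "left_module U V"
    and "1 \<le> k"
  shows "\<exists>\<Phi>. \<Phi> \<in> ring_hom ZB (End_ring U W)
    \<and> left_module ZB (with_action W \<Phi>)
    \<and> (\<forall>z\<in>center U. \<forall>x\<in>carrier W.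
          \<Phi> (monomial (center_ring U) z \<one>\<^bsub>ext_braid_group k\<^esub>) x = z \<odot>\<^bsub>W\<^esub> x)
    \<and> (\<forall>i. 1 \<le> i \<and> i < k \<longrightarrow> \<Phi> (b (T i)) = app (Rcheck_i U M N V k i))
    \<and> \<Phi> (b X1) = app (Rcheck_M_sq U M N V k)
    \<and> \<Phi> (b Y1) = app (Rcheck_N_sq U M N V k)
    \<and> \<Phi> (b Z1) = app (Rcheck_0_sq U M N V k)
    \<and> \<Phi> (b P) = app (Rcheck_P U M N V k)
    \<and> (\<forall>a\<in>carrier ZB. \<forall>u\<in>carrier U. \<forall>x\<in>carrier W.
          \<Phi> a (u \<odot>\<^bsub>W\<^esub> x) = u \<odot>\<^bsub>W\<^esub> \<Phi> a x)"
proof -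
  interpret U: ribbon_hopf_algebra U by fact
  obtain n where k: "k = Suc n"
    using \<open>1 \<le> k\<close> by (cases k) auto
  have mods: "U.mods (M # N # replicate k V)"
    using assms by simp
  have W: "W = tensor_module U (M # N # replicate (Suc n) V)"
    by (simp add: W_def k)
  interpret W: left_module U W
    unfolding W using U.left_module_tensor_module[OF mods] by (simp add: k)
  let ?E = "End_ring U W"
  interpret E: ring ?E
    by (rule W.End_ring_ring)
  interpret H: group "units_of ?E"
    by (rule E.units_group)
  interpret B: group_presentation "braid_gens k" "braid_rels k"
    by unfold_locales (auto simp: braid_rels_def braid_gens_def gen_def geninv_def)
  have G: "group (ext_braid_group k)"
    unfolding ext_braid_group_def by (rule B.group_presented)
  let ?b = "braid_action U M N V k"
  have units: "app (?b s) \<in> carrier (units_of ?E)" if "s \<in> braid_gens k" for s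
    using U.app_Units[OF U.braid_action_isom[OF assms(6-8)]] that by (simp add: units_of_carrier W k)
  obtain \<rho> where \<rho>: "\<rho> \<in> hom (ext_braid_group k) (units_of ?E)"
    and \<rho>_gen: "\<And>s. s \<in> braid_gens k \<Longrightarrow> \<rho> (bgen k s) = app (?b s)"
  proof (rule B.presented_group_hom[OF H.is_group, of "\<lambda>s. app (?b s)"])
    show "(\<lambda>s. app (?b s)) \<in> braid_gens k \<rightarrow> carrier (units_of ?E)"
      using units by blast
    show "eval_word (units_of ?E) (\<lambda>s. app (?b s)) v = eval_word (units_of ?E) (\<lambda>s. app (?b s)) w"
      if "(v, w) \<in> braid_rels k" for v w
      using U.braid_action_relations[OF assms(6-8)] that by (simp add: W k)
  qed (use that in \<open>auto simp: bgen_def gen_def ext_braid_group_def\<close>)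
  have \<rho>_one: "\<rho> \<one>\<^bsub>ext_braid_group k\<^esub> = \<one>\<^bsub>?E\<^esub>"
    using hom_one[OF \<rho> G H.is_group] by (simp add: units_of_one)
  have \<rho>_carrier: "\<rho> g \<in> carrier ?E" if "g \<in> carrier (ext_braid_group k)" for g
    using \<rho> that E.Units_closed by (auto simp: hom_def units_of_carrier)
  have \<rho>': "\<rho> \<in> hom (ext_braid_group k) ?E"
    using \<rho> \<rho>_carrier by (auto simp: hom_def units_of_mult)
  define \<zeta> where "\<zeta> = (\<lambda>z. \<lambda>x\<in>carrier W. z \<odot>\<^bsub>W\<^esub> x)"
  have \<zeta>: "\<zeta> \<in> ring_hom (center_ring U) ?E"
    unfolding \<zeta>_def by (rule W.central_action_hom)
  have C: "cring (center_ring U)"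
    by (rule center_ring_cring) (rule U.U_ring)
  interpret A: group_algebra_setup "center_ring U" "ext_braid_group k"
    by (rule group_algebra_setup.intro[OF C G])
  have comm: "\<zeta> z \<otimes>\<^bsub>?E\<^esub> \<rho> g = \<rho> g \<otimes>\<^bsub>?E\<^esub> \<zeta> z"
    if "z \<in> carrier (center_ring U)" "g \<in> carrier (ext_braid_group k)" for z g
    using that End_ring_apply[OF \<rho>_carrier[OF that(2)]]
    by (auto simp: \<zeta>_def compose_def fun_eq_iff center_ring_def center_def W.action_closed)
  obtain \<Phi> where \<Phi>: "\<Phi> \<in> ring_hom ZB ?E"
    and \<Phi>_monomial: "\<And>z g. z \<in> carrier (center_ring U) \<Longrightarrow> g \<in> carrier (ext_braid_group k) \<Longrightarrow>
      \<Phi> (monomial (center_ring U) z g) = \<zeta> z \<otimes>\<^bsub>?E\<^esub> \<rho> g"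
    unfolding ZB_def using A.group_algebra_hom[OF E.ring_axioms \<zeta> \<rho>' \<rho>_one comm] by metis
  have bgen: "bgen k s \<in> carrier (ext_braid_group k)" if "s \<in> braid_gens k" for s
    using that B.cls_closed[of "[gen s]"] by (simp add: bgen_def ext_braid_group_def gen_def)
  have \<Phi>_b: "\<Phi> (b s) = app (?b s)" if "s \<in> braid_gens k" for s
  proof -
    have "\<zeta> \<one>\<^bsub>U\<^esub> = \<one>\<^bsub>?E\<^esub>"
      using ring_hom_one[OF \<zeta>] by (simp add: center_ring_def)
    moreover have "\<one>\<^bsub>U\<^esub> \<in> carrier (center_ring U)"
      by (auto simp: center_ring_def center_def)
    ultimately show ?thesis
      using \<Phi>_monomial[of "\<one>\<^bsub>U\<^esub>" "bgen k s"] bgen[OF that] \<rho>_gen[OF that] E.l_one[OF \<rho>_carrier[OF bgen[OF that]]]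
      by (simp add: b_def)
  qed
  have central: "\<Phi> (monomial (center_ring U) z \<one>\<^bsub>ext_braid_group k\<^esub>) x = z \<odot>\<^bsub>W\<^esub> x"
    if "z \<in> center U" "x \<in> carrier W" for z x
    using that \<Phi>_monomial[of z "\<one>\<^bsub>ext_braid_group k\<^esub>"] \<rho>_one A.G.one_closed
    by (simp add: center_ring_def compose_def \<zeta>_def)
  have ZB: "ring ZB"
    unfolding ZB_def by (rule A.group_algebra_ring)
  have gens: "X1 \<in> braid_gens k" "Y1 \<in> braid_gens k" "Z1 \<in> braid_gens k" "P \<in> braid_gens k"
    "\<And>i. 1 \<le> i \<Longrightarrow> i < k \<Longrightarrow> T i \<in> braid_gens k"
    by (auto simp: braid_gens_def)
  show ?thesis
    using \<Phi> W.left_module_with_action[OF ZB \<Phi>] central \<Phi>_b gens End_ring_apply(3)[OF ring_hom_closed[OF \<Phi>]]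
    by (intro exI[of _ \<Phi>] conjI) simp_all
qed

end
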